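(* Let $N\geq 1$, let $\Omega\subset\mathbb{R}^N$ be a smooth bounded domain, let $\lambda\in\mathbb{R}$, and let $\lambda_1$ be the first eigenvalue of the Laplace operator $-\Delta$ in $\Omega$ with Dirichlet boundary conditions on $\partial\Omega$. For a locally Lipschitz function $f:\mathbb{R}\to\mathbb{R}$ consider the problem $$-\Delta u=\lambda u+f(u)\ \text{ in }\Omega,\qquad u=0\ \text{ on }\partial\Omega. \qquad (P)$$ (i) If $\lambda\leq 0$, then for every locally Lipschitz function $f:\mathbb{R}\to\mathbb{R}$ satisfying $\int_0^s f(t)\,dt\leq 0$ for every $s\in\mathbb{R}$, the function $u\equiv 0$ is the unique solution to (P). (ii) If $\lambda\geq\lambda_1$, then there exists a locally Lipschitz function $f:\mathbb{R}\to\mathbb{R}$ satisfying $\int_0^s f(t)\,dt\leq 0$ for every $s\in\mathbb{R}$ such that there exists a nontrivial solution to (P).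
   Context: A solution to the problem $-\Delta u=\lambda u+f(u)$ in $\Omega$, $u=0$ on $\partial\Omega$, means a bounded weak solution: a function $u\in H_0^1(\Omega)\cap L^\infty(\Omega)$ such that $\int_\Omega \nabla u\cdot\nabla\varphi=\lambda\int_\Omega u\varphi+\int_\Omega f(u)\varphi$ for all $\varphi\in H_0^1(\Omega)$. (By regularity, every such solution is a classical solution.) A solution is nontrivial if it is not identically zero. *)

theory Defs
  imports "HOL-Analysis.Analysis"
begin

section \<open>Smooth functions and smooth bounded domains\<close>

primrec C_k :: "nat \<Rightarrow> ('a::euclidean_space \<Rightarrow> real) \<Rightarrow> bool" where
  "C_k 0 f \<longleftrightarrow> continuous_on UNIV f"
| "C_k (Suc k) f \<longleftrightarrow> (\<forall>x. f differentiable (at x)) \<and>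
     (\<forall>b\<in>Basis. C_k k (\<lambda>x. frechet_derivative f (at x) b))"

definition smooth :: "('a::euclidean_space \<Rightarrow> real) \<Rightarrow> bool" where
  "smooth f \<longleftrightarrow> (\<forall>k. C_k k f)"

text \<open>
  Near each boundary point, after relabelling (choice of \<open>b\<close>) and reorienting (choice of \<open>s\<close>)
  the coordinate axes, the set is the region above the graph of a smooth function of the
  remaining coordinates. The function \<open>\<gamma>\<close> is defined on the whole space, and the
  invariance condition says that it does not depend on the coordinate along \<open>b\<close>.
  In dimension one \<open>\<gamma>\<close> is therefore constant.
\<close>

definition smooth_boundary :: "'a::euclidean_space set \<Rightarrow> bool" where
  "smooth_boundary \<Omega> \<longleftrightarrow> (\<forall>p\<in>frontier \<Omega>. \<exists>r>0. \<exists>b\<in>Basis. \<exists>s\<in>{1, -1::real}. \<exists>\<gamma>.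
     smooth \<gamma> \<and> (\<forall>x t. \<gamma> (x + t *\<^sub>R b) = \<gamma> x) \<and>
     \<Omega> \<inter> ball p r = {x \<in> ball p r. s * (x \<bullet> b) > \<gamma> x})"

definition smooth_bounded_domain :: "'a::euclidean_space set \<Rightarrow> bool" where
  "smooth_bounded_domain \<Omega> \<longleftrightarrow>
     open \<Omega> \<and> connected \<Omega> \<and> \<Omega> \<noteq> {} \<and> bounded \<Omega> \<and> smooth_boundary \<Omega>"

section \<open>Sobolev spaces\<close>

text \<open>
  Elements of the function spaces on \<open>\<Omega>\<close> are represented by functions on the whole space,
  of which only the values almost everywhere in \<open>\<Omega>\<close> matter.
\<close>

definition test_functions :: "'a::euclidean_space set \<Rightarrow> ('a \<Rightarrow> real) set" where
  "test_functions \<Omega> =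
     {\<phi>. smooth \<phi> \<and> compact (closure {x. \<phi> x \<noteq> 0}) \<and> closure {x. \<phi> x \<noteq> 0} \<subseteq> \<Omega>}"

definition L2 :: "'a::euclidean_space set \<Rightarrow> ('a \<Rightarrow> 'b::euclidean_space) set" where
  "L2 \<Omega> = {u. u \<in> borel_measurable (lebesgue_on \<Omega>) \<and>
     integrable (lebesgue_on \<Omega>) (\<lambda>x. (norm (u x))\<^sup>2)}"

definition L_infinity :: "'a::euclidean_space set \<Rightarrow> ('a \<Rightarrow> real) set" where
  "L_infinity \<Omega> = {u. u \<in> borel_measurable (lebesgue_on \<Omega>) \<and>
     (\<exists>C. AE x in lebesgue_on \<Omega>. \<bar>u x\<bar> \<le> C)}"

definition has_weak_gradient ::
    "'a::euclidean_space set \<Rightarrow> ('a \<Rightarrow> real) \<Rightarrow> ('a \<Rightarrow> 'a) \<Rightarrow> bool" where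
  "has_weak_gradient \<Omega> u g \<longleftrightarrow> g \<in> L2 \<Omega> \<and>
     (\<forall>\<phi>\<in>test_functions \<Omega>. \<forall>b\<in>Basis.
        (LINT x|lebesgue_on \<Omega>. u x * frechet_derivative \<phi> (at x) b) =
        - (LINT x|lebesgue_on \<Omega>. (g x \<bullet> b) * \<phi> x))"

definition H1 :: "'a::euclidean_space set \<Rightarrow> ('a \<Rightarrow> real) set" where
  "H1 \<Omega> = {u \<in> L2 \<Omega>. \<exists>g. has_weak_gradient \<Omega> u g}"

text \<open>
  A weak gradient on an open set is unique up to equality almost everywhere, so the integrals
  below do not depend on the representative that is chosen here.
\<close>

definition weak_gradient :: "'a::euclidean_space set \<Rightarrow> ('a \<Rightarrow> real) \<Rightarrow> 'a \<Rightarrow> 'a" where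
  "weak_gradient \<Omega> u = (SOME g. has_weak_gradient \<Omega> u g)"

definition H1_norm :: "'a::euclidean_space set \<Rightarrow> ('a \<Rightarrow> real) \<Rightarrow> real" where
  "H1_norm \<Omega> u = sqrt ((LINT x|lebesgue_on \<Omega>. (u x)\<^sup>2) +
     (LINT x|lebesgue_on \<Omega>. (norm (weak_gradient \<Omega> u x))\<^sup>2))"

text \<open>The closure of the test functions in \<open>H1 \<Omega>\<close>.\<close>

definition H1_0 :: "'a::euclidean_space set \<Rightarrow> ('a \<Rightarrow> real) set" where
  "H1_0 \<Omega> = {u \<in> H1 \<Omega>. \<exists>\<phi>. (\<forall>n. \<phi> n \<in> test_functions \<Omega>) \<and>
     (\<lambda>n::nat. H1_norm \<Omega> (\<lambda>x. u x - \<phi> n x)) \<longlonglongrightarrow> 0}"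

section \<open>Dirichlet eigenvalues and bounded weak solutions\<close>

definition zero_ae_on :: "'a::euclidean_space set \<Rightarrow> ('a \<Rightarrow> real) \<Rightarrow> bool" where
  "zero_ae_on \<Omega> u \<longleftrightarrow> (AE x in lebesgue_on \<Omega>. u x = 0)"

definition dirichlet_eigenvalue :: "'a::euclidean_space set \<Rightarrow> real \<Rightarrow> bool" where
  "dirichlet_eigenvalue \<Omega> \<mu> \<longleftrightarrow> (\<exists>u\<in>H1_0 \<Omega>. \<not> zero_ae_on \<Omega> u \<and>
     (\<forall>\<phi>\<in>H1_0 \<Omega>. (LINT x|lebesgue_on \<Omega>. weak_gradient \<Omega> u x \<bullet> weak_gradient \<Omega> \<phi> x) =
        \<mu> * (LINT x|lebesgue_on \<Omega>. u x * \<phi> x)))"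

definition first_dirichlet_eigenvalue :: "'a::euclidean_space set \<Rightarrow> real" where
  "first_dirichlet_eigenvalue \<Omega> = (LEAST \<mu>. dirichlet_eigenvalue \<Omega> \<mu>)"

definition bounded_weak_solution ::
    "'a::euclidean_space set \<Rightarrow> real \<Rightarrow> (real \<Rightarrow> real) \<Rightarrow> ('a \<Rightarrow> real) \<Rightarrow> bool" where
  "bounded_weak_solution \<Omega> lam f u \<longleftrightarrow> u \<in> H1_0 \<Omega> \<inter> L_infinity \<Omega> \<and>
     (\<forall>\<phi>\<in>H1_0 \<Omega>. (LINT x|lebesgue_on \<Omega>. weak_gradient \<Omega> u x \<bullet> weak_gradient \<Omega> \<phi> x) =
        lam * (LINT x|lebesgue_on \<Omega>. u x * \<phi> x) + (LINT x|lebesgue_on \<Omega>. f (u x) * \<phi> x))"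

section \<open>The nonlinearity\<close>

definition locally_Lipschitz :: "(real \<Rightarrow> real) \<Rightarrow> bool" where
  "locally_Lipschitz f \<longleftrightarrow> (\<forall>x. \<exists>r>0. \<exists>L. L-lipschitz_on (cball x r) f)"

text \<open>The interval integral is oriented: for \<open>s < 0\<close> it is minus the integral over \<open>[s, 0]\<close>.\<close>

definition nonpositive_primitive :: "(real \<Rightarrow> real) \<Rightarrow> bool" where
  "nonpositive_primitive f \<longleftrightarrow> (\<forall>s::real. (LBINT t=ereal 0..ereal s. f t) \<le> 0)"

end

theory Submission
  imports Defs "HOL-Complex_Analysis.Great_Picard"
begin

text \<open>
  (i) Let \<open>g s = lam * s + f s\<close> with primitive \<open>G\<close>; then \<open>G \<le> 0\<close> and \<open>g 0 = 0\<close>. The one-dimensional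
  solutions of \<open>W'' = - g W\<close> with energy \<open>E > 0\<close> satisfy \<open>W' = sqrt (2 * (E - G W)) > 0\<close>, hence are
  monotone, and they tend to \<open>0\<close> on bounded intervals as \<open>E\<close> does, because \<open>G\<close> is quadratically small
  at \<open>0\<close>. A solution \<open>u\<close> lies below every such profile \<open>W (x \<bullet> b + c)\<close> that is positive on the
  domain: after the change of variable \<open>W (\<Psi> s) = s\<close>, the difference \<open>\<Psi> u - (x \<bullet> b + c)\<close> solves an equation
  without zeroth-order term, so it obeys a maximum principle, which is obtained by testing with
  \<open>\<Psi>' u * exp (- A / (\<Psi> u - (x \<bullet> b + c)))\<close>. Hence \<open>u \<le> 0\<close>, and \<open>u \<ge> 0\<close> by symmetry.

  (ii) With \<open>f s = - (lam - \<lambda>\<^sub>1) * s\<close> a first eigenfunction \<open>u\<close> is a solution. It exists by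
  Rellich's theorem, and it is bounded because \<open>\<bar>u\<bar>\<close>, extended by zero, is a subsolution of
  \<open>- \<Delta> v = \<lambda>\<^sub>1 v\<close> on the whole space and is therefore dominated by its evolution under the heat flow.
\<close>

section \<open>Calculus of smooth functions\<close>

text \<open>Testing the equation in (i) with \<open>u\<close> leaves the integral of u g(u), whose
  sign is not controlled by G \<le> 0. The primitive acts through the energy W'^2 / 2 + G(W), which
  one-dimensional solutions conserve: E > 0 and G \<le> 0 leave W' no zero, so a profile can be
  inverted, and as a function of x \<bullet> b + c it solves the equation in every dimension. The
  remaining obstacle is that the equation for z = \<Psi> u - (x \<bullet> b + c) contains the square
  of the gradient. The weight T(z) = exp(- A / z) has T' / T = A / z^2, which exceeds any given
  constant on a bounded range of z once A is large, so the T' term absorbs the others. T extends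
  smoothly by zero, and z < 0 wherever u = 0 because \<Psi> 0 = 0, so these test functions have zero
  boundary values. In (ii) the heat kernel is an explicit supply of nonnegative smooth weights,
  which may be positive up to and beyond the boundary.\<close>

lemma C_k_SucI:
  assumes "\<And>x. (f has_derivative f' x) (at x)"
    and "\<And>b. b \<in> Basis \<Longrightarrow> C_k k (\<lambda>x. f' x b)"
  shows "C_k (Suc k) f"
proof -
  have "frechet_derivative f (at x) = f' x" for x
    using frechet_derivative_at[OF assms(1)] by simp
  then show ?thesis
    using assms by (auto simp: differentiable_def)
qed

lemma C_k_SucD:
  assumes "C_k (Suc k) f"
  shows "(f has_derivative frechet_derivative f (at x)) (at x)"
    and "b \<in> Basis \<Longrightarrow> C_k k (\<lambda>x. frechet_derivative f (at x) b)"
  using assms by (auto simp: frechet_derivative_works)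

lemma C_k_Suc_imp: "C_k (Suc k) f \<Longrightarrow> C_k k f"
proof (induction k arbitrary: f)
  case 0
  then show ?case
    by (auto intro!: differentiable_imp_continuous_on simp: differentiable_on_def)
next
  case (Suc k)
  have "C_k (Suc k) f"
    using C_k_SucD[OF Suc.prems] Suc.IH by (intro C_k_SucI) auto
  then show ?case .
qed

lemma C_k_continuous: "C_k k f \<Longrightarrow> continuous_on UNIV f"
proof (induction k)
  case (Suc k)
  then show ?case using C_k_Suc_imp by blast
qed simp

lemma C_k_const [simp]: "C_k k (\<lambda>x. c)"
proof (induction k arbitrary: c)
  case (Suc k)
  have "((\<lambda>x. c) has_derivative (\<lambda>h. 0)) (at x)" for x :: 'a
    by simp
  from C_k_SucI[OF this] show ?case using Suc by blast
qed simp

lemma C_k_bounded_linear: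
  assumes "bounded_linear f"
  shows "C_k k f"
proof (cases k)
  case 0
  then show ?thesis using assms by (simp add: linear_continuous_on)
next
  case (Suc n)
  then show ?thesis
    using bounded_linear_imp_has_derivative[OF assms] by (simp del: C_k.simps, intro C_k_SucI) auto
qed

lemma C_k_add: "C_k k f \<Longrightarrow> C_k k g \<Longrightarrow> C_k k (\<lambda>x. f x + g x)"
proof (induction k arbitrary: f g)
  case 0
  then show ?case by (simp add: continuous_on_add)
next
  case (Suc k)
  show ?case
    by (rule C_k_SucI[OF has_derivative_add[OF C_k_SucD(1)[OF Suc.prems(1)] C_k_SucD(1)[OF Suc.prems(2)]]])
       (auto intro!: Suc.IH C_k_SucD(2) Suc.prems)
qed

lemma C_k_mult: "C_k k f \<Longrightarrow> C_k k g \<Longrightarrow> C_k k (\<lambda>x. f x * g x)"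
proof (induction k arbitrary: f g)
  case 0
  then show ?case by (simp add: continuous_on_mult)
next
  case (Suc k)
  show ?case
    by (rule C_k_SucI[OF has_derivative_mult[OF C_k_SucD(1)[OF Suc.prems(1)] C_k_SucD(1)[OF Suc.prems(2)]]])
       (intro C_k_add Suc.IH C_k_SucD(2) C_k_Suc_imp[OF Suc.prems(1)] C_k_Suc_imp[OF Suc.prems(2)] Suc.prems)
qed

text \<open>Since the outer function is real, the chain rule reads S'(f x) times the derivative of
  f. In this product form the induction hypothesis, generalised over S and f, handles the first
  factor and \<open>C_k_mult\<close> the product.\<close>

lemma C_k_compose:
  fixes S :: "real \<Rightarrow> real"
  shows "C_k k S \<Longrightarrow> C_k k f \<Longrightarrow> C_k k (\<lambda>x. S (f x))"
proof (induction k arbitrary: S f)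
  case 0
  then show ?case using continuous_on_compose2[of UNIV S UNIV f] by simp
next
  case (Suc k)
  have chain: "((\<lambda>x. S (f x)) has_derivative
      (\<lambda>h. frechet_derivative S (at (f x)) (frechet_derivative f (at x) h))) (at x)" for x
    using has_derivative_compose[OF C_k_SucD(1)[OF Suc.prems(2)] C_k_SucD(1)[OF Suc.prems(1)]] .
  have scale: "frechet_derivative S (at t) 1 * h = frechet_derivative S (at t) h" for t h
  proof -
    have "linear (frechet_derivative S (at t))"
      using Suc.prems(1) by (intro linear_frechet_derivative) simp
    from linear_cmul[OF this, of h 1] show ?thesis by simp
  qed
  have D: "((\<lambda>x. S (f x)) has_derivative
      (\<lambda>h. frechet_derivative S (at (f x)) 1 * frechet_derivative f (at x) h)) (at x)" for x
    unfolding scale by (rule chain)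
  have "C_k k (\<lambda>x. frechet_derivative S (at (f x)) 1)"
    by (rule Suc.IH[OF C_k_SucD(2)[OF Suc.prems(1)] C_k_Suc_imp[OF Suc.prems(2)]]) simp
  then show ?case
    by (intro C_k_SucI[OF D] C_k_mult C_k_SucD(2)[OF Suc.prems(2)])
qed

lemma C_k_real_SucI:
  fixes S :: "real \<Rightarrow> real"
  assumes "\<And>t. (S has_real_derivative S' t) (at t)" "C_k k S'"
  shows "C_k (Suc k) S"
  by (rule C_k_SucI[OF assms(1)[unfolded has_field_derivative_def]]) (simp add: assms)

text \<open>Differentiability and derivatives are local, so the C^k function h that f agrees with
  may change from point to point. This serves functions glued by a case distinction on the
  domain.\<close>

lemma C_k_local:
  assumes "\<And>x. \<exists>U h. open U \<and> x \<in> U \<and> C_k k h \<and> (\<forall>y\<in>U. f y = h y)"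
  shows "C_k k f"
  using assms
proof (induction k arbitrary: f)
  case 0
  have "isCont f x" for x
  proof -
    obtain U h where U: "open U" "x \<in> U" "C_k 0 h" "\<forall>y\<in>U. f y = h y" using 0 by blast
    have "isCont h x" using U by (simp add: continuous_on_eq_continuous_at)
    moreover have "\<forall>\<^sub>F y in nhds x. f y = h y"
      using U eventually_nhds by blast
    ultimately show "isCont f x" by (simp add: isCont_cong)
  qed
  then show ?case by (simp add: continuous_at_imp_continuous_on)
next
  case (Suc k)
  \<comment> \<open>The derivative is recorded on all of U, not only at x: the induction hypothesis
    asks for agreement of the partial derivatives with those of h on a neighbourhood.\<close>
  have loc: "\<exists>U h. open U \<and> x \<in> U \<and> C_k (Suc k) h \<and> (\<forall>y\<in>U. f y = h y) \<and>
     (\<forall>y\<in>U. (f has_derivative frechet_derivative h (at y)) (at y))" for x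
  proof -
    obtain U h where U: "open U" "x \<in> U" "C_k (Suc k) h" "\<forall>y\<in>U. f y = h y" using Suc.prems by blast
    have "(f has_derivative frechet_derivative h (at y)) (at y)" if "y \<in> U" for y
      using has_derivative_transform_within_open[OF C_k_SucD(1)[OF U(3)] U(1) that] U(4) by simp
    with U show ?thesis by blast
  qed
  have D: "(f has_derivative frechet_derivative f (at x)) (at x)" for x
    using loc[of x] by (metis differentiableI frechet_derivative_works)
  show ?case
  proof (rule C_k_SucI[OF D])
    fix b :: 'a assume b: "b \<in> Basis"
    show "C_k k (\<lambda>x. frechet_derivative f (at x) b)"
    proof (rule Suc.IH)
      fix x
      obtain U h where U: "open U" "x \<in> U" "C_k (Suc k) h" 
        "\<forall>y\<in>U. (f has_derivative frechet_derivative h (at y)) (at y)"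
        using loc[of x] by blast
      have "\<forall>y\<in>U. frechet_derivative f (at y) b = frechet_derivative h (at y) b"
        using U(4) D has_derivative_unique by metis
      then show "\<exists>U h. open U \<and> x \<in> U \<and> C_k k h \<and> (\<forall>y\<in>U. frechet_derivative f (at y) b = h y)"
        using U C_k_SucD(2)[OF U(3) b] by blast
    qed
  qed
qed

lemma smoothD:
  assumes "smooth f"
  shows "(f has_derivative frechet_derivative f (at x)) (at x)"
    and "b \<in> Basis \<Longrightarrow> smooth (\<lambda>x. frechet_derivative f (at x) b)"
    and "continuous_on UNIV f"
proof -
  have *: "C_k k f" for k using assms by (simp add: smooth_def)
  show "(f has_derivative frechet_derivative f (at x)) (at x)"
    by (rule C_k_SucD(1)[OF *[of "Suc 0"]])
  show "b \<in> Basis \<Longrightarrow> smooth (\<lambda>x. frechet_derivative f (at x) b)"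
    unfolding smooth_def by (intro allI C_k_SucD(2)[OF *])
  show "continuous_on UNIV f" by (rule C_k_continuous[OF *])
qed

lemma smooth_realI:
  fixes S :: "real \<Rightarrow> real"
  assumes "\<And>t. (S has_real_derivative S' t) (at t)" "smooth S'"
  shows "smooth S"
proof -
  have "C_k (Suc k) S" for k
    by (rule C_k_real_SucI[OF assms(1)]) (use assms(2) in \<open>auto simp: smooth_def\<close>)
  then show ?thesis by (simp add: smooth_def C_k_Suc_imp del: C_k.simps)
qed

lemma smooth_const [simp]: "smooth (\<lambda>x. c)"
  by (simp add: smooth_def)

lemma smooth_bounded_linear: "bounded_linear f \<Longrightarrow> smooth f"
  by (simp add: smooth_def C_k_bounded_linear)

lemma smooth_ident [simp]: "smooth (\<lambda>x::real. x)"
  by (simp add: smooth_bounded_linear bounded_linear_ident)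

lemma smooth_inner_left [simp]: "smooth (\<lambda>x. x \<bullet> b)"
  by (simp add: smooth_bounded_linear bounded_linear_inner_left)

lemma smooth_add: "smooth f \<Longrightarrow> smooth g \<Longrightarrow> smooth (\<lambda>x. f x + g x)"
  by (simp add: smooth_def C_k_add)

lemma smooth_mult: "smooth f \<Longrightarrow> smooth g \<Longrightarrow> smooth (\<lambda>x. f x * g x)"
  by (simp add: smooth_def C_k_mult)

lemma smooth_compose:
  fixes S :: "real \<Rightarrow> real"
  shows "smooth S \<Longrightarrow> smooth f \<Longrightarrow> smooth (\<lambda>x. S (f x))"
  by (simp add: smooth_def C_k_compose)

lemma smooth_minus: "smooth f \<Longrightarrow> smooth (\<lambda>x. - f x)"
  using smooth_mult[of "\<lambda>x. -1" f] by simp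

lemma smooth_diff: "smooth f \<Longrightarrow> smooth g \<Longrightarrow> smooth (\<lambda>x. f x - g x)"
  using smooth_add[OF _ smooth_minus, of f g] by simp

lemma smooth_power: "smooth f \<Longrightarrow> smooth (\<lambda>x. f x ^ n)"
  by (induction n) (auto intro: smooth_mult)

lemma smooth_sum: "(\<And>i. i \<in> I \<Longrightarrow> smooth (f i)) \<Longrightarrow> smooth (\<lambda>x. \<Sum>i\<in>I. f i x)"
  by (induction I rule: infinite_finite_induct) (auto intro: smooth_add)

lemma smooth_prod: "(\<And>i. i \<in> I \<Longrightarrow> smooth (f i)) \<Longrightarrow> smooth (\<lambda>x. \<Prod>i\<in>I. f i x)"
  by (induction I rule: infinite_finite_induct) (auto intro: smooth_mult)

lemma smooth_local:
  assumes "\<And>x. \<exists>U h. open U \<and> x \<in> U \<and> smooth h \<and> (\<forall>y\<in>U. f y = h y)"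
  shows "smooth f"
  using assms unfolding smooth_def by (meson C_k_local)

text \<open>Closure under differentiation allows an induction on k over the whole family at once, in
  place of a formula for the k-th derivative.\<close>

lemma smooth_real_family:
  fixes F :: "(real \<Rightarrow> real) set"
  assumes "\<And>f. f \<in> F \<Longrightarrow> \<exists>f'\<in>F. \<forall>t. (f has_real_derivative f' t) (at t)" "f \<in> F"
  shows "smooth f"
proof -
  have "C_k k f" if "f \<in> F" for f k
    using that
  proof (induction k arbitrary: f)
    case 0
    then obtain f' where "\<forall>t. (f has_real_derivative f' t) (at t)" using assms by blast
    then have "isCont f t" for t using DERIV_isCont by blast
    then show ?case by (simp add: continuous_at_imp_continuous_on)
  next
    case (Suc k)
    then show ?case using assms C_k_real_SucI by metis
  qed
  then show ?thesis using assms(2) by (simp add: smooth_def)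
qed

lemma smooth_exp: "smooth (exp :: real \<Rightarrow> real)"
  by (rule smooth_real_family[of "{exp}"]) (auto intro: DERIV_exp)

text \<open>The derivative of 1 / f is a product of - f' and two copies of 1 / f, so C^k regularity
  of 1 / f itself is the induction hypothesis that gives C^(k+1).\<close>

lemma smooth_inverse:
  assumes "smooth f" "\<And>x. f x \<noteq> 0"
  shows "smooth (\<lambda>x. inverse (f x))"
proof -
  have D: "((\<lambda>x. inverse (f x)) has_derivative
     (\<lambda>h. - (inverse (f x) * frechet_derivative f (at x) h * inverse (f x)))) (at x)" for x
    by (rule Deriv.has_derivative_inverse[OF assms(2) smoothD(1)[OF assms(1)]])
  have "C_k k (\<lambda>x. inverse (f x))" for k
  proof (induction k)
    case 0
    then show ?case using smoothD(3)[OF assms(1)] assms(2) by (auto intro: continuous_on_inverse)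
  next
    case (Suc k)
    show ?case
    proof (rule C_k_SucI[OF D])
      fix b :: 'a assume "b \<in> Basis"
      then have "C_k k (\<lambda>x. frechet_derivative f (at x) b)"
        using smoothD(2)[OF assms(1)] by (simp add: smooth_def)
      then have "C_k k (\<lambda>x. (-1) * (inverse (f x) * frechet_derivative f (at x) b * inverse (f x)))"
        by (intro C_k_mult Suc C_k_const)
      then show "C_k k (\<lambda>x. - (inverse (f x) * frechet_derivative f (at x) b * inverse (f x)))"
        by simp
    qed
  qed
  then show ?thesis by (simp add: smooth_def)
qed

section \<open>A smooth function that is flat at zero\<close>

definition flat_exp :: "real \<Rightarrow> real" where
  "flat_exp t = (if t > 0 then exp (- (1 / t)) else 0)"

text \<open>With x = 1 / t this is the decay at infinity of a polynomial times exp(- x). It controls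
  the difference quotients at zero of all derivatives of \<open>flat_exp\<close>.\<close>

lemma poly_exp_flat_tendsto:
  "((\<lambda>t. poly P (1 / t) * exp (- (1 / t))) \<longlongrightarrow> 0) (at_right (0::real))"
proof -
  have *: "((\<lambda>x. poly P x * exp (- x)) \<longlongrightarrow> 0) (at_top :: real filter)"
  proof -
    have "((\<lambda>x. \<Sum>i\<le>degree P. coeff P i * (x ^ i / exp x)) \<longlongrightarrow> (\<Sum>i\<le>degree P. coeff P i * 0)) (at_top :: real filter)"
      by (intro tendsto_intros tendsto_power_div_exp_0)
    then show ?thesis
      by (simp add: poly_altdef sum_distrib_right exp_minus divide_inverse mult.assoc)
  qed
  have "filterlim (\<lambda>t::real. 1 / t) at_top (at_right 0)"
    by (simp add: filterlim_inverse_at_top_right flip: inverse_eq_divide)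
  from filterlim_compose[OF * this] show ?thesis by simp
qed

lemma smooth_flat_exp: "smooth flat_exp"
proof -
  \<comment> \<open>The derivatives of exp(- 1 / t) are polynomials in 1 / t times the same
    exponential; differentiation acts on the polynomial by P \<mapsto> X^2 (P - P').\<close>
  define fam where "fam P t = (if t > 0 then poly P (1 / t) * exp (- (1 / t)) else 0)" for P :: "real poly" and t
  have D: "(fam P has_real_derivative fam ([:0, 0, 1:] * (P - pderiv P)) t) (at t)" for P t
  proof -
    consider "t > 0" | "t < 0" | "t = 0" by linarith
    then show ?thesis
    proof cases
      case 1
      have d1: "((\<lambda>t. 1 / t) has_real_derivative - (1 / t\<^sup>2)) (at t)"
        using 1 by (auto intro!: derivative_eq_intros simp: power2_eq_square)
      have d2: "((\<lambda>t. exp (- (1 / t))) has_real_derivative exp (- (1 / t)) * (1 / t\<^sup>2)) (at t)"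
        using DERIV_chain2[OF DERIV_exp DERIV_minus[OF d1]] by simp
      have "((\<lambda>t. poly P (1 / t) * exp (- (1 / t))) has_real_derivative
          fam ([:0, 0, 1:] * (P - pderiv P)) t) (at t)"
        by (rule DERIV_cong[OF DERIV_mult[OF DERIV_chain2[OF poly_DERIV d1] d2]])
           (use 1 in \<open>simp add: fam_def algebra_simps power2_eq_square\<close>)
      then show ?thesis
        by (rule has_field_derivative_transform_within_open[of _ _ _ "{0<..}"]) (use 1 in \<open>auto simp: fam_def\<close>)
    next
      case 2
      have "((\<lambda>t. 0) has_real_derivative fam ([:0, 0, 1:] * (P - pderiv P)) t) (at t)"
        using 2 by (simp add: fam_def)
      then show ?thesis
        by (rule has_field_derivative_transform_within_open[of _ _ _ "{..<0}"]) (use 2 in \<open>auto simp: fam_def\<close>)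
    next
      case 3
      have "((\<lambda>y. (fam P y - fam P 0) / (y - 0)) \<longlongrightarrow> 0) (at (0::real))"
      proof (rule filterlim_split_at)
        show "((\<lambda>y. (fam P y - fam P 0) / (y - 0)) \<longlongrightarrow> 0) (at_left 0)"
          by (rule tendsto_eventually) (auto simp: eventually_at_filter fam_def)
        have "\<forall>\<^sub>F y in at_right 0. poly ([:0,1:] * P) (1 / y) * exp (- (1 / y)) = (fam P y - fam P 0) / (y - 0)"
          by (auto simp: eventually_at_filter fam_def)
        \<comment> \<open>Division by y has turned P(1 / y) into (X P)(1 / y), which is again of the
          form covered by the limit.\<close>
        from Lim_transform_eventually[OF poly_exp_flat_tendsto this]
        show "((\<lambda>y. (fam P y - fam P 0) / (y - 0)) \<longlongrightarrow> 0) (at_right 0)" .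
      qed
      then show ?thesis using 3 by (simp add: has_field_derivative_iff fam_def)
    qed
  qed
  have "smooth (fam [:1:])"
    by (rule smooth_real_family[of "range fam"]) (use D in auto)
  moreover have "fam [:1:] = flat_exp"
    by (auto simp: fam_def flat_exp_def)
  ultimately show ?thesis by simp
qed

lemma flat_exp_bounds: "0 \<le> flat_exp t" "flat_exp t \<le> 1" "0 < t \<Longrightarrow> 0 < flat_exp t" "t \<le> 0 \<Longrightarrow> flat_exp t = 0"
  by (auto simp: flat_exp_def)

lemma DERIV_flat_exp: "t > 0 \<Longrightarrow> (flat_exp has_real_derivative flat_exp t / t\<^sup>2) (at t)"
proof -
  assume t: "t > 0"
  have d1: "((\<lambda>t. 1 / t) has_real_derivative - (1 / t\<^sup>2)) (at t)"
    using t by (auto intro!: derivative_eq_intros simp: power2_eq_square)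
  have "((\<lambda>t. exp (- (1 / t))) has_real_derivative flat_exp t / t\<^sup>2) (at t)"
    using DERIV_chain2[OF DERIV_exp DERIV_minus[OF d1]] t by (simp add: flat_exp_def)
  then show ?thesis
    by (rule has_field_derivative_transform_within_open[of _ _ _ "{0<..}"]) (use t in \<open>auto simp: flat_exp_def\<close>)
qed

lemma flat_exp_tendsto_1:
  assumes "t > 0"
  shows "(\<lambda>n. flat_exp (real n * t)) \<longlonglongrightarrow> 1"
proof -
  have "(\<lambda>n. exp (- (inverse (real (Suc n)) * (1 / t)))) \<longlonglongrightarrow> exp (- (0 * (1 / t)))"
    by (intro tendsto_intros LIMSEQ_inverse_real_of_nat)
  moreover have "exp (- (inverse (real (Suc n)) * (1 / t))) = flat_exp (real (Suc n) * t)" for n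
    using assms by (simp add: flat_exp_def field_simps del: of_nat_Suc)
  ultimately have "(\<lambda>n. flat_exp (real (Suc n) * t)) \<longlonglongrightarrow> 1" by simp
  then show ?thesis by (rule LIMSEQ_imp_Suc)
qed

section \<open>Square-integrable functions\<close>

text \<open>The same condition as membership in \<open>L2\<close>, but for an arbitrary measure,
  because both \<open>lebesgue_on \<Omega>\<close> and \<open>lborel\<close> occur.\<close>

definition sq_integrable :: "'a measure \<Rightarrow> ('a \<Rightarrow> 'b::euclidean_space) \<Rightarrow> bool" where
  "sq_integrable M f \<longleftrightarrow> f \<in> borel_measurable M \<and> integrable M (\<lambda>x. (norm (f x))\<^sup>2)"

text \<open>The square of the L^2 norm: the parallelogram law and the Rayleigh quotient are free of
  square roots in this form.\<close>

definition sq_int :: "'a measure \<Rightarrow> ('a \<Rightarrow> 'b::euclidean_space) \<Rightarrow> real" where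
  "sq_int M f = (LINT x|M. (norm (f x))\<^sup>2)"

lemma sq_int_nonneg [simp]: "0 \<le> sq_int M f"
  by (simp add: sq_int_def)

lemma sq_integrable_measurable [measurable_dest]: "sq_integrable M f \<Longrightarrow> f \<in> borel_measurable M"
  by (simp add: sq_integrable_def)

lemma sq_integrable_bound:
  assumes f: "f \<in> borel_measurable M" and g: "integrable M g"
    and le: "AE x in M. (norm (f x))\<^sup>2 \<le> g x"
  shows "sq_integrable M f"
  unfolding sq_integrable_def
proof
  show "integrable M (\<lambda>x. (norm (f x))\<^sup>2)"
    by (rule Bochner_Integration.integrable_bound[OF g]) (use f le in auto)
qed fact

lemma sq_integrable_inner:
  fixes f g :: "'a \<Rightarrow> 'b::euclidean_space"
  assumes "sq_integrable M f" "sq_integrable M g"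
  shows "integrable M (\<lambda>x. f x \<bullet> g x)"
proof (rule Bochner_Integration.integrable_bound)
  show "integrable M (\<lambda>x. (norm (f x))\<^sup>2 + (norm (g x))\<^sup>2)"
    using assms by (simp add: sq_integrable_def)
  show "(\<lambda>x. f x \<bullet> g x) \<in> borel_measurable M"
    using assms by (auto simp add: sq_integrable_def)
  have "\<bar>f x \<bullet> g x\<bar> \<le> (norm (f x))\<^sup>2 + (norm (g x))\<^sup>2" for x
    using Cauchy_Schwarz_ineq2[of "f x" "g x"] sum_squares_bound[of "norm (f x)" "norm (g x)"]
      mult_nonneg_nonneg[of "norm (f x)" "norm (g x)"] norm_ge_zero[of "f x"] norm_ge_zero[of "g x"] by linarith
  then show "AE x in M. norm (f x \<bullet> g x) \<le> norm ((norm (f x))\<^sup>2 + (norm (g x))\<^sup>2)"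
    by simp
qed

lemma sq_integrable_scaleR: "sq_integrable M f \<Longrightarrow> sq_integrable M (\<lambda>x. c *\<^sub>R f x)"
  by (auto simp add: sq_integrable_def power_mult_distrib)

lemma sq_int_scaleR: "sq_int M (\<lambda>x. c *\<^sub>R f x) = c\<^sup>2 * sq_int M f"
  by (simp add: sq_int_def power_mult_distrib)

lemma norm_add_square_le: "(norm (a + b))\<^sup>2 \<le> 2 * (norm a)\<^sup>2 + 2 * (norm (b::'b::euclidean_space))\<^sup>2"
proof -
  have "(norm (a + b))\<^sup>2 + (norm (a - b))\<^sup>2 = 2 * (norm a)\<^sup>2 + 2 * (norm b)\<^sup>2"
    by (simp add: power2_norm_eq_inner algebra_simps inner_commute)
  then show ?thesis by (metis le_add_same_cancel1 zero_le_power2)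
qed

lemma sq_integrable_add:
  assumes "sq_integrable M f" "sq_integrable M g"
  shows "sq_integrable M (\<lambda>x. f x + g x)"
proof (rule sq_integrable_bound)
  show "(\<lambda>x. f x + g x) \<in> borel_measurable M"
    using assms by (auto simp add: sq_integrable_def)
  show "integrable M (\<lambda>x. 2 * (norm (f x))\<^sup>2 + 2 * (norm (g x))\<^sup>2)"
    using assms by (simp add: sq_integrable_def)
qed (simp add: norm_add_square_le)

lemma sq_integrable_uminus: "sq_integrable M f \<Longrightarrow> sq_integrable M (\<lambda>x. - f x)"
  by (simp add: sq_integrable_def)

lemma sq_integrable_diff:
  assumes "sq_integrable M f" "sq_integrable M g"
  shows "sq_integrable M (\<lambda>x. f x - g x)"
  using sq_integrable_add[OF assms(1) sq_integrable_uminus[OF assms(2)]] by simp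

lemma sq_int_add_le:
  assumes "sq_integrable M f" "sq_integrable M g"
  shows "sq_int M (\<lambda>x. f x + g x) \<le> 2 * sq_int M f + 2 * sq_int M g"
proof -
  have "(LINT x|M. (norm (f x + g x))\<^sup>2) \<le> (LINT x|M. 2 * (norm (f x))\<^sup>2 + 2 * (norm (g x))\<^sup>2)"
    using assms sq_integrable_add[OF assms] by (intro integral_mono) (auto simp: sq_integrable_def norm_add_square_le)
  then show ?thesis using assms by (simp add: sq_int_def sq_integrable_def)
qed

lemma sq_int_cong_AE:
  assumes "AE x in M. f x = g x" "f \<in> borel_measurable M" "g \<in> borel_measurable M"
  shows "sq_int M f = sq_int M g"
  unfolding sq_int_def by (rule integral_cong_AE) (use assms in auto)

lemma sq_integrable_cong_AE:
  assumes "AE x in M. f x = g x" "f \<in> borel_measurable M" "sq_integrable M g"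
  shows "sq_integrable M f"
  by (rule sq_integrable_bound[of _ _ "\<lambda>x. (norm (g x))\<^sup>2"]) (use assms in \<open>auto simp: sq_integrable_def\<close>)

lemma sq_int_minus_commute: "sq_int M (\<lambda>x. f x - g x) = sq_int M (\<lambda>x. g x - f x)"
  by (simp add: sq_int_def norm_minus_commute)

lemma sq_int_sum_inner:
  assumes "sq_integrable M f" "sq_integrable M g"
  shows "sq_int M (\<lambda>x. f x + t *\<^sub>R g x) =
     sq_int M f + 2 * t * (LINT x|M. f x \<bullet> g x) + t\<^sup>2 * sq_int M g"
proof -
  have "(norm (f x + t *\<^sub>R g x))\<^sup>2 = (norm (f x))\<^sup>2 + 2 * t * (f x \<bullet> g x) + t\<^sup>2 * (norm (g x))\<^sup>2" for x
    unfolding power2_norm_eq_inner by (simp add: algebra_simps inner_commute power2_eq_square)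
  then show ?thesis
    using assms sq_integrable_inner[OF assms] by (simp add: sq_int_def sq_integrable_def)
qed

text \<open>The squared norm of f + t g is a nonnegative quadratic polynomial in t, which bounds its
  discriminant; if the leading coefficient vanishes, it is linear and hence constant.\<close>

lemma sq_int_Cauchy_Schwarz:
  assumes "sq_integrable M f" "sq_integrable M g"
  shows "\<bar>LINT x|M. f x \<bullet> g x\<bar> \<le> sqrt (sq_int M f) * sqrt (sq_int M g)"
proof -
  define a b c where "a = sq_int M f" and "b = (LINT x|M. f x \<bullet> g x)" and "c = sq_int M g"
  have ac: "a \<ge> 0" "c \<ge> 0" by (auto simp: a_def c_def)
  have *: "0 \<le> a + 2 * t * b + t\<^sup>2 * c" for t
    using sq_int_sum_inner[OF assms, of t] sq_int_nonneg unfolding a_def b_def c_def by metis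
  have "b\<^sup>2 \<le> a * c"
  proof (cases "c = 0")
    case True
    have "b = 0"
    proof (rule ccontr)
      assume "b \<noteq> 0"
      \<comment> \<open>This t makes a + 2 t b equal to -1.\<close>
      then show False using *[of "- (a + 1) / (2 * b)"] True by (simp add: field_simps)
    qed
    then show ?thesis using ac by simp
  next
    case False
    then have c: "c > 0" using ac by simp
    \<comment> \<open>The quadratic has its minimum at t = - b / c.\<close>
    have "0 \<le> (a + 2 * (- b / c) * b + (- b / c)\<^sup>2 * c) * c"
      using *[of "- b / c"] c by (intro mult_nonneg_nonneg) auto
    also have "\<dots> = a * c - b\<^sup>2"
      using c by (simp add: field_simps power2_eq_square)
    finally show ?thesis by simp
  qed
  then have "sqrt (b\<^sup>2) \<le> sqrt (a * c)" by (rule real_sqrt_le_mono)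
  then show ?thesis by (simp add: a_def b_def c_def real_sqrt_mult)
qed

text \<open>Expanding the product around the limits leaves three terms, each with at least one
  factor that tends to zero in L^2; Cauchy-Schwarz bounds all of them.\<close>

lemma sq_int_inner_tendsto:
  assumes f: "\<And>n. sq_integrable M (f n)" "sq_integrable M F" "(\<lambda>n. sq_int M (\<lambda>x. f n x - F x)) \<longlonglongrightarrow> 0"
    and g: "\<And>n. sq_integrable M (g n)" "sq_integrable M G" "(\<lambda>n. sq_int M (\<lambda>x. g n x - G x)) \<longlonglongrightarrow> 0"
  shows "(\<lambda>n. LINT x|M. f n x \<bullet> g n x) \<longlonglongrightarrow> (LINT x|M. F x \<bullet> G x)"
proof -
  let ?a = "\<lambda>n. sqrt (sq_int M (\<lambda>x. f n x - F x))" and ?b = "\<lambda>n. sqrt (sq_int M (\<lambda>x. g n x - G x))"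
  have ab: "?a \<longlonglongrightarrow> 0" "?b \<longlonglongrightarrow> 0"
    using tendsto_real_sqrt[OF f(3)] tendsto_real_sqrt[OF g(3)] by simp_all
  have lim: "(\<lambda>n. ?a n * ?b n + ?a n * sqrt (sq_int M G) + sqrt (sq_int M F) * ?b n) \<longlonglongrightarrow> 0"
    using tendsto_add[OF tendsto_add[OF tendsto_mult[OF ab] tendsto_mult_right[OF ab(1)]] tendsto_mult_left[OF ab(2)]]
    by simp
  have "(\<lambda>n. (LINT x|M. f n x \<bullet> g n x) - (LINT x|M. F x \<bullet> G x)) \<longlonglongrightarrow> 0"
  proof (rule Lim_null_comparison[OF _ lim], rule always_eventually, rule allI)
    fix n
    have s: "sq_integrable M (\<lambda>x. f n x - F x)" "sq_integrable M (\<lambda>x. g n x - G x)"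
      using f g by (auto intro: sq_integrable_diff)
    have "(LINT x|M. f n x \<bullet> g n x) - (LINT x|M. F x \<bullet> G x) = (LINT x|M. f n x \<bullet> g n x - F x \<bullet> G x)"
      using f g by (simp add: sq_integrable_inner)
    also have "\<dots> = (LINT x|M. (f n x - F x) \<bullet> (g n x - G x) + (f n x - F x) \<bullet> G x + F x \<bullet> (g n x - G x))"
      by (rule Bochner_Integration.integral_cong) (auto simp: algebra_simps)
    also have "\<dots> = (LINT x|M. (f n x - F x) \<bullet> (g n x - G x)) + (LINT x|M. (f n x - F x) \<bullet> G x) 
        + (LINT x|M. F x \<bullet> (g n x - G x))"
      using s f g by (simp add: sq_integrable_inner)
    finally show "norm ((LINT x|M. f n x \<bullet> g n x) - (LINT x|M. F x \<bullet> G x)) \<le>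
       ?a n * ?b n + ?a n * sqrt (sq_int M G) + sqrt (sq_int M F) * ?b n"
      using sq_int_Cauchy_Schwarz[OF s] sq_int_Cauchy_Schwarz[OF s(1) g(2)] sq_int_Cauchy_Schwarz[OF f(2) s(2)]
      unfolding real_norm_def by linarith
  qed
  then show ?thesis by (simp add: LIM_zero_iff)
qed

lemma sq_int_tendsto:
  assumes "\<And>n. sq_integrable M (f n)" "sq_integrable M F" "(\<lambda>n. sq_int M (\<lambda>x. f n x - F x)) \<longlonglongrightarrow> 0"
  shows "(\<lambda>n. sq_int M (f n)) \<longlonglongrightarrow> sq_int M F"
  using sq_int_inner_tendsto[OF assms assms] by (simp add: sq_int_def power2_norm_eq_inner)

text \<open>The squared norms of the differences tend to zero in L^1, hence almost everywhere along
  a subsequence.\<close>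

lemma sq_int_tendsto_AE_subseq:
  assumes "\<And>n. sq_integrable M (f n)" "sq_integrable M F" "(\<lambda>n. sq_int M (\<lambda>x. f n x - F x)) \<longlonglongrightarrow> 0"
  obtains r where "strict_mono (r::nat\<Rightarrow>nat)" "AE x in M. (\<lambda>n. f (r n) x) \<longlonglongrightarrow> F x"
proof -
  have "\<exists>r. strict_mono r \<and> (AE x in M. (\<lambda>n. (norm (f (r n) x - F x))\<^sup>2) \<longlonglongrightarrow> 0)"
    using assms sq_integrable_diff[OF assms(1,2)]
    by (intro tendsto_L1_AE_subseq) (auto simp: sq_int_def sq_integrable_def)
  then obtain r where r: "strict_mono (r::nat\<Rightarrow>nat)" "AE x in M. (\<lambda>n. (norm (f (r n) x - F x))\<^sup>2) \<longlonglongrightarrow> 0"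
    by blast
  have "AE x in M. (\<lambda>n. f (r n) x) \<longlonglongrightarrow> F x"
    using r(2)
  proof eventually_elim
    case (elim x)
    from tendsto_real_sqrt[OF this] have "(\<lambda>n. norm (f (r n) x - F x)) \<longlonglongrightarrow> 0" by simp
    then show ?case using LIM_zero_iff tendsto_norm_zero_iff by blast
  qed
  with r(1) show ?thesis using that by blast
qed

lemma (in finite_measure) sq_integrable_integrable:
  assumes "sq_integrable M f"
  shows "integrable M f"
proof (rule Bochner_Integration.integrable_bound)
  show "integrable M (\<lambda>x. 1 + (norm (f x))\<^sup>2)"
    using assms by (simp add: sq_integrable_def)
  have "norm (f x) \<le> 1 + (norm (f x))\<^sup>2" for x
    using sum_squares_bound[of "norm (f x)" 1] by (simp add: power2_eq_square) (smt (verit) norm_ge_zero)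
  then show "AE x in M. norm (f x) \<le> norm (1 + (norm (f x))\<^sup>2)" by simp
qed (use assms in \<open>simp add: sq_integrable_def\<close>)

lemma (in finite_measure) sq_int_L1_le:
  assumes "sq_integrable M f"
  shows "(LINT x|M. norm (f x)) \<le> sqrt (measure M (space M)) * sqrt (sq_int M f)"
proof -
  have "sq_integrable M (\<lambda>x. norm (f x))" using assms by (auto simp add: sq_integrable_def)
  moreover have "sq_integrable M (\<lambda>x. 1::real)" by (simp add: sq_integrable_def)
  ultimately have "\<bar>LINT x|M. 1 \<bullet> norm (f x)\<bar> \<le> sqrt (sq_int M (\<lambda>x. 1::real)) * sqrt (sq_int M (\<lambda>x. norm (f x)))"
    by (intro sq_int_Cauchy_Schwarz)
  then show ?thesis by (simp add: sq_int_def)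
qed

text \<open>Riesz-Fischer. On a finite measure an L^2 Cauchy sequence is L^1 Cauchy, so a
  subsequence converges almost everywhere to some F; Fatou's lemma along that subsequence bounds the
  L^2 distance to F by the Cauchy tolerance.\<close>

lemma (in finite_measure) sq_int_complete:
  fixes f :: "nat \<Rightarrow> 'a \<Rightarrow> 'b::euclidean_space"
  assumes f: "\<And>n. sq_integrable M (f n)"
    and cauchy: "\<And>e. e > 0 \<Longrightarrow> \<exists>N. \<forall>m\<ge>N. \<forall>n\<ge>N. sq_int M (\<lambda>x. f m x - f n x) < e"
  obtains F where "sq_integrable M F" "(\<lambda>n. sq_int M (\<lambda>x. f n x - F x)) \<longlonglongrightarrow> 0"
proof -
  have [measurable]: "f n \<in> borel_measurable M" for n using f by (simp add: sq_integrable_def)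
  have "\<exists>N. \<forall>i\<ge>N. \<forall>j\<ge>N. (LINT x|M. norm (f i x - f j x)) < e" if e: "e > 0" for e
  proof -
    define C where "C = sqrt (measure M (space M)) + 1"
    have C: "C > 0" by (simp add: C_def add_nonneg_pos)
    obtain N where N: "\<forall>m\<ge>N. \<forall>n\<ge>N. sq_int M (\<lambda>x. f m x - f n x) < (e / C)\<^sup>2"
      using cauchy[of "(e / C)\<^sup>2"] e C by auto
    have "(LINT x|M. norm (f i x - f j x)) < e" if "i \<ge> N" "j \<ge> N" for i j
    proof -
      have "sqrt (sq_int M (\<lambda>x. f i x - f j x)) < e / C"
        using real_sqrt_less_mono[OF N[rule_format, OF that]] e C by simp
      then have "C * sqrt (sq_int M (\<lambda>x. f i x - f j x)) < e"
        using C by (simp add: field_simps)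
      moreover have "sqrt (measure M (space M)) * sqrt (sq_int M (\<lambda>x. f i x - f j x)) \<le>
          C * sqrt (sq_int M (\<lambda>x. f i x - f j x))"
        by (intro mult_right_mono) (auto simp: C_def)
      ultimately show ?thesis
        using sq_int_L1_le[OF sq_integrable_diff[OF f[of i] f[of j]]] by linarith
    qed
    then show ?thesis by blast
  qed
  from cauchy_L1_AE_cauchy_subseq[OF sq_integrable_integrable[OF f] this]
  obtain r where r: "strict_mono r" "AE x in M. Cauchy (\<lambda>i. f (r i) x)" by blast
  define F where "F x = lim (\<lambda>i. f (r i) x)" for x
  have [measurable]: "F \<in> borel_measurable M" unfolding F_def by measurable
  have conv: "AE x in M. (\<lambda>i. f (r i) x) \<longlonglongrightarrow> F x"
    using r(2) by eventually_elim (simp add: F_def Cauchy_convergent convergent_LIMSEQ_iff[symmetric])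
  have key: "(\<integral>\<^sup>+x. ennreal ((norm (f m x - F x))\<^sup>2) \<partial>M) \<le> ennreal e"
    if N: "\<forall>m\<ge>N. \<forall>n\<ge>N. sq_int M (\<lambda>x. f m x - f n x) < e" and m: "m \<ge> N" for e N m
  proof -
    have "(\<integral>\<^sup>+x. ennreal ((norm (f m x - F x))\<^sup>2) \<partial>M) = 
       (\<integral>\<^sup>+x. liminf (\<lambda>i. ennreal ((norm (f m x - f (r i) x))\<^sup>2)) \<partial>M)"
    proof (rule nn_integral_cong_AE)
      show "AE x in M. ennreal ((norm (f m x - F x))\<^sup>2) = liminf (\<lambda>i. ennreal ((norm (f m x - f (r i) x))\<^sup>2))"
        using conv
      proof eventually_elim
        case (elim x)
        have "(\<lambda>i. ennreal ((norm (f m x - f (r i) x))\<^sup>2)) \<longlonglongrightarrow> ennreal ((norm (f m x - F x))\<^sup>2)"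
          by (intro tendsto_intros elim tendsto_ennrealI)
        from lim_imp_Liminf[OF _ this] show ?case by simp
      qed
    qed
    also have "\<dots> \<le> liminf (\<lambda>i. \<integral>\<^sup>+x. ennreal ((norm (f m x - f (r i) x))\<^sup>2) \<partial>M)"
      by (rule nn_integral_liminf) measurable
    also have "\<dots> \<le> ennreal e"
    proof (rule Liminf_le)
      show "\<forall>\<^sub>F i in sequentially. (\<integral>\<^sup>+x. ennreal ((norm (f m x - f (r i) x))\<^sup>2) \<partial>M) \<le> ennreal e"
        using eventually_ge_at_top[of N]
      proof eventually_elim
        case (elim i)
        then have "r i \<ge> N" using seq_suble[OF r(1), of i] by linarith
        have "(\<integral>\<^sup>+x. ennreal ((norm (f m x - f (r i) x))\<^sup>2) \<partial>M) = ennreal (sq_int M (\<lambda>x. f m x - f (r i) x))"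
          unfolding sq_int_def using sq_integrable_diff[OF f f]
          by (intro nn_integral_eq_integral) (auto simp: sq_integrable_def)
        also have "\<dots> \<le> ennreal e" using N m \<open>r i \<ge> N\<close> by (intro ennreal_leI) (simp add: less_imp_le)
        finally show ?case .
      qed
    qed simp
    finally show ?thesis .
  qed
  have diff: "sq_integrable M (\<lambda>x. f m x - F x) \<and> sq_int M (\<lambda>x. f m x - F x) \<le> e"
    if N: "\<forall>m\<ge>N. \<forall>n\<ge>N. sq_int M (\<lambda>x. f m x - f n x) < e" and m: "m \<ge> N" and e: "e > 0" for e N m
  proof -
    have i: "integrable M (\<lambda>x. (norm (f m x - F x))\<^sup>2)"
      using key[OF N m] by (intro integrableI_bounded) (auto simp: less_top[symmetric] top_unique)
    have "ennreal (sq_int M (\<lambda>x. f m x - F x)) \<le> ennreal e"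
      using key[OF N m] nn_integral_eq_integral[OF i] by (simp add: sq_int_def)
    then show ?thesis using i e by (simp add: sq_integrable_def)
  qed
  obtain N where "\<forall>m\<ge>N. \<forall>n\<ge>N. sq_int M (\<lambda>x. f m x - f n x) < 1" using cauchy[of 1] by auto
  from diff[OF this order_refl] have "sq_integrable M (\<lambda>x. f N x - F x)" by simp
  from sq_integrable_diff[OF f[of N] this] have F: "sq_integrable M F" by simp
  have "(\<lambda>n. sq_int M (\<lambda>x. f n x - F x)) \<longlonglongrightarrow> 0"
  proof (rule LIMSEQ_I)
    fix e :: real assume e: "e > 0"
    obtain N where N: "\<forall>m\<ge>N. \<forall>n\<ge>N. sq_int M (\<lambda>x. f m x - f n x) < e / 2" using cauchy[of "e/2"] e by auto
    have "norm (sq_int M (\<lambda>x. f n x - F x) - 0) < e" if "n \<ge> N" for n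
      using diff[OF N that] e by (simp add: abs_of_nonneg)
    then show "\<exists>N. \<forall>n\<ge>N. norm (sq_int M (\<lambda>x. f n x - F x) - 0) < e" by blast
  qed
  with F show ?thesis using that by blast
qed

section \<open>Test functions\<close>

definition grad :: "('a::euclidean_space \<Rightarrow> real) \<Rightarrow> 'a \<Rightarrow> 'a" where
  "grad f x = (\<Sum>b\<in>Basis. frechet_derivative f (at x) b *\<^sub>R b)"

lemma grad_inner_Basis: "b \<in> Basis \<Longrightarrow> grad f x \<bullet> b = frechet_derivative f (at x) b"
  by (simp add: grad_def inner_sum_left_Basis)

lemma grad_unique:
  assumes "(f has_derivative (\<lambda>h. v \<bullet> h)) (at x)"
  shows "grad f x = v"
  using frechet_derivative_at[OF assms, symmetric] by (simp add: grad_def euclidean_representation)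

lemma has_derivative_grad:
  assumes "f differentiable (at x)"
  shows "(f has_derivative (\<lambda>h. grad f x \<bullet> h)) (at x)"
proof -
  have D: "(f has_derivative frechet_derivative f (at x)) (at x)"
    using assms frechet_derivative_works by blast
  interpret linear "frechet_derivative f (at x)" using assms linear_frechet_derivative by blast
  have "grad f x \<bullet> h = frechet_derivative f (at x) h" for h
  proof -
    have "frechet_derivative f (at x) h = frechet_derivative f (at x) (\<Sum>b\<in>Basis. (h \<bullet> b) *\<^sub>R b)"
      by (simp add: euclidean_representation)
    also have "\<dots> = (\<Sum>b\<in>Basis. (h \<bullet> b) * frechet_derivative f (at x) b)"
      by (simp add: sum scale)
    finally show ?thesis
      by (simp add: grad_def inner_sum_left inner_sum_right inner_commute mult.commute)
  qed
  with D show ?thesis by simp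
qed

lemma smooth_has_derivative_grad: "smooth f \<Longrightarrow> (f has_derivative (\<lambda>h. grad f x \<bullet> h)) (at x)"
  using smoothD(1) by (intro has_derivative_grad) (auto simp: differentiable_def)

lemma smooth_grad_component: "smooth f \<Longrightarrow> b \<in> Basis \<Longrightarrow> smooth (\<lambda>x. grad f x \<bullet> b)"
  by (simp add: grad_inner_Basis smoothD(2))

lemma continuous_on_grad: "smooth f \<Longrightarrow> continuous_on A (grad f)"
  unfolding grad_def by (intro continuous_intros continuous_on_subset[OF smoothD(3)[OF smoothD(2)]]) auto

lemma test_functionsD:
  assumes "\<phi> \<in> test_functions \<Omega>"
  shows "smooth \<phi>" "compact (closure {x. \<phi> x \<noteq> 0})" "closure {x. \<phi> x \<noteq> 0} \<subseteq> \<Omega>"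
    "x \<notin> \<Omega> \<Longrightarrow> \<phi> x = 0" "continuous_on A \<phi>"
  using assms closure_subset[of "{x. \<phi> x \<noteq> 0}"] continuous_on_subset[OF smoothD(3), of \<phi> A]
  by (auto simp: test_functions_def)

lemma test_functionsI:
  assumes "smooth \<phi>" "compact K" "K \<subseteq> \<Omega>" "\<And>x. x \<notin> K \<Longrightarrow> \<phi> x = 0"
  shows "\<phi> \<in> test_functions \<Omega>"
proof -
  have "closure {x. \<phi> x \<noteq> 0} \<subseteq> K"
    using assms(2,4) by (intro closure_minimal) (auto simp: compact_imp_closed)
  moreover from this have "compact (closure {x. \<phi> x \<noteq> 0})"
    using compact_Int_closed[OF assms(2) closed_closure, of "{x. \<phi> x \<noteq> 0}"] by (simp add: Int_absorb1)
  ultimately show ?thesis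
    using assms unfolding test_functions_def by auto
qed

lemma test_functions_vanish:
  assumes "\<phi> \<in> test_functions \<Omega>" "smooth \<psi>" "\<And>x. \<phi> x = 0 \<Longrightarrow> \<psi> x = 0"
  shows "\<psi> \<in> test_functions \<Omega>"
  by (rule test_functionsI[of _ "closure {x. \<phi> x \<noteq> 0}"])
     (use assms closure_subset[of "{x. \<phi> x \<noteq> 0}"] test_functionsD[OF assms(1)] in auto)

lemma test_functions_mult: "\<phi> \<in> test_functions \<Omega> \<Longrightarrow> smooth \<psi> \<Longrightarrow> (\<lambda>x. \<phi> x * \<psi> x) \<in> test_functions \<Omega>"
  by (rule test_functions_vanish) (auto intro: smooth_mult dest: test_functionsD(1))

lemma test_functions_scale: "\<phi> \<in> test_functions \<Omega> \<Longrightarrow> (\<lambda>x. c * \<phi> x) \<in> test_functions \<Omega>"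
  by (rule test_functions_vanish) (auto intro: smooth_mult dest: test_functionsD(1))

lemma test_functions_zero: "(\<lambda>x. 0) \<in> test_functions \<Omega>"
  by (rule test_functionsI[of _ "{}"]) auto

lemma test_functions_add:
  assumes "\<phi> \<in> test_functions \<Omega>" "\<psi> \<in> test_functions \<Omega>"
  shows "(\<lambda>x. \<phi> x + \<psi> x) \<in> test_functions \<Omega>"
proof (rule test_functionsI[of _ "closure {x. \<phi> x \<noteq> 0} \<union> closure {x. \<psi> x \<noteq> 0}"])
  show "\<phi> x + \<psi> x = 0" if "x \<notin> closure {x. \<phi> x \<noteq> 0} \<union> closure {x. \<psi> x \<noteq> 0}" for x
    using that closure_subset[of "{x. \<phi> x \<noteq> 0}"] closure_subset[of "{x. \<psi> x \<noteq> 0}"] by fastforce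
qed (use test_functionsD[OF assms(1)] test_functionsD[OF assms(2)] in \<open>auto intro!: smooth_add\<close>)

lemma grad_add: "smooth f \<Longrightarrow> smooth g \<Longrightarrow> grad (\<lambda>x. f x + g x) x = grad f x + grad g x"
  by (intro grad_unique)
     (auto intro!: derivative_eq_intros smooth_has_derivative_grad simp: inner_add_left)

lemma grad_scale: "smooth f \<Longrightarrow> grad (\<lambda>x. c * f x) x = c *\<^sub>R grad f x"
  by (intro grad_unique)
     (auto intro!: derivative_eq_intros smooth_has_derivative_grad)

lemma grad_mult: "smooth f \<Longrightarrow> smooth g \<Longrightarrow> grad (\<lambda>x. f x * g x) x = f x *\<^sub>R grad g x + g x *\<^sub>R grad f x"
  by (intro grad_unique)
     (auto intro!: derivative_eq_intros smooth_has_derivative_grad simp: inner_add_left)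

lemma grad_const [simp]: "grad (\<lambda>x. c) x = 0"
  by (rule grad_unique) simp

text \<open>The complement of the closed support is open and the function vanishes on it, so its
  gradient vanishes there too.\<close>

lemma test_functions_partial:
  assumes "\<phi> \<in> test_functions \<Omega>" "b \<in> Basis"
  shows "(\<lambda>x. grad \<phi> x \<bullet> b) \<in> test_functions \<Omega>"
proof (rule test_functionsI[of _ "closure {x. \<phi> x \<noteq> 0}"])
  show "smooth (\<lambda>x. grad \<phi> x \<bullet> b)"
    using assms by (intro smooth_grad_component test_functionsD(1))
  fix x assume "x \<notin> closure {x. \<phi> x \<noteq> 0}"
  then have x: "x \<in> - closure {x. \<phi> x \<noteq> 0}" by simp
  have "((\<lambda>x. 0) has_derivative (\<lambda>h. 0 \<bullet> h)) (at x)" by simp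
  then have "(\<phi> has_derivative (\<lambda>h. 0 \<bullet> h)) (at x)"
    by (rule has_derivative_transform_within_open[OF _ _ x])
       (use closure_subset[of "{x. \<phi> x \<noteq> 0}"] in auto)
  then have "grad \<phi> x = 0" by (rule grad_unique)
  then show "grad \<phi> x \<bullet> b = 0" by simp
qed (use test_functionsD[OF assms(1)] in auto)

lemma test_functions_bounded:
  assumes "\<phi> \<in> test_functions \<Omega>"
  obtains C where "C > 0" "\<And>x. \<bar>\<phi> x\<bar> \<le> C"
proof -
  have "compact (\<phi> ` closure {x. \<phi> x \<noteq> 0})"
    using test_functionsD[OF assms] by (intro compact_continuous_image)
  then obtain C where C: "C > 0" "\<forall>y\<in>\<phi> ` closure {x. \<phi> x \<noteq> 0}. norm y \<le> C"
    using compact_imp_bounded bounded_pos by metis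
  have "\<bar>\<phi> x\<bar> \<le> C" for x
  proof (cases "\<phi> x = 0")
    case False
    then have "x \<in> closure {x. \<phi> x \<noteq> 0}" using closure_subset[of "{x. \<phi> x \<noteq> 0}"] by blast
    then show ?thesis using C by auto
  qed (use C in auto)
  with C(1) show ?thesis using that by blast
qed

lemma test_functions_grad_bounded:
  assumes "\<phi> \<in> test_functions \<Omega>"
  obtains C where "C > 0" "\<And>x. norm (grad \<phi> x) \<le> C"
proof -
  have "\<forall>b\<in>Basis. \<exists>C. \<forall>x. \<bar>grad \<phi> x \<bullet> b\<bar> \<le> C"
    using test_functions_partial[OF assms] test_functions_bounded by metis
  then obtain C where C: "\<And>b x. b \<in> Basis \<Longrightarrow> \<bar>grad \<phi> x \<bullet> b\<bar> \<le> C b" by metis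
  have "norm (grad \<phi> x) \<le> \<bar>\<Sum>b\<in>Basis. C b\<bar> + 1" for x
  proof -
    have "norm (grad \<phi> x) \<le> (\<Sum>b\<in>Basis. \<bar>grad \<phi> x \<bullet> b\<bar>)" by (rule norm_le_l1)
    also have "\<dots> \<le> (\<Sum>b\<in>Basis. C b)" by (rule sum_mono) (rule C)
    finally show ?thesis by linarith
  qed
  then show ?thesis using that[of "\<bar>\<Sum>b\<in>Basis. C b\<bar> + 1"] by auto
qed

lemma test_functions_grad_zero: "\<phi> \<in> test_functions \<Omega> \<Longrightarrow> x \<notin> \<Omega> \<Longrightarrow> grad \<phi> x = 0"
  by (rule euclidean_eqI) (use test_functionsD(4)[OF test_functions_partial] in auto)

lemma smooth_lipschitz:
  assumes "smooth \<phi>" "\<And>x. norm (grad \<phi> x) \<le> C"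
  shows "\<bar>\<phi> x - \<phi> y\<bar> \<le> C * norm (x - y)"
proof -
  have "onorm (\<lambda>h. grad \<phi> x \<bullet> h) \<le> C" for x
  proof (rule onorm_bound)
    show "0 \<le> C" using assms(2)[of x] norm_ge_zero[of "grad \<phi> x"] by linarith
    show "norm (grad \<phi> x \<bullet> h) \<le> C * norm h" for h
      using Cauchy_Schwarz_ineq2[of "grad \<phi> x" h] mult_right_mono[OF assms(2)[of x] norm_ge_zero[of h]] by simp
  qed
  then have "norm (\<phi> x - \<phi> y) \<le> C * norm (x - y)"
    by (intro differentiable_bound[of UNIV \<phi> "\<lambda>x h. grad \<phi> x \<bullet> h"])
       (auto intro: smooth_has_derivative_grad[OF assms(1)])
  then show ?thesis by simp
qed

section \<open>Translation invariance of the Lebesgue integral\<close>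

lemma integral_lborel_translate:
  fixes f :: "'a::euclidean_space \<Rightarrow> real"
  assumes "f \<in> borel_measurable borel"
  shows "(LINT x|lborel. f (x + c)) = (LINT x|lborel. f x)"
proof -
  have "(LINT x|lborel. f x) = (LINT x|distr lborel borel ((+) c). f x)"
    by (simp add: lborel_distr_plus)
  also have "\<dots> = (LINT x|lborel. f (c + x))"
    using assms by (intro integral_distr) auto
  finally show ?thesis by (simp add: add.commute)
qed

lemma integrable_lborel_translate:
  fixes f :: "'a::euclidean_space \<Rightarrow> real"
  assumes "integrable lborel f"
  shows "integrable lborel (\<lambda>x. f (x + c))"
proof -
  have "integrable (distr lborel borel ((+) c)) f"
    using assms by (simp add: lborel_distr_plus)
  then have "integrable lborel (\<lambda>x. f (c + x))"
    by (subst (asm) integrable_distr_eq) (use assms in auto)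
  then show ?thesis by (simp add: add.commute)
qed

lemma integrable_bounded_support:
  fixes f :: "'a::euclidean_space \<Rightarrow> real"
  assumes "f \<in> borel_measurable borel" "bounded S" "\<And>x. x \<notin> S \<Longrightarrow> f x = 0" "\<And>x. \<bar>f x\<bar> \<le> C"
  shows "integrable lborel f"
proof -
  obtain R where R: "\<And>x. x \<in> S \<Longrightarrow> norm x \<le> R" using assms(2) bounded_iff by blast
  show ?thesis
  proof (rule Bochner_Integration.integrable_bound)
    show "integrable lborel (\<lambda>x::'a. C * indicator (cball 0 R) x :: real)"
      using emeasure_bounded_finite[of "cball 0 R :: 'a set"] by (intro integrable_mult_right integrable_real_indicator) (auto simp: less_top top.not_eq_extremum)
    show "AE x in lborel. norm (f x) \<le> norm (C * indicator (cball 0 R) x :: real)"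
    proof (rule AE_I2)
      fix x
      show "norm (f x) \<le> norm (C * indicator (cball 0 R) x :: real)"
        using assms(3,4)[of x] R[of x] by (cases "x \<in> S") (auto simp: indicator_def)
    qed
  qed (use assms(1) in simp)
qed

lemma difference_quotient_tendsto:
  fixes h :: "nat \<Rightarrow> real"
  assumes "smooth \<phi>" "h \<longlonglongrightarrow> 0" "\<And>n. h n \<noteq> 0"
  shows "(\<lambda>n. (\<phi> (x + h n *\<^sub>R v) - \<phi> x) / h n) \<longlonglongrightarrow> grad \<phi> x \<bullet> v"
proof -
  have "((\<lambda>t. x + t *\<^sub>R v) has_derivative (\<lambda>t. t *\<^sub>R v)) (at 0)"
    by (auto intro!: derivative_eq_intros)
  from has_derivative_compose[OF this, of \<phi> "\<lambda>y. grad \<phi> x \<bullet> y"] smooth_has_derivative_grad[OF assms(1), of x]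
  have "((\<lambda>t. \<phi> (x + t *\<^sub>R v)) has_derivative (\<lambda>t. grad \<phi> x \<bullet> (t *\<^sub>R v))) (at 0)" by simp
  moreover have "(*) (grad \<phi> x \<bullet> v) = (\<lambda>t. grad \<phi> x \<bullet> (t *\<^sub>R v))" by (simp add: fun_eq_iff)
  ultimately have "((\<lambda>t. \<phi> (x + t *\<^sub>R v)) has_real_derivative grad \<phi> x \<bullet> v) (at 0)"
    by (simp only: has_field_derivative_def)
  then have "((\<lambda>t. (\<phi> (x + t *\<^sub>R v) - \<phi> x) / t) \<longlongrightarrow> grad \<phi> x \<bullet> v) (at 0)"
    by (simp add: has_field_derivative_iff)
  moreover have "filterlim h (at 0) sequentially" using assms(2,3) by (simp add: filterlim_at)
  ultimately show ?thesis by (rule filterlim_compose)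
qed

text \<open>The difference quotients of \<open>F\<close> have integral zero by translation invariance.\<close>

lemma integral_partial_eq_zero:
  assumes F: "F \<in> test_functions \<Omega>" and b: "b \<in> Basis"
  shows "(LINT x|lborel. grad F x \<bullet> b) = 0"
proof -
  obtain C where C: "C > 0" "\<And>x. norm (grad F x) \<le> C" using test_functions_grad_bounded[OF F] by blast
  obtain C' where C': "\<And>x. \<bar>F x\<bar> \<le> C'" using test_functions_bounded[OF F] by metis
  have contF: "continuous_on UNIV F" by (rule test_functionsD(5)[OF F])
  have "bounded {x. F x \<noteq> 0}"
    using test_functionsD(2)[OF F] bounded_closure closure_subset compact_imp_bounded bounded_subset by metis
  then obtain R where R: "\<And>x. F x \<noteq> 0 \<Longrightarrow> norm x \<le> R" by (auto simp: bounded_iff)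
  have intF: "integrable lborel F"
    by (rule integrable_bounded_support[of _ "{x. F x \<noteq> 0}" C'])
       (use contF C' \<open>bounded _\<close> in \<open>auto intro: borel_measurable_continuous_onI\<close>)
  define h where "h n = inverse (real (Suc n))" for n
  have h: "h n > 0" "h n \<le> 1" "h \<longlonglongrightarrow> 0" for n
    unfolding h_def using LIMSEQ_inverse_real_of_nat by (simp_all add: inverse_le_1_iff)
  define D where "D n x = (F (x + h n *\<^sub>R b) - F x) / h n" for n x
  have zero: "(LINT x|lborel. D n x) = 0" for n
  proof -
    have "(LINT x|lborel. F (x + h n *\<^sub>R b) - F x) = 0"
      using integrable_lborel_translate[OF intF, of "h n *\<^sub>R b"] intF
        integral_lborel_translate[of F "h n *\<^sub>R b"] contF
      by (simp add: borel_measurable_continuous_onI)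
    then show ?thesis by (simp add: D_def)
  qed
  have "(\<lambda>n. LINT x|lborel. D n x) \<longlonglongrightarrow> (LINT x|lborel. grad F x \<bullet> b)"
  \<comment> \<open>The steps h n are at most 1, so all quotients vanish outside the ball of radius
    R + 1; inside it the Lipschitz constant C dominates them.\<close>
  proof (rule integral_dominated_convergence[where w = "\<lambda>x. C * indicator (cball 0 (R + 1)) x :: real"])
    show "(\<lambda>x. grad F x \<bullet> b) \<in> borel_measurable lborel"
      using test_functionsD(5)[OF test_functions_partial[OF F b], of UNIV] by (simp add: borel_measurable_continuous_onI)
    show "D n \<in> borel_measurable lborel" for n
      unfolding D_def using contF h(1)[of n]
      by (simp, intro borel_measurable_continuous_onI continuous_intros continuous_on_compose2[OF contF]) auto
    show "integrable lborel (\<lambda>x::'a. C * indicator (cball 0 (R + 1)) x :: real)"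
      using emeasure_bounded_finite[of "cball 0 (R + 1) :: 'a set"] by (intro integrable_mult_right integrable_real_indicator) (auto simp: less_top top.not_eq_extremum)
    show "AE x in lborel. (\<lambda>n. D n x) \<longlonglongrightarrow> grad F x \<bullet> b"
      unfolding D_def using h(1)
      by (intro AE_I2 difference_quotient_tendsto[OF test_functionsD(1)[OF F] h(3)]) (simp add: less_imp_neq[symmetric])
    show "AE x in lborel. norm (D n x) \<le> C * indicator (cball 0 (R + 1)) x" for n
    proof (rule AE_I2)
      fix x
      show "norm (D n x) \<le> C * indicator (cball 0 (R + 1)) x"
      proof (cases "norm x \<le> R + 1")
        case True
        have "\<bar>F (x + h n *\<^sub>R b) - F x\<bar> \<le> C * h n"
          using smooth_lipschitz[OF test_functionsD(1)[OF F] C(2), of "x + h n *\<^sub>R b" x] h(1)[of n] b by simp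
        then show ?thesis using True h(1)[of n] by (simp add: D_def field_simps)
      next
        case False
        have "norm x \<le> norm (x + h n *\<^sub>R b) + norm (h n *\<^sub>R b)" by (metis add_diff_cancel norm_triangle_ineq4)
        then have "norm (x + h n *\<^sub>R b) > R" using False h(1,2)[of n] b by simp
        then have "F (x + h n *\<^sub>R b) = 0" "F x = 0" using R[of x] R[of "x + h n *\<^sub>R b"] False by auto
        then show ?thesis using C(1) by (simp add: D_def)
      qed
    qed
  qed
  with zero show ?thesis by (simp add: LIMSEQ_const_iff)
qed

lemma integral_lebesgue_on_eq_lborel:
  fixes f :: "'a::euclidean_space \<Rightarrow> real"
  assumes "\<Omega> \<in> sets lebesgue" "f \<in> borel_measurable borel" "\<And>x. x \<notin> \<Omega> \<Longrightarrow> f x = 0"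
  shows "(LINT x|lebesgue_on \<Omega>. f x) = (LINT x|lborel. f x)"
proof -
  have "indicator \<Omega> x *\<^sub>R f x = f x" for x using assms(3) by (cases "x \<in> \<Omega>") auto
  then show ?thesis
    using assms by (simp add: integral_restrict_space integral_completion del: real_scaleR_def)
qed

section \<open>Weak gradients\<close>

locale bounded_open =
  fixes \<Omega> :: "'a::euclidean_space set"
  assumes open_Omega: "open \<Omega>" and bounded_Omega: "bounded \<Omega>"
begin

abbreviation M :: "'a measure" where "M \<equiv> lebesgue_on \<Omega>"

lemma Omega_sets [simp, measurable]: "\<Omega> \<in> sets lebesgue"
  using open_Omega lmeasurable_open[OF bounded_Omega] by (simp add: fmeasurableD)

sublocale finite_measure M
  by (intro finite_measure_lebesgue_on lmeasurable_open bounded_Omega open_Omega)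

lemma continuous_measurable [measurable_dest]:
  fixes f :: "'a \<Rightarrow> 'b::euclidean_space"
  shows "continuous_on UNIV f \<Longrightarrow> f \<in> borel_measurable M"
  by (intro continuous_imp_measurable_on_sets_lebesgue) (auto intro: continuous_on_subset)

lemma continuous_bounded_on:
  fixes f :: "'a \<Rightarrow> 'b::euclidean_space"
  assumes "continuous_on UNIV f"
  obtains C where "C > 0" "\<And>x. x \<in> \<Omega> \<Longrightarrow> norm (f x) \<le> C"
proof -
  have "compact (f ` closure \<Omega>)"
    using bounded_Omega assms by (intro compact_continuous_image) (auto intro: continuous_on_subset)
  then obtain C where "C > 0" "\<forall>y\<in>f ` closure \<Omega>. norm y \<le> C"
    using compact_imp_bounded bounded_pos by metis
  then show ?thesis using that closure_subset[of \<Omega>] by blast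
qed

lemma AE_M_I: "(\<And>x. x \<in> \<Omega> \<Longrightarrow> P x) \<Longrightarrow> AE x in M. P x"
  by (rule AE_I2) simp

lemma bounded_sq_integrable:
  fixes f :: "'a \<Rightarrow> 'b::euclidean_space"
  assumes "f \<in> borel_measurable M" "AE x in M. norm (f x) \<le> C"
  shows "sq_integrable M f"
proof (rule sq_integrable_bound[OF assms(1), of "\<lambda>x. C\<^sup>2"])
  show "AE x in M. (norm (f x))\<^sup>2 \<le> C\<^sup>2"
    using assms(2) by eventually_elim (auto intro: power_mono)
qed simp

lemma continuous_sq_integrable:
  fixes f :: "'a \<Rightarrow> 'b::euclidean_space"
  assumes "continuous_on UNIV f"
  shows "sq_integrable M f"
proof -
  obtain C where "\<And>x. x \<in> \<Omega> \<Longrightarrow> norm (f x) \<le> C" using continuous_bounded_on[OF assms] by metis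
  then show ?thesis
    using continuous_measurable[OF assms] by (intro bounded_sq_integrable[of f C] AE_M_I) auto
qed

lemma smooth_sq_integrable: "smooth f \<Longrightarrow> sq_integrable M f"
  by (rule continuous_sq_integrable[OF smoothD(3)])

lemma grad_sq_integrable: "smooth f \<Longrightarrow> sq_integrable M (grad f)"
  by (rule continuous_sq_integrable[OF continuous_on_grad])

lemma integral_test_eq_lborel:
  assumes "continuous_on UNIV f" "\<And>x. x \<notin> \<Omega> \<Longrightarrow> f x = (0::real)"
  shows "(LINT x|M. f x) = (LINT x|lborel. f x)"
  using assms by (intro integral_lebesgue_on_eq_lborel) (auto intro: borel_measurable_continuous_onI)

text \<open>The product \<phi> \<psi> has compact support in \<Omega> even if \<psi> has not, so its
  partial derivatives have integral zero, and the product rule splits that integral.\<close>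

lemma integral_by_parts_test:
  assumes \<phi>: "\<phi> \<in> test_functions \<Omega>" and \<psi>: "smooth \<psi>" and b: "b \<in> Basis"
  shows "(LINT x|M. \<phi> x * (grad \<psi> x \<bullet> b)) = - (LINT x|M. (grad \<phi> x \<bullet> b) * \<psi> x)"
proof -
  let ?F = "\<lambda>x. \<phi> x * \<psi> x"
  have F: "?F \<in> test_functions \<Omega>" by (rule test_functions_mult[OF \<phi> \<psi>])
  have s: "smooth \<phi>" "smooth (\<lambda>x. grad \<psi> x \<bullet> b)" "smooth (\<lambda>x. grad \<phi> x \<bullet> b)"
    using test_functionsD(1)[OF \<phi>] \<psi> b by (auto intro: smooth_grad_component)
  have "0 = (LINT x|lborel. grad ?F x \<bullet> b)"
    by (rule integral_partial_eq_zero[OF F b, symmetric])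
  also have "\<dots> = (LINT x|M. grad ?F x \<bullet> b)"
    by (rule integral_test_eq_lborel[symmetric])
       (use test_functionsD(4,5)[OF test_functions_partial[OF F b]] in auto)
  also have "\<dots> = (LINT x|M. \<phi> x \<bullet> (grad \<psi> x \<bullet> b) + (grad \<phi> x \<bullet> b) \<bullet> \<psi> x)"
    by (rule Bochner_Integration.integral_cong)
       (auto simp: grad_mult[OF s(1) \<psi>] inner_add_left algebra_simps)
  also have "\<dots> = (LINT x|M. \<phi> x \<bullet> (grad \<psi> x \<bullet> b)) + (LINT x|M. (grad \<phi> x \<bullet> b) \<bullet> \<psi> x)"
    by (intro Bochner_Integration.integral_add sq_integrable_inner smooth_sq_integrable s \<psi>)
  finally show ?thesis by simp
qed

text \<open>The bump is a product of \<open>flat_exp\<close> applied to n times the signed distances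
  to the faces: it is zero outside the open box and tends to 1 inside as n grows.\<close>

lemma box_bumps:
  assumes "cbox a c \<subseteq> \<Omega>"
  obtains \<phi> where "\<And>n::nat. \<phi> n \<in> test_functions \<Omega>" "\<And>n x. 0 \<le> \<phi> n x" "\<And>n x. \<phi> n x \<le> 1"
    "\<And>x. (\<lambda>n. \<phi> n x) \<longlonglongrightarrow> indicator (box a c) x"
proof -
  define \<phi> where "\<phi> n x = (\<Prod>b\<in>Basis. flat_exp (real n * ((x - a) \<bullet> b)) * flat_exp (real n * ((c - x) \<bullet> b)))"
    for n and x :: 'a
  have zero: "\<exists>b\<in>Basis. (x - a) \<bullet> b \<le> 0 \<or> (c - x) \<bullet> b \<le> 0" if "x \<notin> box a c" for x
    using that by (auto simp: mem_box inner_diff_left not_less)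
  have zero': "\<phi> n x = 0" if x: "x \<notin> box a c" for n x
  proof -
    obtain b where "b \<in> Basis" "(x - a) \<bullet> b \<le> 0 \<or> (c - x) \<bullet> b \<le> 0" using zero[OF x] by blast
    then have "flat_exp (real n * ((x - a) \<bullet> b)) * flat_exp (real n * ((c - x) \<bullet> b)) = 0"
      using flat_exp_bounds(4)[of "real n * ((x - a) \<bullet> b)"] flat_exp_bounds(4)[of "real n * ((c - x) \<bullet> b)"]
      by (auto simp: mult_nonneg_nonpos)
    then show ?thesis unfolding \<phi>_def using \<open>b \<in> Basis\<close> by (intro prod_zero) auto
  qed
  show ?thesis
  proof (rule that[of \<phi>])
    show "\<phi> n \<in> test_functions \<Omega>" for n
    proof (rule test_functionsI[of _ "cbox a c"])
      show "smooth (\<phi> n)"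
        unfolding \<phi>_def inner_diff_left
        by (intro smooth_prod smooth_mult smooth_compose[OF smooth_flat_exp] smooth_diff) simp_all
    qed (use assms in \<open>auto intro!: zero' dest: subsetD[OF box_subset_cbox]\<close>)
    show "0 \<le> \<phi> n x" for n x
      unfolding \<phi>_def by (intro prod_nonneg mult_nonneg_nonneg) (auto simp: flat_exp_bounds)
    show "\<phi> n x \<le> 1" for n x
      unfolding \<phi>_def by (intro prod_le_1) (auto simp: flat_exp_bounds intro!: mult_le_one)
    show "(\<lambda>n. \<phi> n x) \<longlonglongrightarrow> indicator (box a c) x" for x
    proof (cases "x \<in> box a c")
      case True
      have "(\<lambda>n. \<phi> n x) \<longlonglongrightarrow> (\<Prod>b\<in>(Basis::'a set). 1 * 1)"
        unfolding \<phi>_def using True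
        by (intro tendsto_prod tendsto_mult flat_exp_tendsto_1) (auto simp: mem_box inner_diff_left)
      then show ?thesis using True by simp
    qed (simp add: zero')
  qed
qed

text \<open>Fundamental lemma of the calculus of variations. Bumps give integral zero over open
  boxes with closure in \<Omega>. Boxes are stable under intersection and generate the Borel sets,
  so the integral over every Borel part of a fixed such box vanishes, and countably many boxes cover
  \<Omega>.\<close>

lemma du_Bois_Reymond:
  assumes h: "integrable M h" and orth: "\<And>\<phi>. \<phi> \<in> test_functions \<Omega> \<Longrightarrow> (LINT x|M. h x * \<phi> x) = (0::real)"
  shows "AE x in M. h x = 0"
proof -
  have hm: "h \<in> borel_measurable M" using h by simp
  define H where "H x = (if x \<in> \<Omega> then h x else 0)" for x
  have H: "integrable lebesgue H"
  proof -
    have "H = (\<lambda>x. indicator \<Omega> x *\<^sub>R h x)" by (simp add: H_def fun_eq_iff)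
    then show ?thesis using h by (simp add: integrable_restrict_space)
  qed
  then have "H \<in> borel_measurable lebesgue" by simp
  \<comment> \<open>Boxes generate only the Borel sets, so the Lebesgue measurable H is replaced by
    a Borel function k that equals it almost everywhere.\<close>
  then obtain k where k[measurable]: "k \<in> borel_measurable lborel" and "AE x in lborel. H x = k x"
    using completion_ex_borel_measurable_real by blast
  then have Hk: "AE x in lebesgue. H x = k x" using AE_completion by blast
  have kL: "integrable lebesgue k"
    by (rule integrable_cong_AE_imp[OF H]) (use Hk in \<open>auto intro: measurable_completion\<close>)
  then have kl: "integrable lborel k"
    using k by (simp add: integrable_completion)
  have box0: "(LINT x|lborel. indicator (box a c) x * k x) = 0" if ac: "cbox a c \<subseteq> \<Omega>" for a c
  proof -
    obtain \<phi> where \<phi>: "\<And>n::nat. \<phi> n \<in> test_functions \<Omega>" "\<And>n x. 0 \<le> \<phi> n x" "\<And>n x. \<phi> n x \<le> 1"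
      "\<And>x. (\<lambda>n. \<phi> n x) \<longlonglongrightarrow> indicator (box a c) x" using box_bumps[OF ac] by metis
    have "(\<lambda>n. LINT x|M. h x * \<phi> n x) \<longlonglongrightarrow> (LINT x|M. h x * indicator (box a c) x)"
    proof (rule integral_dominated_convergence[where w = "\<lambda>x. \<bar>h x\<bar>"])
      show "AE x in M. norm (h x * \<phi> n x) \<le> \<bar>h x\<bar>" for n
        using \<phi>(2,3)[of n] by (auto simp: abs_mult intro!: mult_left_le)
      show "(\<lambda>x. h x * indicator (box a c) x) \<in> borel_measurable M"
        by (intro borel_measurable_times hm measurable_restrict_space1[of _ lebesgue] borel_measurable_indicator) auto
      show "(\<lambda>x. h x * \<phi> n x) \<in> borel_measurable M" for n
        using hm continuous_measurable[OF test_functionsD(5)[OF \<phi>(1)]] by simp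
      show "AE x in M. (\<lambda>n. h x * \<phi> n x) \<longlonglongrightarrow> h x * indicator (box a c) x"
        by (intro AE_I2 tendsto_mult tendsto_const \<phi>(4))
    qed (use h in auto)
    then have "(LINT x|M. h x * indicator (box a c) x) = 0"
      using orth[OF \<phi>(1)] by (simp add: LIMSEQ_const_iff)
    moreover have "(LINT x|M. h x * indicator (box a c) x) = (LINT x|lebesgue. indicator (box a c) x * H x)"
      by (simp add: integral_restrict_space) (rule Bochner_Integration.integral_cong, auto simp: H_def indicator_def)
    moreover have "\<dots> = (LINT x|lebesgue. indicator (box a c) x * k x)"
    proof (rule integral_cong_AE)
      show "(\<lambda>x. indicator (box a c) x * H x) \<in> borel_measurable lebesgue"
        using H by (intro borel_measurable_times borel_measurable_indicator) auto
      show "(\<lambda>x. indicator (box a c) x * k x) \<in> borel_measurable lebesgue"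
        by (intro measurable_completion) measurable
    qed (use Hk in auto)
    moreover have "\<dots> = (LINT x|lborel. indicator (box a c) x * k x)"
      by (rule integral_completion) measurable
    ultimately show ?thesis by simp
  qed
  have cbox_AE: "AE x in lborel. x \<in> box a c \<longrightarrow> k x = 0" if ac: "cbox a c \<subseteq> \<Omega>" for a c
  proof -
    define f where "f x = indicator (box a c) x * k x" for x
    have f: "integrable lborel f"
      using integrable_mult_indicator[of "box a c" lborel k] kl by (simp add: f_def[abs_def])
    have fA: "integrable lborel (\<lambda>x. indicator A x * f x)" if "A \<in> sets borel" for A
      using integrable_mult_indicator[of A lborel f] that f by simp
    let ?G = "range (\<lambda>(a, b). box a b :: 'a set)"
    have IS: "Int_stable ?G" by (auto simp: Int_stable_def box_Int_box)
    have PW: "?G \<subseteq> Pow UNIV" by simp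
    have sig: "A \<in> sigma_sets UNIV ?G" if "A \<in> sets borel" for A
      using that by (simp add: borel_eq_box)
    have "(LINT x|lborel. indicator A x * f x) = 0" if "A \<in> sets borel" for A
      using IS PW sig[OF that]
    proof (induction A rule: sigma_sets_induct_disjoint)
      case (basic A)
      then obtain p q where A: "A = box p q" by auto
      obtain p' q' where pq: "box p q \<inter> box a c = box p' q'" "cbox p' q' \<subseteq> \<Omega> \<or> box p' q' = {}"
      proof -
        \<comment> \<open>Cutting an arbitrary box with the fixed one gives a box whose closed
          version still lies in \<Omega>, so \<open>box0\<close> applies to it.\<close>
        define p' where "p' = (\<Sum>i\<in>Basis. max (p \<bullet> i) (a \<bullet> i) *\<^sub>R i)"
        define q' where "q' = (\<Sum>i\<in>Basis. min (q \<bullet> i) (c \<bullet> i) *\<^sub>R i)"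
        have "box p q \<inter> box a c = box p' q'" unfolding p'_def q'_def by (rule box_Int_box)
        moreover have "cbox p' q' \<subseteq> cbox a c" by (auto simp: mem_box p'_def q'_def)
        ultimately show ?thesis using that ac by blast
      qed
      have "indicator A x * f x = indicator (box p' q') x * k x" for x
        using pq(1) A unfolding f_def by (auto simp: indicator_def)
      then show ?case using pq(2) box0[of p' q'] by auto
    next
      case (compl A)
      then have A: "A \<in> sets borel" by (simp add: borel_eq_box)
      have "(LINT x|lborel. f x) = 0" unfolding f_def using box0[OF ac] by simp
      moreover have "indicator (UNIV - A) x * f x = f x - indicator A x * f x" for x
        by (auto simp: indicator_def)
      ultimately show ?case using compl.IH fA[OF A] f by simp
    next
      case (union A)
      have A: "A i \<in> sets lborel" for i using union by (auto simp: borel_eq_box)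
      have "set_lebesgue_integral lborel (\<Union>i. A i) f = (\<Sum>i. set_lebesgue_integral lborel (A i) f)"
      proof (rule lebesgue_integral_countable_add)
        show "set_integrable lborel (\<Union>i. A i) f"
          using fA[of "\<Union>i. A i"] A by (auto simp: set_integrable_def)
      qed (use A union in \<open>auto simp: disjoint_family_on_def\<close>)
      then show ?case using union by (simp add: set_lebesgue_integral_def)
    qed auto
    then have "AE x in lborel. f x = (\<lambda>x. 0) x"
      by (intro density_unique_real f) (auto simp: set_lebesgue_integral_def)
    then show ?thesis by eventually_elim (auto simp: f_def)
  qed
  \<comment> \<open>The countable cover of \<Omega> consists of closed boxes; their boundaries are
    null sets.\<close>
  have cbox_AE': "AE x in lebesgue. x \<in> cbox a c \<longrightarrow> k x = 0" if ac: "cbox a c \<subseteq> \<Omega>" for a c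
  proof -
    have "AE x in lebesgue. x \<notin> cbox a c - box a c"
      using negligible_frontier_interval[of a c] by (intro AE_not_in) (simp add: negligible_iff_null_sets)
    with AE_completion[OF cbox_AE[OF ac]] show ?thesis by eventually_elim auto
  qed
  obtain \<D> where \<D>: "countable \<D>" "\<D> \<subseteq> Pow \<Omega>" "\<And>X. X \<in> \<D> \<Longrightarrow> \<exists>a b. X = cbox a b" "\<Union>\<D> = \<Omega>"
    using open_countable_Union_open_cbox[OF open_Omega] by blast
  have "AE x in lebesgue. \<forall>X\<in>\<D>. x \<in> X \<longrightarrow> k x = 0"
  proof (subst AE_ball_countable[OF \<D>(1)], rule ballI)
    fix X assume X: "X \<in> \<D>"
    then obtain a c where "X = cbox a c" using \<D>(3) by blast
    with X \<D>(2) show "AE x in lebesgue. x \<in> X \<longrightarrow> k x = 0" using cbox_AE'[of a c] by auto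
  qed
  with Hk have "AE x in lebesgue. x \<in> \<Omega> \<longrightarrow> h x = 0"
    by eventually_elim (use \<D>(4) in \<open>auto simp: H_def split: if_splits\<close>)
  then show ?thesis by (simp add: AE_restrict_space_iff)
qed

end

section \<open>Approximation and the chain rule in \<open>H1_0\<close>\<close>

text \<open>Membership in \<open>H1_0\<close> with a named gradient g and a named approximating
  sequence: operations are carried out on the sequence, away from the choice hidden in
  \<open>weak_gradient\<close>.\<close>

definition H1_approx ::
    "'a::euclidean_space set \<Rightarrow> ('a \<Rightarrow> real) \<Rightarrow> ('a \<Rightarrow> 'a) \<Rightarrow> (nat \<Rightarrow> 'a \<Rightarrow> real) \<Rightarrow> bool" where
  "H1_approx \<Omega> u g \<phi> \<longleftrightarrow>
     sq_integrable (lebesgue_on \<Omega>) u \<and> sq_integrable (lebesgue_on \<Omega>) g \<and>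
     (\<forall>n. \<phi> n \<in> test_functions \<Omega>) \<and>
     (\<lambda>n. sq_int (lebesgue_on \<Omega>) (\<lambda>x. \<phi> n x - u x)) \<longlonglongrightarrow> 0 \<and>
     (\<lambda>n. sq_int (lebesgue_on \<Omega>) (\<lambda>x. grad (\<phi> n) x - g x)) \<longlonglongrightarrow> 0"

lemma L2_iff: "u \<in> L2 \<Omega> \<longleftrightarrow> sq_integrable (lebesgue_on \<Omega>) u"
  by (simp add: L2_def sq_integrable_def)

lemma H1_approx_subseq: "H1_approx \<Omega> u g \<phi> \<Longrightarrow> strict_mono r \<Longrightarrow> H1_approx \<Omega> u g (\<lambda>n. \<phi> (r n))"
  unfolding H1_approx_def by (auto intro: LIMSEQ_subseq_LIMSEQ[unfolded o_def])

context bounded_open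
begin

lemma test_function_sq_integrable:
  assumes "\<phi> \<in> test_functions \<Omega>"
  shows "sq_integrable M \<phi>" "sq_integrable M (grad \<phi>)"
  using smooth_sq_integrable grad_sq_integrable test_functionsD(1)[OF assms] by auto

lemma sq_integrable_component: "sq_integrable M g \<Longrightarrow> sq_integrable M (\<lambda>x. g x \<bullet> b)"
proof (rule sq_integrable_bound[where g = "\<lambda>x. (norm b)\<^sup>2 * (norm (g x))\<^sup>2"])
  assume g: "sq_integrable M g"
  show "(\<lambda>x. g x \<bullet> b) \<in> borel_measurable M" using sq_integrable_measurable[OF g] by measurable
  show "integrable M (\<lambda>x. (norm b)\<^sup>2 * (norm (g x))\<^sup>2)" using g by (simp add: sq_integrable_def)
  have "(norm (g x \<bullet> b))\<^sup>2 \<le> (norm b)\<^sup>2 * (norm (g x))\<^sup>2" for x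
    using power_mono[OF Cauchy_Schwarz_ineq2[of "g x" b], of 2] by (simp add: power_mult_distrib mult.commute)
  then show "AE x in M. (norm (g x \<bullet> b))\<^sup>2 \<le> (norm b)\<^sup>2 * (norm (g x))\<^sup>2" by simp
qed

lemma sq_int_component_le: 
  assumes "sq_integrable M g" "b \<in> Basis"
  shows "sq_int M (\<lambda>x. g x \<bullet> b) \<le> sq_int M g"
  unfolding sq_int_def
proof (rule integral_mono)
  show "(norm (g x \<bullet> b))\<^sup>2 \<le> (norm (g x))\<^sup>2" for x
    using power_mono[OF Basis_le_norm[OF assms(2), of "g x"] abs_ge_zero, of 2] by simp
qed (use assms(1) sq_integrable_component[OF assms(1), of b] in \<open>auto simp: sq_integrable_def\<close>)

text \<open>Each component of g - g' is orthogonal to all test functions, so the fundamental lemma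
  applies to it.\<close>

lemma weak_gradient_unique:
  assumes "has_weak_gradient \<Omega> u g" "has_weak_gradient \<Omega> u g'"
  shows "AE x in M. g x = g' x"
proof -
  have g: "sq_integrable M g" "sq_integrable M g'"
    using assms by (auto simp: has_weak_gradient_def L2_iff)
  have "AE x in M. (g x - g' x) \<bullet> b = 0" if b: "b \<in> Basis" for b
  proof (rule du_Bois_Reymond)
    show "integrable M (\<lambda>x. (g x - g' x) \<bullet> b)"
      by (intro sq_integrable_integrable sq_integrable_component sq_integrable_diff g)
    fix \<phi> assume \<phi>: "\<phi> \<in> test_functions \<Omega>"
    have i: "integrable M (\<lambda>x. (g x \<bullet> b) * \<phi> x)" "integrable M (\<lambda>x. (g' x \<bullet> b) * \<phi> x)"
      using sq_integrable_inner[OF sq_integrable_component[OF g(1)] test_function_sq_integrable(1)[OF \<phi>]]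
        sq_integrable_inner[OF sq_integrable_component[OF g(2)] test_function_sq_integrable(1)[OF \<phi>]] by auto
    have "(LINT x|M. (g x \<bullet> b) * \<phi> x) = (LINT x|M. (g' x \<bullet> b) * \<phi> x)"
    proof -
      have "- (LINT x|M. (g x \<bullet> b) * \<phi> x) = - (LINT x|M. (g' x \<bullet> b) * \<phi> x)"
        using assms[unfolded has_weak_gradient_def, THEN conjunct2, rule_format, OF \<phi> b] by simp
      then show ?thesis by simp
    qed
    then show "(LINT x|M. ((g x - g' x) \<bullet> b) * \<phi> x) = 0"
      using i by (simp add: inner_diff_left left_diff_distrib)
  qed
  then have "AE x in M. \<forall>b\<in>Basis. (g x - g' x) \<bullet> b = 0"
    by (intro AE_finite_allI) auto
  then show ?thesis
    by eventually_elim (rule euclidean_eqI, simp add: inner_diff_left)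
qed

lemma has_weak_gradient_weak_gradient:
  "has_weak_gradient \<Omega> u g \<Longrightarrow> has_weak_gradient \<Omega> u (weak_gradient \<Omega> u)"
  unfolding weak_gradient_def by (rule someI[of "has_weak_gradient \<Omega> u"])

text \<open>The approximants of u are test functions, so no boundary term arises even if \<psi> is
  nonzero at the boundary. This is the form in which the zero boundary values of u are exploited;
  with \<psi> = 1 it says that each component of the gradient has integral zero.\<close>

lemma H1_approx_by_parts:
  assumes "H1_approx \<Omega> u g \<phi>" "smooth \<psi>" "b \<in> Basis"
  shows "(LINT x|M. u x * (grad \<psi> x \<bullet> b)) = - (LINT x|M. (g x \<bullet> b) * \<psi> x)"
proof -
  note A = assms(1)[unfolded H1_approx_def]
  have t: "\<phi> n \<in> test_functions \<Omega>" for n using A by blast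
  have s: "sq_integrable M (\<lambda>x. grad \<psi> x \<bullet> b)" "sq_integrable M \<psi>"
    using smooth_sq_integrable smooth_grad_component assms by blast+
  have z: "(\<lambda>n. sq_int M (\<lambda>x. f x - f x)) \<longlonglongrightarrow> 0" for f :: "'a \<Rightarrow> real"
    by (simp add: sq_int_def)
  have lim1: "(\<lambda>n. LINT x|M. \<phi> n x \<bullet> (grad \<psi> x \<bullet> b)) \<longlonglongrightarrow> (LINT x|M. u x \<bullet> (grad \<psi> x \<bullet> b))"
    by (rule sq_int_inner_tendsto[OF _ _ _ s(1) s(1) z]) (use A t test_function_sq_integrable in auto)
  have lim2: "(\<lambda>n. LINT x|M. (grad (\<phi> n) x \<bullet> b) \<bullet> \<psi> x) \<longlonglongrightarrow> (LINT x|M. (g x \<bullet> b) \<bullet> \<psi> x)"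
  proof (rule sq_int_inner_tendsto[OF _ _ _ s(2) s(2) z])
    show "sq_integrable M (\<lambda>x. grad (\<phi> n) x \<bullet> b)" for n
      by (rule sq_integrable_component[OF test_function_sq_integrable(2)[OF t]])
    show "sq_integrable M (\<lambda>x. g x \<bullet> b)" by (rule sq_integrable_component) (use A in blast)
    show "(\<lambda>n. sq_int M (\<lambda>x. grad (\<phi> n) x \<bullet> b - g x \<bullet> b)) \<longlonglongrightarrow> 0"
    proof (rule tendsto_sandwich[OF _ _ tendsto_const])
      show "\<forall>\<^sub>F n in sequentially. sq_int M (\<lambda>x. grad (\<phi> n) x \<bullet> b - g x \<bullet> b) \<le> sq_int M (\<lambda>x. grad (\<phi> n) x - g x)"
        using sq_int_component_le[OF sq_integrable_diff[OF test_function_sq_integrable(2)[OF t]] assms(3)] A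
        by (auto simp: inner_diff_left)
    qed (use A in auto)
  qed
  have eq: "(LINT x|M. \<phi> n x \<bullet> (grad \<psi> x \<bullet> b)) = - (LINT x|M. (grad (\<phi> n) x \<bullet> b) \<bullet> \<psi> x)" for n
    using integral_by_parts_test[OF t assms(2,3)] by simp
  show ?thesis
    using LIMSEQ_unique[OF lim1[unfolded eq] tendsto_minus[OF lim2]] by simp
qed

lemma H1_approx_has_weak_gradient:
  assumes "H1_approx \<Omega> u g \<phi>"
  shows "has_weak_gradient \<Omega> u g"
  unfolding has_weak_gradient_def
proof (intro conjI ballI)
  show "g \<in> L2 \<Omega>" using assms by (simp add: H1_approx_def L2_iff)
  show "(LINT x|M. u x * frechet_derivative \<psi> (at x) b) = - (LINT x|M. (g x \<bullet> b) * \<psi> x)"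
    if "\<psi> \<in> test_functions \<Omega>" "b \<in> Basis" for \<psi> b
    using H1_approx_by_parts[OF assms test_functionsD(1)] that by (simp add: grad_inner_Basis)
qed

lemma H1_approx_test: "\<phi> \<in> test_functions \<Omega> \<Longrightarrow> H1_approx \<Omega> \<phi> (grad \<phi>) (\<lambda>n. \<phi>)"
  unfolding H1_approx_def using test_function_sq_integrable by (simp add: sq_int_def)

lemma has_weak_gradient_diff:
  assumes u: "has_weak_gradient \<Omega> u g" "sq_integrable M u" and v: "has_weak_gradient \<Omega> v h" "sq_integrable M v"
  shows "has_weak_gradient \<Omega> (\<lambda>x. u x - v x) (\<lambda>x. g x - h x)"
  unfolding has_weak_gradient_def
proof (intro conjI ballI)
  have gh: "sq_integrable M g" "sq_integrable M h"
    using assms by (auto simp: has_weak_gradient_def L2_iff)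
  show "(\<lambda>x. g x - h x) \<in> L2 \<Omega>" unfolding L2_iff by (rule sq_integrable_diff[OF gh])
  fix \<psi> :: "'a \<Rightarrow> real" and b :: 'a assume \<psi>: "\<psi> \<in> test_functions \<Omega>" and b: "b \<in> Basis"
  have s: "sq_integrable M (\<lambda>x. frechet_derivative \<psi> (at x) b)" "sq_integrable M \<psi>"
    using smooth_sq_integrable smoothD(2)[OF test_functionsD(1)[OF \<psi>] b] test_functionsD(1)[OF \<psi>] by blast+
  show "(LINT x|M. (u x - v x) * frechet_derivative \<psi> (at x) b) = - (LINT x|M. ((g x - h x) \<bullet> b) * \<psi> x)"
    using u(1) v(1) \<psi> b sq_integrable_inner[OF u(2) s(1)] sq_integrable_inner[OF v(2) s(1)]
      sq_integrable_inner[OF sq_integrable_component[OF gh(1)] s(2), of b]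
      sq_integrable_inner[OF sq_integrable_component[OF gh(2)] s(2), of b]
    by (simp add: has_weak_gradient_def left_diff_distrib inner_diff_left)
qed

text \<open>By uniqueness any known weak gradient may stand in for the chosen one, which makes the
  H1 distance to a test function computable.\<close>

lemma H1_norm_diff_test:
  assumes u: "has_weak_gradient \<Omega> u g" "sq_integrable M u" and \<phi>: "\<phi> \<in> test_functions \<Omega>"
  shows "H1_norm \<Omega> (\<lambda>x. u x - \<phi> x) =
    sqrt (sq_int M (\<lambda>x. \<phi> x - u x) + sq_int M (\<lambda>x. grad \<phi> x - g x))"
proof -
  have w: "has_weak_gradient \<Omega> (\<lambda>x. u x - \<phi> x) (\<lambda>x. g x - grad \<phi> x)"
    by (rule has_weak_gradient_diff[OF u H1_approx_has_weak_gradient[OF H1_approx_test[OF \<phi>]]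
          test_function_sq_integrable(1)[OF \<phi>]])
  note w' = has_weak_gradient_weak_gradient[OF w]
  have "sq_int M (weak_gradient \<Omega> (\<lambda>x. u x - \<phi> x)) = sq_int M (\<lambda>x. g x - grad \<phi> x)"
    using weak_gradient_unique[OF w' w] w w'
    by (intro sq_int_cong_AE) (auto simp: has_weak_gradient_def L2_iff sq_integrable_measurable)
  then have "H1_norm \<Omega> (\<lambda>x. u x - \<phi> x) = sqrt (sq_int M (\<lambda>x. u x - \<phi> x) + sq_int M (\<lambda>x. g x - grad \<phi> x))"
    unfolding H1_norm_def by (simp add: sq_int_def)
  then show ?thesis
    using sq_int_minus_commute[of M u \<phi>] sq_int_minus_commute[of M g "grad \<phi>"] by simp
qed

text \<open>The two L^2 errors in \<open>H1_approx\<close> add up to the squared H1 distance, and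
  almost everywhere uniqueness identifies the chosen \<open>weak_gradient\<close> with g.\<close>

lemma H1_approx_H1_0:
  assumes "H1_approx \<Omega> u g \<phi>"
  shows "u \<in> H1_0 \<Omega>" "AE x in M. weak_gradient \<Omega> u x = g x"
proof -
  note A = assms[unfolded H1_approx_def] and w = H1_approx_has_weak_gradient[OF assms]
  have "(\<lambda>n. sqrt (sq_int M (\<lambda>x. \<phi> n x - u x) + sq_int M (\<lambda>x. grad (\<phi> n) x - g x))) \<longlonglongrightarrow> sqrt (0 + 0)"
    using A by (intro tendsto_intros) auto
  then have "(\<lambda>n. H1_norm \<Omega> (\<lambda>x. u x - \<phi> n x)) \<longlonglongrightarrow> 0"
    using H1_norm_diff_test[OF w] A by simp
  moreover have "u \<in> H1 \<Omega>" using A w unfolding H1_def L2_iff by auto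
  ultimately show "u \<in> H1_0 \<Omega>"
    using A unfolding H1_0_def by auto
  show "AE x in M. weak_gradient \<Omega> u x = g x"
    by (rule weak_gradient_unique[OF has_weak_gradient_weak_gradient[OF w] w])
qed

text \<open>The squared H1 distance dominates both L^2 errors, so functions and gradients converge
  separately.\<close>

lemma H1_0_approx:
  assumes "u \<in> H1_0 \<Omega>"
  obtains \<phi> where "H1_approx \<Omega> u (weak_gradient \<Omega> u) \<phi>"
proof -
  obtain g \<phi> where u: "sq_integrable M u" "has_weak_gradient \<Omega> u g" "\<And>n. \<phi> n \<in> test_functions \<Omega>"
    "(\<lambda>n::nat. H1_norm \<Omega> (\<lambda>x. u x - \<phi> n x)) \<longlonglongrightarrow> 0"
    using assms unfolding H1_0_def H1_def L2_iff by auto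
  note w = has_weak_gradient_weak_gradient[OF u(2)]
  let ?a = "\<lambda>n. sq_int M (\<lambda>x. \<phi> n x - u x)" and ?b = "\<lambda>n. sq_int M (\<lambda>x. grad (\<phi> n) x - weak_gradient \<Omega> u x)"
  have "(\<lambda>n. (sqrt (?a n + ?b n))\<^sup>2) \<longlonglongrightarrow> 0\<^sup>2"
    using u(4) unfolding H1_norm_diff_test[OF w u(1,3)] by (rule tendsto_power)
  then have *: "(\<lambda>n. ?a n + ?b n) \<longlonglongrightarrow> 0" by simp
  have "?a \<longlonglongrightarrow> 0" by (rule tendsto_sandwich[OF _ _ tendsto_const *]) auto
  moreover have "?b \<longlonglongrightarrow> 0" by (rule tendsto_sandwich[OF _ _ tendsto_const *]) auto
  ultimately have "H1_approx \<Omega> u (weak_gradient \<Omega> u) \<phi>"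
    using u w by (simp add: H1_approx_def has_weak_gradient_def L2_iff)
  then show ?thesis by (rule that)
qed

lemma H1_0_sq_integrable:
  assumes "u \<in> H1_0 \<Omega>"
  shows "sq_integrable M u" "sq_integrable M (weak_gradient \<Omega> u)"
  using H1_0_approx[OF assms] unfolding H1_approx_def by blast+

lemma H1_approx_lincomb:
  assumes "H1_approx \<Omega> u g \<phi>" "H1_approx \<Omega> v h \<psi>"
  shows "H1_approx \<Omega> (\<lambda>x. u x + c * v x) (\<lambda>x. g x + c *\<^sub>R h x) (\<lambda>n x. \<phi> n x + c * \<psi> n x)"
proof -
  note A = assms(1)[unfolded H1_approx_def] and B = assms(2)[unfolded H1_approx_def]
  have lim: "(\<lambda>n. sq_int M (\<lambda>x. p n x + c *\<^sub>R q n x - (P x + c *\<^sub>R Q x))) \<longlonglongrightarrow> 0"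
    if "\<And>n. sq_integrable M (p n)" "sq_integrable M P" "(\<lambda>n. sq_int M (\<lambda>x. p n x - P x)) \<longlonglongrightarrow> 0"
      "\<And>n. sq_integrable M (q n)" "sq_integrable M Q" "(\<lambda>n. sq_int M (\<lambda>x. q n x - Q x)) \<longlonglongrightarrow> 0"
    for p q and P Q :: "'a \<Rightarrow> 'b::euclidean_space"
  proof -
    have "(\<lambda>n. 2 * sq_int M (\<lambda>x. p n x - P x) + 2 * (c\<^sup>2 * sq_int M (\<lambda>x. q n x - Q x))) \<longlonglongrightarrow> 2 * 0 + 2 * (c\<^sup>2 * 0)"
      by (intro tendsto_intros that)
    then have lim: "(\<lambda>n. 2 * sq_int M (\<lambda>x. p n x - P x) + 2 * (c\<^sup>2 * sq_int M (\<lambda>x. q n x - Q x))) \<longlonglongrightarrow> 0" by simp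
    have eq: "p n x + c *\<^sub>R q n x - (P x + c *\<^sub>R Q x) = (p n x - P x) + c *\<^sub>R (q n x - Q x)" for n x
      by (simp add: algebra_simps)
    have "sq_int M (\<lambda>x. p n x + c *\<^sub>R q n x - (P x + c *\<^sub>R Q x)) \<le>
      2 * sq_int M (\<lambda>x. p n x - P x) + 2 * (c\<^sup>2 * sq_int M (\<lambda>x. q n x - Q x))" for n
      using sq_int_add_le[OF sq_integrable_diff[OF that(1,2)] sq_integrable_scaleR[OF sq_integrable_diff[OF that(4,5)]], of n c n]
      unfolding eq by (simp add: sq_int_scaleR)
    then show ?thesis
      by (intro tendsto_sandwich[OF _ _ tendsto_const lim]) auto
  qed
  have t: "\<phi> n \<in> test_functions \<Omega>" "\<psi> n \<in> test_functions \<Omega>" for n using A B by auto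
  have gr: "grad (\<lambda>x. \<phi> n x + c * \<psi> n x) x = grad (\<phi> n) x + c *\<^sub>R grad (\<psi> n) x" for n x
    using test_functionsD(1)[OF t(1)] test_functionsD(1)[OF t(2)]
    by (simp add: grad_add grad_scale smooth_mult)
  show ?thesis
    unfolding H1_approx_def gr
  proof (intro conjI allI)
    show "sq_integrable M (\<lambda>x. u x + c * v x)" "sq_integrable M (\<lambda>x. g x + c *\<^sub>R h x)"
      using A B sq_integrable_scaleR[of M v c] sq_integrable_scaleR[of M h c] by (auto intro!: sq_integrable_add)
    show "(\<lambda>x. \<phi> n x + c * \<psi> n x) \<in> test_functions \<Omega>" for n
      by (intro test_functions_add test_functions_scale t)
    show "(\<lambda>n. sq_int M (\<lambda>x. \<phi> n x + c * \<psi> n x - (u x + c * v x))) \<longlonglongrightarrow> 0"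
      using lim[of \<phi> u \<psi> v] A B test_function_sq_integrable(1)[OF t(1)] test_function_sq_integrable(1)[OF t(2)]
      by simp
    show "(\<lambda>n. sq_int M (\<lambda>x. grad (\<phi> n) x + c *\<^sub>R grad (\<psi> n) x - (g x + c *\<^sub>R h x))) \<longlonglongrightarrow> 0"
      using lim[of "\<lambda>n. grad (\<phi> n)" g "\<lambda>n. grad (\<psi> n)" h] A B
        test_function_sq_integrable(2)[OF t(1)] test_function_sq_integrable(2)[OF t(2)]
      by simp
  qed
qed

lemma H1_0_lincomb:
  assumes "u \<in> H1_0 \<Omega>" "v \<in> H1_0 \<Omega>"
  shows "(\<lambda>x. u x + c * v x) \<in> H1_0 \<Omega>"
    "AE x in M. weak_gradient \<Omega> (\<lambda>x. u x + c * v x) x = weak_gradient \<Omega> u x + c *\<^sub>R weak_gradient \<Omega> v x"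
proof -
  obtain \<phi> \<psi> where "H1_approx \<Omega> u (weak_gradient \<Omega> u) \<phi>" "H1_approx \<Omega> v (weak_gradient \<Omega> v) \<psi>"
    using H1_0_approx[OF assms(1)] H1_0_approx[OF assms(2)] by metis
  from H1_approx_H1_0[OF H1_approx_lincomb[OF this]]
  show "(\<lambda>x. u x + c * v x) \<in> H1_0 \<Omega>"
    "AE x in M. weak_gradient \<Omega> (\<lambda>x. u x + c * v x) x = weak_gradient \<Omega> u x + c *\<^sub>R weak_gradient \<Omega> v x" .
qed

lemma H1_0_zero:
  shows "(\<lambda>x. 0) \<in> H1_0 \<Omega>" "AE x in M. weak_gradient \<Omega> (\<lambda>x. 0) x = 0"
  using H1_approx_H1_0[OF H1_approx_test[OF test_functions_zero]] by simp_all

end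

section \<open>The chain rule for compositions of the form H x (u x)\<close>

lemma tendsto_zero_le:
  fixes a b :: "nat \<Rightarrow> real"
  assumes "\<And>n. 0 \<le> a n" "\<And>n. a n \<le> b n" "b \<longlonglongrightarrow> 0"
  shows "a \<longlonglongrightarrow> 0"
  by (rule tendsto_sandwich[OF _ _ tendsto_const assms(3)]) (use assms in auto)

lemma sq_int_tendsto_zero_dominated:
  assumes "\<And>n. f n \<in> borel_measurable M" "integrable M w"
    and "\<And>n. AE x in M. (norm (f n x))\<^sup>2 \<le> w x" "AE x in M. (\<lambda>n. f n x) \<longlonglongrightarrow> 0"
  shows "(\<lambda>n. sq_int M (f n)) \<longlonglongrightarrow> 0"
proof -
  have "(\<lambda>n. LINT x|M. (norm (f n x))\<^sup>2) \<longlonglongrightarrow> (LINT x|M. 0)"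
  proof (rule integral_dominated_convergence[OF _ _ assms(2)])
    show "AE x in M. (\<lambda>n. (norm (f n x))\<^sup>2) \<longlonglongrightarrow> 0"
      using assms(4)
    proof eventually_elim
      case (elim x)
      then have "(\<lambda>n. (norm (f n x))\<^sup>2) \<longlonglongrightarrow> (norm (0::'b))\<^sup>2" by (intro tendsto_intros)
      then show ?case by simp
    qed
  qed (use assms in auto)
  then show ?thesis by (simp add: sq_int_def)
qed

lemma sq_int_mult_bound:
  assumes "sq_integrable M f" "g \<in> borel_measurable M" "AE x in M. norm (g x) \<le> C * norm (f x)"
  shows "sq_integrable M g" "sq_int M g \<le> C\<^sup>2 * sq_int M f"
proof -
  have i: "integrable M (\<lambda>x. C\<^sup>2 * (norm (f x))\<^sup>2)" using assms(1) by (simp add: sq_integrable_def)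
  have le: "AE x in M. (norm (g x))\<^sup>2 \<le> C\<^sup>2 * (norm (f x))\<^sup>2"
    using assms(3)
  proof eventually_elim
    case (elim x)
    from power_mono[OF this norm_ge_zero, of 2] show ?case by (simp add: power_mult_distrib)
  qed
  show s: "sq_integrable M g" by (rule sq_integrable_bound[OF assms(2) i le])
  have "(LINT x|M. (norm (g x))\<^sup>2) \<le> (LINT x|M. C\<^sup>2 * (norm (f x))\<^sup>2)"
    using s le i by (intro integral_mono_AE) (auto simp: sq_integrable_def)
  then show "sq_int M g \<le> C\<^sup>2 * sq_int M f" by (simp add: sq_int_def)
qed

context bounded_open
begin

lemma H1_approx_cong_AE:
  assumes "H1_approx \<Omega> u g \<phi>" "AE x in M. u x = v x" "AE x in M. g x = h x"
    "v \<in> borel_measurable M" "h \<in> borel_measurable M"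
  shows "H1_approx \<Omega> v h \<phi>"
proof -
  note A = assms(1)[unfolded H1_approx_def]
  have t: "\<phi> n \<in> borel_measurable M" "grad (\<phi> n) \<in> borel_measurable M" for n
    using A test_function_sq_integrable[of "\<phi> n"] sq_integrable_measurable[of M "\<phi> n"]
      sq_integrable_measurable[of M "grad (\<phi> n)"] by auto
  have vh: "sq_integrable M v" "sq_integrable M h"
    using sq_integrable_cong_AE[OF _ assms(4)] sq_integrable_cong_AE[OF _ assms(5)] assms(2,3) A
    by (auto simp: eq_commute)
  have "sq_int M (\<lambda>x. \<phi> n x - u x) = sq_int M (\<lambda>x. \<phi> n x - v x)" 
    "sq_int M (\<lambda>x. grad (\<phi> n) x - g x) = sq_int M (\<lambda>x. grad (\<phi> n) x - h x)" for n
  proof -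
    show "sq_int M (\<lambda>x. \<phi> n x - u x) = sq_int M (\<lambda>x. \<phi> n x - v x)"
      using assms(2,4) t(1) A by (intro sq_int_cong_AE borel_measurable_diff) (auto simp: sq_integrable_def)
    show "sq_int M (\<lambda>x. grad (\<phi> n) x - g x) = sq_int M (\<lambda>x. grad (\<phi> n) x - h x)"
      using assms(3,5) t(2) A by (intro sq_int_cong_AE borel_measurable_diff) (auto simp: sq_integrable_def)
  qed
  then show ?thesis using A vh by (simp add: H1_approx_def)
qed

lemma measurable_pair_compose:
  fixes H :: "'a \<Rightarrow> real \<Rightarrow> 'b::euclidean_space"
  assumes "continuous_on UNIV (\<lambda>p. H (fst p) (snd p))" "u \<in> borel_measurable M"
  shows "(\<lambda>x. H x (u x)) \<in> borel_measurable M"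
  by (rule borel_measurable_continuous_Pair[OF continuous_measurable[OF continuous_on_id] assms(2,1)])

lemma continuous_pair_section:
  fixes H :: "'a \<Rightarrow> real \<Rightarrow> 'b::euclidean_space"
  assumes "continuous_on UNIV (\<lambda>p. H (fst p) (snd p))" "(f \<longlongrightarrow> l) F"
  shows "((\<lambda>n. H x (f n)) \<longlongrightarrow> H x l) F"
proof -
  have "continuous_on UNIV (\<lambda>s. H x s)"
    using continuous_on_compose2[OF assms(1) continuous_on_Pair[OF continuous_on_const[of UNIV x] continuous_on_id]] by simp
  then show ?thesis using continuous_on_tendsto_compose[of UNIV "H x" f l F] assms(2) by simp
qed

text \<open>\<open>H\<close> need not be defined sensibly outside \<open>\<Omega>\<close>; this is why the test functions are cut off there.\<close>

lemma H1_approx_compose: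
  fixes H Hs :: "'a \<Rightarrow> real \<Rightarrow> real" and Hx :: "'a \<Rightarrow> real \<Rightarrow> 'a"
  assumes A: "H1_approx \<Omega> u g \<phi>"
    and cont: "continuous_on UNIV (\<lambda>p. H (fst p) (snd p))" "continuous_on UNIV (\<lambda>p. Hx (fst p) (snd p))"
      "continuous_on UNIV (\<lambda>p. Hs (fst p) (snd p))"
    and der: "\<And>x s. x \<in> \<Omega> \<Longrightarrow> ((\<lambda>p. H (fst p) (snd p)) has_derivative 
        (\<lambda>h. Hx x s \<bullet> fst h + Hs x s * snd h)) (at (x, s))"
    and test: "\<And>\<psi>. \<psi> \<in> test_functions \<Omega> \<Longrightarrow> (\<lambda>x. if x \<in> \<Omega> then H x (\<psi> x) else 0) \<in> test_functions \<Omega>"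
    and I: "convex I" "\<And>n x. x \<in> \<Omega> \<Longrightarrow> \<phi> n x \<in> I" "AE x in M. u x \<in> I"
    and bound: "\<And>x s. x \<in> \<Omega> \<Longrightarrow> s \<in> I \<Longrightarrow> norm (Hx x s) \<le> C" "\<And>x s. x \<in> \<Omega> \<Longrightarrow> s \<in> I \<Longrightarrow> \<bar>Hs x s\<bar> \<le> C"
  obtains r where "strict_mono r"
    "H1_approx \<Omega> (\<lambda>x. H x (u x)) (\<lambda>x. Hx x (u x) + Hs x (u x) *\<^sub>R g x) (\<lambda>n x. if x \<in> \<Omega> then H x (\<phi> (r n) x) else 0)"
proof -
  note A' = A[unfolded H1_approx_def]
  have t: "\<phi> n \<in> test_functions \<Omega>" for n using A' by blast
  note ts = test_function_sq_integrable[OF t]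
  have u: "sq_integrable M u" and g: "sq_integrable M g" using A' by auto
  note um = sq_integrable_measurable[OF u] and gm = sq_integrable_measurable[OF g]
  \<comment> \<open>L^2 convergence gives pointwise convergence only along a subsequence, and the
    errors \<open>e1\<close> and \<open>e3\<close> below need the pointwise version.\<close>
  obtain r where r: "strict_mono r" "AE x in M. (\<lambda>n. \<phi> (r n) x) \<longlonglongrightarrow> u x"
    by (rule sq_int_tendsto_AE_subseq[OF ts(1) u]) (use A' in auto)
  define \<psi> where "\<psi> n = (\<lambda>x. if x \<in> \<Omega> then H x (\<phi> (r n) x) else 0)" for n
  have \<psi>: "\<psi> n \<in> test_functions \<Omega>" for n unfolding \<psi>_def by (rule test[OF t])
  note \<psi>s = test_function_sq_integrable[OF \<psi>]
  have lim: "(\<lambda>n. sq_int M (\<lambda>x. \<phi> (r n) x - u x)) \<longlonglongrightarrow> 0" "(\<lambda>n. sq_int M (\<lambda>x. grad (\<phi> (r n)) x - g x)) \<longlonglongrightarrow> 0"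
    using H1_approx_subseq[OF A r(1)] by (auto simp: H1_approx_def)
  have \<phi>m: "\<phi> n \<in> borel_measurable M" "grad (\<phi> n) \<in> borel_measurable M" for n
    by (rule sq_integrable_measurable[OF ts(1)], rule sq_integrable_measurable[OF ts(2)])
  note m = measurable_pair_compose[OF cont(1) um] measurable_pair_compose[OF cont(2) um] measurable_pair_compose[OF cont(3) um]
    measurable_pair_compose[OF cont(1) \<phi>m(1)] measurable_pair_compose[OF cont(2) \<phi>m(1)] measurable_pair_compose[OF cont(3) \<phi>m(1)]
    um gm \<phi>m
  have C: "C \<ge> 0" if "x \<in> \<Omega>" for x using bound(1)[OF that I(2)[OF that, of 0]] norm_ge_zero[of "Hx x (\<phi> 0 x)"] order_trans[of 0 "norm (Hx x (\<phi> 0 x))" C] by simp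
  have Lip: "\<bar>H x s - H x q\<bar> \<le> C * \<bar>s - q\<bar>" if x: "x \<in> \<Omega>" and s: "s \<in> I" "q \<in> I" for x s q
  proof -
    have D: "((\<lambda>s. H x s) has_derivative (\<lambda>h. Hs x s * h)) (at s within I)" for s
    proof -
      have "((\<lambda>s. (x, s)) has_derivative (\<lambda>h. (0, h))) (at s)" by (intro has_derivative_Pair has_derivative_const has_derivative_ident)
      from has_derivative_compose[where g = "\<lambda>p. H (fst p) (snd p)", OF this der[OF x, of s]]
      have "((\<lambda>s. H x s) has_derivative (\<lambda>h. Hs x s * h)) (at s)" by simp
      then show ?thesis by (rule has_derivative_at_withinI)
    qed
    have "norm (H x s - H x q) \<le> C * norm (s - q)"
    proof (rule differentiable_bound[OF I(1) D _ s])
      show "onorm (\<lambda>h. Hs x t * h) \<le> C" if "t \<in> I" for t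
        using bound(2)[OF x that] C[OF x] by (intro onorm_bound) (auto simp: abs_mult intro: mult_right_mono)
    qed
    then show ?thesis by simp
  qed
  have gr: "grad (\<psi> n) x = Hx x (\<phi> (r n) x) + Hs x (\<phi> (r n) x) *\<^sub>R grad (\<phi> (r n)) x" if x: "x \<in> \<Omega>" for n x
  proof (rule grad_unique)
    have "((\<lambda>x. (x, \<phi> (r n) x)) has_derivative (\<lambda>h. (h, grad (\<phi> (r n)) x \<bullet> h))) (at x)"
      by (intro has_derivative_Pair has_derivative_ident smooth_has_derivative_grad test_functionsD(1)[OF t])
    from has_derivative_compose[where g = "\<lambda>p. H (fst p) (snd p)", OF this der[OF x, of "\<phi> (r n) x"]]
    have "((\<lambda>x. H x (\<phi> (r n) x)) has_derivative (\<lambda>h. (Hx x (\<phi> (r n) x) + Hs x (\<phi> (r n) x) *\<^sub>R grad (\<phi> (r n)) x) \<bullet> h)) (at x)"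
      by (simp add: inner_add_left)
    then show "(\<psi> n has_derivative (\<lambda>h. (Hx x (\<phi> (r n) x) + Hs x (\<phi> (r n) x) *\<^sub>R grad (\<phi> (r n)) x) \<bullet> h)) (at x)"
      by (rule has_derivative_transform_within_open[OF _ open_Omega x]) (simp add: \<psi>_def)
  qed
  have AE_I: "AE x in M. x \<in> \<Omega> \<and> u x \<in> I \<and> (\<lambda>n. \<phi> (r n) x) \<longlonglongrightarrow> u x"
    using I(3) r(2) AE_M_I[of "\<lambda>x. x \<in> \<Omega>"] by auto
  have d: "sq_integrable M (\<lambda>x. \<psi> n x - H x (u x))" "sq_int M (\<lambda>x. \<psi> n x - H x (u x)) \<le> C\<^sup>2 * sq_int M (\<lambda>x. \<phi> (r n) x - u x)" for n
  proof -
    have *: "(\<lambda>x. \<psi> n x - H x (u x)) \<in> borel_measurable M"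
      by (rule borel_measurable_diff[OF sq_integrable_measurable[OF \<psi>s(1)] m(1)])
    have **: "AE x in M. norm (\<psi> n x - H x (u x)) \<le> C * norm (\<phi> (r n) x - u x)"
      using AE_I by eventually_elim (use Lip I(2) in \<open>auto simp: \<psi>_def\<close>)
    have ***: "sq_integrable M (\<lambda>x. \<phi> (r n) x - u x)" by (intro sq_integrable_diff ts u)
    show "sq_integrable M (\<lambda>x. \<psi> n x - H x (u x))" "sq_int M (\<lambda>x. \<psi> n x - H x (u x)) \<le> C\<^sup>2 * sq_int M (\<lambda>x. \<phi> (r n) x - u x)"
      by (rule sq_int_mult_bound[OF *** * **])+
  qed
  have c1: "sq_integrable M (\<lambda>x. H x (u x))"
    using sq_integrable_diff[OF \<psi>s(1)[of 0] d(1)[of 0]] by simp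
  have c2: "(\<lambda>n. sq_int M (\<lambda>x. \<psi> n x - H x (u x))) \<longlonglongrightarrow> 0"
    by (rule tendsto_zero_le[OF sq_int_nonneg d(2)]) (use tendsto_mult_left[OF lim(1), of "C\<^sup>2"] in simp)
  have Hxu: "sq_integrable M (\<lambda>x. Hx x (u x))"
  proof (rule bounded_sq_integrable[OF m(2), of C])
    show "AE x in M. norm (Hx x (u x)) \<le> C"
      using AE_I by eventually_elim (use bound(1) in auto)
  qed
  have Hsg: "sq_integrable M (\<lambda>x. Hs x (u x) *\<^sub>R g x)"
  proof (rule sq_int_mult_bound(1)[OF g, of _ C])
    show "(\<lambda>x. Hs x (u x) *\<^sub>R g x) \<in> borel_measurable M" by (rule borel_measurable_scaleR[OF m(3) gm])
    show "AE x in M. norm (Hs x (u x) *\<^sub>R g x) \<le> C * norm (g x)"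
      using AE_I by eventually_elim (use bound(2) in \<open>auto intro: mult_right_mono\<close>)
  qed
  \<comment> \<open>The gradient error splits into three parts. \<open>e1\<close> and
    \<open>e3\<close> tend to zero by continuity and dominated convergence, with a constant and a
    multiple of |g|^2 as bounds for their squares; \<open>e2\<close> is a bounded factor times the
    gradient error of the approximants.\<close>
  define e1 where "e1 n x = Hx x (\<phi> (r n) x) - Hx x (u x)" for n x
  define e2 where "e2 n x = Hs x (\<phi> (r n) x) *\<^sub>R (grad (\<phi> (r n)) x - g x)" for n x
  define e3 where "e3 n x = (Hs x (\<phi> (r n) x) - Hs x (u x)) *\<^sub>R g x" for n x
  have e1: "(\<lambda>n. sq_int M (e1 n)) \<longlonglongrightarrow> 0" "sq_integrable M (e1 n)" for n
  proof -
    have le: "AE x in M. norm (e1 n x) \<le> 2 * C" for n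
      using AE_I
    proof eventually_elim
      case (elim x)
      then show ?case using bound(1)[of x "\<phi> (r n) x"] bound(1)[of x "u x"] I(2)[of x "r n"]
          norm_triangle_ineq4[of "Hx x (\<phi> (r n) x)" "Hx x (u x)"] by (simp add: e1_def)
    qed
    have me: "e1 n \<in> borel_measurable M" for n unfolding e1_def by (rule borel_measurable_diff[OF m(5) m(2)])
    show "sq_integrable M (e1 n)" by (rule bounded_sq_integrable[OF me le])
    show "(\<lambda>n. sq_int M (e1 n)) \<longlonglongrightarrow> 0"
    proof (rule sq_int_tendsto_zero_dominated[OF me, of "\<lambda>x. (2 * C)\<^sup>2"])
      show "AE x in M. (norm (e1 n x))\<^sup>2 \<le> (2 * C)\<^sup>2" for n
        using le[of n] by eventually_elim (rule power_mono[OF _ norm_ge_zero])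
      show "AE x in M. (\<lambda>n. e1 n x) \<longlonglongrightarrow> 0"
        using AE_I
      proof eventually_elim
        case (elim x)
        then have "(\<lambda>n. e1 n x) \<longlonglongrightarrow> Hx x (u x) - Hx x (u x)"
          unfolding e1_def by (intro tendsto_diff tendsto_const continuous_pair_section[OF cont(2)]) auto
        then show ?case by simp
      qed
    qed simp
  qed
  have e2: "(\<lambda>n. sq_int M (e2 n)) \<longlonglongrightarrow> 0" "sq_integrable M (e2 n)" for n
  proof -
    have b: "AE x in M. norm (e2 n x) \<le> C * norm (grad (\<phi> (r n)) x - g x)" for n
      using AE_I by eventually_elim (use bound(2) I(2) in \<open>auto simp: e2_def intro: mult_right_mono\<close>)
    have me: "e2 n \<in> borel_measurable M" for n unfolding e2_def by (rule borel_measurable_scaleR[OF m(6) borel_measurable_diff[OF \<phi>m(2) gm]])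
    have s: "sq_integrable M (\<lambda>x. grad (\<phi> (r n)) x - g x)" for n by (intro sq_integrable_diff ts g)
    show "sq_integrable M (e2 n)" by (rule sq_int_mult_bound[OF s me b])
    have "sq_int M (e2 n) \<le> C\<^sup>2 * sq_int M (\<lambda>x. grad (\<phi> (r n)) x - g x)" for n by (rule sq_int_mult_bound[OF s me b])
    then show "(\<lambda>n. sq_int M (e2 n)) \<longlonglongrightarrow> 0"
      using tendsto_mult_left[OF lim(2), of "C\<^sup>2"] by (intro tendsto_zero_le[OF sq_int_nonneg]) auto
  qed
  have e3: "(\<lambda>n. sq_int M (e3 n)) \<longlonglongrightarrow> 0" "sq_integrable M (e3 n)" for n
  proof -
    have le: "AE x in M. norm (e3 n x) \<le> (2 * C) * norm (g x)" for n
      using AE_I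
    proof eventually_elim
      case (elim x)
      then have "\<bar>Hs x (\<phi> (r n) x) - Hs x (u x)\<bar> \<le> 2 * C" 
        using bound(2)[of x "\<phi> (r n) x"] bound(2)[of x "u x"] I(2)[of x "r n"] by simp
      then show ?case by (simp add: e3_def mult_right_mono)
    qed
    have me: "e3 n \<in> borel_measurable M" for n unfolding e3_def by (rule borel_measurable_scaleR[OF borel_measurable_diff[OF m(6) m(3)] gm])
    show "sq_integrable M (e3 n)" by (rule sq_int_mult_bound[OF g me le])
    show "(\<lambda>n. sq_int M (e3 n)) \<longlonglongrightarrow> 0"
    proof (rule sq_int_tendsto_zero_dominated[OF me, of "\<lambda>x. (2 * C)\<^sup>2 * (norm (g x))\<^sup>2"])
      show "AE x in M. (norm (e3 n x))\<^sup>2 \<le> (2 * C)\<^sup>2 * (norm (g x))\<^sup>2" for n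
        using le[of n]
      proof eventually_elim
        case (elim x)
        from power_mono[OF this norm_ge_zero, of 2] show ?case by (simp add: power_mult_distrib)
      qed
      show "integrable M (\<lambda>x. (2 * C)\<^sup>2 * (norm (g x))\<^sup>2)" using g by (simp add: sq_integrable_def)
      show "AE x in M. (\<lambda>n. e3 n x) \<longlonglongrightarrow> 0"
        using AE_I
      proof eventually_elim
        case (elim x)
        then have "(\<lambda>n. e3 n x) \<longlonglongrightarrow> (Hs x (u x) - Hs x (u x)) *\<^sub>R g x"
          unfolding e3_def by (intro tendsto_scaleR tendsto_diff tendsto_const continuous_pair_section[OF cont(3)]) auto
        then show ?case by simp
      qed
    qed
  qed
  have eq: "sq_int M (\<lambda>x. grad (\<psi> n) x - (Hx x (u x) + Hs x (u x) *\<^sub>R g x)) = sq_int M (\<lambda>x. e1 n x + e2 n x + e3 n x)" for n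
    unfolding sq_int_def
    by (rule Bochner_Integration.integral_cong) (auto simp: gr e1_def e2_def e3_def algebra_simps)
  have le: "sq_int M (\<lambda>x. e1 n x + e2 n x + e3 n x) \<le> 2 * (2 * sq_int M (e1 n) + 2 * sq_int M (e2 n)) + 2 * sq_int M (e3 n)" for n
    using sq_int_add_le[OF sq_integrable_add[OF e1(2)[of n] e2(2)[of n]] e3(2)[of n]] sq_int_add_le[OF e1(2)[of n] e2(2)[of n]] by simp
  have "(\<lambda>n. 2 * (2 * sq_int M (e1 n) + 2 * sq_int M (e2 n)) + 2 * sq_int M (e3 n)) \<longlonglongrightarrow> 2 * (2 * 0 + 2 * 0) + 2 * 0"
    by (intro tendsto_intros e1 e2 e3)
  then have "(\<lambda>n. 2 * (2 * sq_int M (e1 n) + 2 * sq_int M (e2 n)) + 2 * sq_int M (e3 n)) \<longlonglongrightarrow> 0" by simp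
  from tendsto_zero_le[OF sq_int_nonneg le this]
  have "(\<lambda>n. sq_int M (\<lambda>x. e1 n x + e2 n x + e3 n x)) \<longlonglongrightarrow> 0" .
  then have "H1_approx \<Omega> (\<lambda>x. H x (u x)) (\<lambda>x. Hx x (u x) + Hs x (u x) *\<^sub>R g x) \<psi>"
    unfolding H1_approx_def eq using c1 c2 \<psi> sq_integrable_add[OF Hxu Hsg] by simp
  then show ?thesis using that[OF r(1)] unfolding \<psi>_def by blast
qed

end

lemma smooth_real_DERIV:
  fixes S :: "real \<Rightarrow> real"
  assumes "smooth S"
  obtains S' where "\<And>s. (S has_real_derivative S' s) (at s)" "smooth S'"
proof
  have "frechet_derivative S (at s) 1 * h = frechet_derivative S (at s) h" for s h
  proof -
    have "linear (frechet_derivative S (at s))"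
      using smoothD(1)[OF assms, of s] has_derivative_linear by blast
    from linear_cmul[OF this, of h 1] show ?thesis by simp
  qed
  then have "frechet_derivative S (at s) = (*) (frechet_derivative S (at s) 1)" for s by (simp add: fun_eq_iff)
  then show "(S has_real_derivative frechet_derivative S (at s) 1) (at s)" for s
    using smoothD(1)[OF assms, of s] unfolding has_field_derivative_def by simp
  show "smooth (\<lambda>s. frechet_derivative S (at s) 1)" by (rule smoothD(2)[OF assms]) simp
qed

text \<open>\<open>\<tau> s\<close> is \<open>s\<close> times a smooth cutoff function, so it is the identity near \<open>[-K, K]\<close> but not monotone.\<close>

lemma smooth_clamp:
  fixes K :: real
  assumes "K \<ge> 0"
  obtains \<tau> \<tau>' B where "smooth \<tau>" "\<And>s. (\<tau> has_real_derivative \<tau>' s) (at s)" "continuous_on UNIV \<tau>'"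
    "\<And>s. \<bar>\<tau> s\<bar> \<le> B" "\<And>s. \<bar>\<tau>' s\<bar> \<le> B" "\<And>s. \<bar>s\<bar> \<le> K \<Longrightarrow> \<tau> s = s" "\<And>s. \<bar>s\<bar> \<le> K \<Longrightarrow> \<tau>' s = 1"
proof -
  \<comment> \<open>The margin makes \<tau> the identity on a neighbourhood of [-K, K], so its
    derivative is 1 at the end points as well.\<close>
  define L where "L = K + 1"
  have L: "L > 0" using assms by (simp add: L_def)
  \<comment> \<open>a is positive exactly for |s| < L + 1 and b exactly for |s| > L. Hence a + b has
    no zero, and a / (a + b) is a smooth cutoff that is 1 up to L and 0 from L + 1 on.\<close>
  define a where "a s = flat_exp ((L + 1)\<^sup>2 - s\<^sup>2)" for s
  define b where "b s = flat_exp (s\<^sup>2 - L\<^sup>2)" for s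
  define \<tau> where "\<tau> s = s * (a s * inverse (a s + b s))" for s
  have sm: "smooth a" "smooth b"
    unfolding a_def b_def power2_eq_square
    by (intro smooth_compose[OF smooth_flat_exp] smooth_diff smooth_mult smooth_const smooth_ident)+
  have ab: "a s \<ge> 0" "b s \<ge> 0" for s by (auto simp: a_def b_def flat_exp_bounds)
  have LL: "L\<^sup>2 < (L + 1)\<^sup>2" using L by (intro power_strict_mono) auto
  have pos: "a s + b s > 0" for s
  proof (cases "s\<^sup>2 < (L + 1)\<^sup>2")
    case True
    then have "a s > 0" by (simp add: a_def flat_exp_bounds)
    then show ?thesis using ab(2)[of s] by simp
  next
    case False
    then have "b s > 0" using LL by (simp add: b_def flat_exp_bounds)
    then show ?thesis using ab(1)[of s] by simp
  qed
  have smooth: "smooth \<tau>"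
    unfolding \<tau>_def by (intro smooth_mult smooth_ident smooth_inverse smooth_add sm) (use pos in \<open>auto simp: less_imp_neq[symmetric]\<close>)
  have in1: "\<tau> s = s" if "\<bar>s\<bar> \<le> L" for s
  proof -
    have "s\<^sup>2 \<le> L\<^sup>2" using power_mono[OF that abs_ge_zero, of 2] by simp
    then have "b s = 0" by (simp add: b_def flat_exp_bounds)
    then show ?thesis using pos[of s] by (simp add: \<tau>_def)
  qed
  have out: "\<tau> s = 0" if "\<bar>s\<bar> \<ge> L + 1" for s
  proof -
    have "(L + 1)\<^sup>2 \<le> s\<^sup>2" using power_mono[OF that, of 2] L by simp
    then have "a s = 0" by (simp add: a_def flat_exp_bounds)
    then show ?thesis by (simp add: \<tau>_def)
  qed
  obtain \<tau>' where \<tau>': "\<And>s. (\<tau> has_real_derivative \<tau>' s) (at s)" "smooth \<tau>'" using smooth_real_DERIV[OF smooth] by metis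
  have c: "continuous_on UNIV \<tau>'" by (rule smoothD(3)[OF \<tau>'(2)])
  have d1: "\<tau>' s = 1" if "\<bar>s\<bar> \<le> K" for s
  proof -
    have "(\<tau> has_real_derivative 1) (at s)"
      by (rule has_field_derivative_transform_within_open[OF DERIV_ident, of "{-L<..<L}"])
         (use that in1 in \<open>auto simp: L_def\<close>)
    then show ?thesis using \<tau>'(1) DERIV_unique by blast
  qed
  have d0: "\<tau>' s = 0" if "\<bar>s\<bar> > L + 1" for s
  proof -
    have "(\<tau> has_real_derivative 0) (at s)"
      by (rule has_field_derivative_transform_within_open[OF DERIV_const, of "- {-(L+1)..L+1}"])
         (use that out in \<open>auto simp: abs_if split: if_splits\<close>)
    then show ?thesis using \<tau>'(1) DERIV_unique by blast
  qed
  have "compact (\<tau>' ` {-(L+1)..L+1})"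
    by (intro compact_continuous_image) (auto intro: continuous_on_subset[OF c])
  then obtain C where C: "\<forall>y\<in>\<tau>' ` {-(L+1)..L+1}. norm y \<le> C"
    using compact_imp_bounded bounded_iff by metis
  have b1: "\<bar>\<tau>' s\<bar> \<le> max C (L + 1)" for s
  proof (cases "\<bar>s\<bar> \<le> L + 1")
    case True
    then have "s \<in> {-(L+1)..L+1}" by auto
    then have "\<bar>\<tau>' s\<bar> \<le> C" using C by auto
    then show ?thesis by simp
  qed (use d0 L in \<open>simp add: max_def\<close>)
  have b0: "\<bar>\<tau> s\<bar> \<le> max C (L + 1)" for s
  proof (cases "\<bar>s\<bar> \<le> L + 1")
    case True
    have "a s * inverse (a s + b s) \<le> 1" using ab[of s] pos[of s] by (simp add: field_simps)
    then have "\<bar>\<tau> s\<bar> \<le> \<bar>s\<bar> * 1"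
      unfolding \<tau>_def abs_mult using ab[of s] pos[of s] by (intro mult_left_mono) auto
    then show ?thesis using True by simp
  qed (use out L in \<open>simp add: max_def\<close>)
  show ?thesis
    by (rule that[OF smooth \<tau>'(1) c b0 b1]) (use in1 d1 in \<open>auto simp: L_def\<close>)
qed

context bounded_open
begin

text \<open>\<open>S 0 = 0\<close> preserves compact supports. The alternative in the bound on S
  admits functions of linear growth, such as the regularised absolute value, when the gradient of a
  vanishes on \<Omega>.\<close>

lemma H1_approx_compose_real:
  assumes A: "H1_approx \<Omega> u g \<phi>" and S: "smooth S" "S 0 = 0"
    and S': "\<And>s. (S has_real_derivative S' s) (at s)" "continuous_on UNIV S'"
    and a: "smooth a"
    and I: "convex I" "\<And>n x. x \<in> \<Omega> \<Longrightarrow> \<phi> n x \<in> I" "AE x in M. u x \<in> I"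
    and bound: "\<And>s. s \<in> I \<Longrightarrow> \<bar>S s\<bar> \<le> B \<or> (\<forall>x\<in>\<Omega>. grad a x = 0)" "\<And>s. s \<in> I \<Longrightarrow> \<bar>S' s\<bar> \<le> B"
  obtains r where "strict_mono r"
    "H1_approx \<Omega> (\<lambda>x. a x * S (u x)) (\<lambda>x. S (u x) *\<^sub>R grad a x + (a x * S' (u x)) *\<^sub>R g x) (\<lambda>n x. a x * S (\<phi> (r n) x))"
proof -
  note ca = smoothD(3)[OF a] and cg = continuous_on_grad[OF a, of UNIV] and cS = smoothD(3)[OF S(1)]
  obtain C1 where C1: "C1 > 0" "\<And>x. x \<in> \<Omega> \<Longrightarrow> norm (a x) \<le> C1" using continuous_bounded_on[OF ca] by metis
  obtain C2 where C2: "C2 > 0" "\<And>x. x \<in> \<Omega> \<Longrightarrow> norm (grad a x) \<le> C2" using continuous_bounded_on[OF cg] by metis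
  define C where "C = C1 * \<bar>B\<bar> + C2 * \<bar>B\<bar>"
  have t: "\<phi> n \<in> test_functions \<Omega>" for n using A unfolding H1_approx_def by blast
  have eq: "(if x \<in> \<Omega> then a x * S (\<psi> x) else 0) = a x * S (\<psi> x)" if "\<psi> \<in> test_functions \<Omega>" for \<psi> x
    using test_functionsD(4)[OF that, of x] S(2) by auto
  obtain r where r: "strict_mono r" "H1_approx \<Omega> (\<lambda>x. a x * S (u x)) (\<lambda>x. S (u x) *\<^sub>R grad a x + (a x * S' (u x)) *\<^sub>R g x)
      (\<lambda>n x. if x \<in> \<Omega> then a x * S (\<phi> (r n) x) else 0)"
  proof (rule H1_approx_compose[OF A, where H = "\<lambda>x s. a x * S s" and Hx = "\<lambda>x s. S s *\<^sub>R grad a x" and Hs = "\<lambda>x s. a x * S' s" and C = C])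
    show "continuous_on UNIV (\<lambda>p. a (fst p) * S (snd p))"
      by (intro continuous_intros continuous_on_compose2[OF ca] continuous_on_compose2[OF cS]) auto
    show "continuous_on UNIV (\<lambda>p. S (snd p) *\<^sub>R grad a (fst p))"
      by (intro continuous_intros continuous_on_compose2[OF cg] continuous_on_compose2[OF cS]) auto
    show "continuous_on UNIV (\<lambda>p. a (fst p) * S' (snd p))"
      by (intro continuous_intros continuous_on_compose2[OF ca] continuous_on_compose2[OF S'(2)]) auto
    show "((\<lambda>p. a (fst p) * S (snd p)) has_derivative (\<lambda>h. (S s *\<^sub>R grad a x) \<bullet> fst h + a x * S' s * snd h)) (at (x, s))" for x s
    proof -
      have "((\<lambda>p. a (fst p)) has_derivative (\<lambda>h. grad a x \<bullet> fst h)) (at (x, s))"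
        by (rule has_derivative_compose[where g = a, OF has_derivative_fst[OF has_derivative_ident]])
           (simp add: smooth_has_derivative_grad[OF a])
      moreover have "((\<lambda>p. S (snd p)) has_derivative (\<lambda>h. S' s * snd h)) (at (x, s))"
        by (rule has_derivative_compose[where g = S, OF has_derivative_snd[OF has_derivative_ident]])
           (use S'(1)[of s] in \<open>simp add: has_field_derivative_def\<close>)
      ultimately show ?thesis
        by (rule has_derivative_eq_rhs[OF has_derivative_mult]) (simp add: fun_eq_iff algebra_simps)
    qed
    show "(\<lambda>x. if x \<in> \<Omega> then a x * S (\<psi> x) else 0) \<in> test_functions \<Omega>" if \<psi>: "\<psi> \<in> test_functions \<Omega>" for \<psi>
    proof -
      have "(\<lambda>x. a x * S (\<psi> x)) \<in> test_functions \<Omega>"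
        by (rule test_functions_vanish[OF \<psi>])
           (use S(2) in \<open>auto intro!: smooth_mult a smooth_compose[OF S(1)] test_functionsD(1)[OF \<psi>]\<close>)
      then show ?thesis by (simp add: eq[OF \<psi>])
    qed
    show "norm (S s *\<^sub>R grad a x) \<le> C" if "x \<in> \<Omega>" "s \<in> I" for x s
    proof (cases "grad a x = 0")
      case True
      then show ?thesis using C1 C2 by (simp add: C_def)
    next
      case False
      then have "\<bar>S s\<bar> \<le> \<bar>B\<bar>" using bound(1)[OF that(2)] that(1) by auto
      then have "\<bar>S s\<bar> * norm (grad a x) \<le> \<bar>B\<bar> * C2" using C2(2)[OF that(1)] by (intro mult_mono) auto
      then show ?thesis using C1(1) by (simp add: C_def mult.commute add_increasing)
    qed
    show "\<bar>a x * S' s\<bar> \<le> C" if "x \<in> \<Omega>" "s \<in> I" for x s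
    proof -
      have "\<bar>a x\<bar> * \<bar>S' s\<bar> \<le> C1 * \<bar>B\<bar>"
        using C1(2)[OF that(1)] bound(2)[OF that(2)] C1(1) by (intro mult_mono) auto
      then show ?thesis using C2(1) by (simp add: C_def abs_mult add_increasing2)
    qed
  qed (use I in auto)
  show ?thesis using that[OF r(1)] r(2) by (simp add: eq[OF t])
qed

text \<open>Composing the approximants with the smooth clamp bounds them uniformly; since |u| \<le>
  K, neither u nor its gradient changes. Later compositions involve functions that are controlled
  only on bounded intervals.\<close>

lemma H1_0_bounded_approx:
  assumes u: "u \<in> H1_0 \<Omega>" and K: "AE x in M. \<bar>u x\<bar> \<le> K"
  obtains \<phi> B where "H1_approx \<Omega> u (weak_gradient \<Omega> u) \<phi>" "\<And>n x. \<bar>\<phi> n x\<bar> \<le> B" "K \<le> B"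
proof -
  obtain \<phi> where A: "H1_approx \<Omega> u (weak_gradient \<Omega> u) \<phi>" using H1_0_approx[OF u] .
  obtain \<tau> \<tau>' B where \<tau>: "smooth \<tau>" "\<And>s. (\<tau> has_real_derivative \<tau>' s) (at s)" "continuous_on UNIV \<tau>'"
    "\<And>s. \<bar>\<tau> s\<bar> \<le> B" "\<And>s. \<bar>\<tau>' s\<bar> \<le> B" "\<And>s. \<bar>s\<bar> \<le> max K 0 \<Longrightarrow> \<tau> s = s" "\<And>s. \<bar>s\<bar> \<le> max K 0 \<Longrightarrow> \<tau>' s = 1"
    by (rule smooth_clamp[of "max K 0"]) auto
  have "\<tau> 0 = 0" using \<tau>(6)[of 0] by simp
  obtain r where r: "H1_approx \<Omega> (\<lambda>x. 1 * \<tau> (u x)) (\<lambda>x. \<tau> (u x) *\<^sub>R grad (\<lambda>x. 1) x + (1 * \<tau>' (u x)) *\<^sub>R weak_gradient \<Omega> u x) 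
      (\<lambda>n x. 1 * \<tau> (\<phi> (r n) x))"
    by (rule H1_approx_compose_real[OF A \<tau>(1) \<open>\<tau> 0 = 0\<close> \<tau>(2,3) smooth_const[of 1], of UNIV B]) (use \<tau>(4,5) in auto)
  have "H1_approx \<Omega> u (weak_gradient \<Omega> u) (\<lambda>n x. 1 * \<tau> (\<phi> (r n) x))"
  proof (rule H1_approx_cong_AE[OF r])
    show "AE x in M. 1 * \<tau> (u x) = u x" using K by eventually_elim (simp add: \<tau>(6))
    show "AE x in M. \<tau> (u x) *\<^sub>R grad (\<lambda>x. 1) x + (1 * \<tau>' (u x)) *\<^sub>R weak_gradient \<Omega> u x = weak_gradient \<Omega> u x"
      using K by eventually_elim (simp add: \<tau>(7))
  qed (use H1_0_sq_integrable[OF u] in \<open>auto intro: sq_integrable_measurable\<close>)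
  moreover have "K \<le> B" using \<tau>(4)[of "max K 0"] \<tau>(6)[of "max K 0"] by simp
  ultimately show ?thesis using that[of "\<lambda>n x. \<tau> (\<phi> (r n) x)" B] \<tau>(4) by simp
qed

end

section \<open>Uniqueness for non-positive primitives\<close>

lemma interval_integral_DERIV:
  fixes f :: "real \<Rightarrow> real"
  assumes f: "continuous_on UNIV f"
  shows "((\<lambda>x. LBINT t=ereal 0..ereal x. f t) has_real_derivative f s) (at s)"
proof -
  define A where "A = \<bar>s\<bar> + 1"
  have "((\<lambda>x::real. LBINT t=ereal 0..ereal x. f t) has_vector_derivative f s) (at s within {-A..A})"
    by (rule interval_integral_FTC2) (use continuous_on_subset[OF f] in \<open>auto simp: A_def\<close>)
  then show ?thesis
    by (subst (asm) at_within_interior) (auto simp: A_def has_real_derivative_iff_has_vector_derivative)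
qed

text \<open>Weierstrass approximation is applied to f, and the polynomial is integrated term by
  term. Closeness of the derivatives together with a prescribed value at 0 yields approximation in
  C^1.\<close>

lemma polynomial_antiderivative_approx:
  fixes f :: "real \<Rightarrow> real"
  assumes "continuous_on {-K..K} f" "\<eta> > 0"
  obtains P P' where "smooth P" "\<And>s. (P has_real_derivative P' s) (at s)" "continuous_on UNIV P'"
    "P 0 = c" "\<And>s. \<bar>s\<bar> \<le> K \<Longrightarrow> \<bar>P' s - f s\<bar> < \<eta>"
proof -
  obtain r where r: "real_polynomial_function r" "\<And>s. s \<in> {-K..K} \<Longrightarrow> \<bar>f s - r s\<bar> < \<eta>"
    using Stone_Weierstrass_real_polynomial_function[OF compact_Icc assms] by blast
  obtain a n where an: "r = (\<lambda>x. \<Sum>i\<le>n. a i * x ^ i)"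
    using r(1) real_polynomial_function_iff_sum by blast
  define P where "P x = c + (\<Sum>i\<le>n. (a i / real (Suc i)) * x ^ Suc i)" for x
  have sr: "smooth r" unfolding an by (intro smooth_sum smooth_mult smooth_power smooth_const smooth_ident)
  have D: "(P has_real_derivative r s) (at s)" for s
  proof -
    have "((\<lambda>x. \<Sum>i\<le>n. (a i / real (Suc i)) * x ^ Suc i) has_real_derivative (\<Sum>i\<le>n. a i * s ^ i)) (at s)"
      by (rule DERIV_sum) (auto intro!: derivative_eq_intros simp del: power_Suc of_nat_Suc)
    from DERIV_add[OF DERIV_const this, of c] show ?thesis unfolding P_def an by simp
  qed
  show ?thesis
  proof (rule that[OF smooth_realI[OF D sr] D smoothD(3)[OF sr]])
    show "P 0 = c" by (simp add: P_def)
    show "\<bar>r s - f s\<bar> < \<eta>" if "\<bar>s\<bar> \<le> K" for s using r(2)[of s] that by (simp add: abs_minus_commute abs_le_iff)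
  qed
qed

text \<open>
  \<open>p\<close> is a polynomial that is \<open>C\<^sup>1\<close>-close to \<open>p0 = (2 * (E - G - \<delta> s)) powr (- 1 / 2)\<close>, the inverse speed of
  the profile, which satisfies \<open>p0' = (g + \<delta>) * p0^3\<close>; the term \<open>\<delta> s\<close> makes the inequality strict.
  Since \<open>p0 \<ge> 1 / (a + b s)\<close> near \<open>0\<close> with \<open>a\<^sup>2 = 2 * E\<close>, the value \<open>\<Psi> \<epsilon>\<close> exceeds any given \<open>D\<close> for small \<open>E\<close>.
\<close>

lemma barrier_function:
  fixes g G :: "real \<Rightarrow> real"
  assumes G: "\<And>s. (G has_real_derivative g s) (at s)" "G 0 = 0" "\<And>s. G s \<le> 0"
    and g: "continuous_on UNIV g" and L: "L > 0" "s0 > 0" "\<And>s. \<bar>s\<bar> \<le> s0 \<Longrightarrow> \<bar>g s\<bar> \<le> L * \<bar>s\<bar>"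
    and K: "K > 0" and \<epsilon>: "\<epsilon> > 0" and D: "D > 0"
  obtains p p' \<Psi> d where "smooth p" "\<And>s. (p has_real_derivative p' s) (at s)" "continuous_on UNIV p'"
    "smooth \<Psi>" "\<And>s. (\<Psi> has_real_derivative p s) (at s)" "\<Psi> 0 = 0" "d > 0"
    "\<And>s. \<bar>s\<bar> \<le> K \<Longrightarrow> p s > 0" "\<And>s. \<bar>s\<bar> \<le> K \<Longrightarrow> g s * p s - p' s / (p s)\<^sup>2 \<le> - d"
    "\<And>s. \<epsilon> \<le> s \<Longrightarrow> s \<le> K \<Longrightarrow> \<Psi> s > D"
proof -
  define e where "e = min \<epsilon> (min s0 K)"
  have e: "e > 0" "e \<le> \<epsilon>" "e \<le> s0" "e \<le> K" using \<epsilon> L K by (auto simp: e_def)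
  \<comment> \<open>For small s \<ge> 0 the bound |G s| \<le> L s^2 gives q s \<le> a^2 + b^2
    s^2.\<close>
  define b where "b = sqrt (2 * L)"
  have b: "b > 0" "b\<^sup>2 = 2 * L" using L by (auto simp: b_def)
  \<comment> \<open>With a = b e / X one gets 1 + b e / a = exp(2 b D + 1), so ln(1 + b e / a) / (2
    b) = D + 1 / (2 b); this logarithm is the lower bound for \<Psi> e obtained at the end.\<close>
  define X where "X = exp (2 * b * D + 1) - 1"
  have X: "X > 0" using b D by (simp add: X_def add_pos_pos)
  define a where "a = b * e / X"
  have a: "a > 0" using b e X by (simp add: a_def)
  define E where "E = a\<^sup>2 / 2"
  have E: "E > 0" using a by (simp add: E_def)
  \<comment> \<open>This keeps \<delta> s \<le> E / 2 on [-K, K], hence q \<ge> E there.\<close>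
  define \<delta> where "\<delta> = E / (2 * K)"
  have \<delta>: "\<delta> > 0" using E K by (simp add: \<delta>_def)
  \<comment> \<open>The squared speed W'^2 of the perturbed profile as a function of its height
    s.\<close>
  define q where "q s = 2 * (E - G s - \<delta> * s)" for s
  have qD: "(q has_real_derivative - 2 * (g s + \<delta>)) (at s)" for s
    unfolding q_def by (auto intro!: derivative_eq_intros G(1))
  have qE: "q s \<ge> E" if "\<bar>s\<bar> \<le> K" for s
  proof -
    have "\<delta> * s \<le> \<delta> * K" using that \<delta> by (intro mult_left_mono) auto
    also have "\<dots> = E / 2" using K by (simp add: \<delta>_def)
    finally show ?thesis using G(3)[of s] unfolding q_def by simp
  qed
  have qpos: "q s > 0" if "\<bar>s\<bar> \<le> K" for s using qE[OF that] E by simp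
  have qc: "continuous_on {-K..K} q"
    using DERIV_isCont[OF qD] by (simp add: continuous_at_imp_continuous_on)
  obtain Q where Q: "\<And>s. \<bar>s\<bar> \<le> K \<Longrightarrow> q s \<le> Q"
  proof -
    have "compact (q ` {-K..K})" by (rule compact_continuous_image[OF qc compact_Icc])
    then obtain C where C: "\<forall>y\<in>q ` {-K..K}. norm y \<le> C" using compact_imp_bounded bounded_iff by metis
    have "q s \<le> C" if "\<bar>s\<bar> \<le> K" for s
    proof -
      have "s \<in> {-K..K}" using that by auto
      then have "\<bar>q s\<bar> \<le> C" using C by auto
      then show ?thesis by simp
    qed
    then show ?thesis by (rule that)
  qed
  obtain \<Gamma> where \<Gamma>: "\<And>s. \<bar>s\<bar> \<le> K \<Longrightarrow> \<bar>g s\<bar> \<le> \<Gamma>"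
  proof -
    have "compact (g ` {-K..K})" by (rule compact_continuous_image[OF continuous_on_subset[OF g] compact_Icc]) simp
    then obtain C where C: "\<forall>y\<in>g ` {-K..K}. norm y \<le> C" using compact_imp_bounded bounded_iff by metis
    have "\<bar>g s\<bar> \<le> C" if "\<bar>s\<bar> \<le> K" for s
    proof -
      have "s \<in> {-K..K}" using that by auto
      then show ?thesis using C by auto
    qed
    then show ?thesis by (rule that)
  qed
  have \<Gamma>0: "\<Gamma> \<ge> 0" using \<Gamma>[of 0] K by auto
  have Q0: "Q > 0" using Q[of 0] qpos[of 0] K by auto
  define p0 where "p0 s = inverse (sqrt (q s))" for s
  define p1 where "p1 s = (g s + \<delta>) * (p0 s)^3" for s
  define c1 where "c1 = inverse (sqrt Q)"
  define c2 where "c2 = inverse (sqrt E)"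
  have c1: "c1 > 0" using Q0 by (simp add: c1_def)
  have c: "c1 \<le> p0 s" "p0 s \<le> c2" if "\<bar>s\<bar> \<le> K" for s
  proof -
    show "c1 \<le> p0 s" unfolding c1_def p0_def using Q[OF that] qpos[OF that] by (intro le_imp_inverse_le) auto
    show "p0 s \<le> c2" unfolding c2_def p0_def using qE[OF that] E by (intro le_imp_inverse_le) auto
  qed
  have c12: "c1 \<le> c2" using c[of 0] K by simp
  have c2: "c2 > 0" using c1 c12 by simp
  have p0D: "(p0 has_real_derivative p1 s) (at s)" if s: "\<bar>s\<bar> \<le> K" for s
  proof -
    have s1: "((\<lambda>s. sqrt (q s)) has_real_derivative (inverse (sqrt (q s)) / 2) * (- 2 * (g s + \<delta>))) (at s)"
      by (rule DERIV_chain2[OF DERIV_real_sqrt qD]) (rule qpos[OF s])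
    have i: "inverse \<bar>q s\<bar> = inverse (sqrt (q s)) * inverse (sqrt (q s))"
      using qpos[OF s] by (simp flip: inverse_mult_distrib)
    have "sqrt (q s) \<noteq> 0" using qpos[OF s] by simp
    from DERIV_inverse_fun[OF s1 this] show ?thesis
      unfolding p0_def p1_def by (rule DERIV_cong) (simp add: power3_eq_cube numeral_2_eq_2 i algebra_simps)
  qed
  have p1c: "continuous_on {-K..K} p1"
  proof -
    have "continuous_on {-K..K} p0"
      using DERIV_isCont[OF p0D] by (simp add: continuous_at_imp_continuous_on abs_le_iff)
    then show ?thesis unfolding p1_def by (intro continuous_intros continuous_on_subset[OF g]) auto
  qed
  \<comment> \<open>Error budget: an error \<eta> in p' counts once, and it causes an error of at
    most \<eta> K in p, hence 12 c2^2 \<eta> K in p^3 and 12 \<Gamma> c2^2 \<eta> K in g p^3. The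
    total is \<eta> Z, and \<eta> is chosen so that this uses at most half of the margin \<delta>
    c1^3.\<close>
  define Z where "Z = 1 + 12 * \<Gamma> * c2\<^sup>2 * K"
  have den: "Z > 0" unfolding Z_def using \<Gamma>0 K by (intro add_pos_nonneg) auto
  define \<eta> where "\<eta> = min (c1 / (2 * K)) (\<delta> * c1^3 / (2 * Z))"
  have \<eta>: "\<eta> > 0" "\<eta> * K \<le> c1 / 2" "\<eta> * Z \<le> \<delta> * c1^3 / 2"
  proof -
    show "\<eta> > 0" using c1 K \<delta> den by (simp add: \<eta>_def)
    have "\<eta> \<le> c1 / (2 * K)" by (simp add: \<eta>_def)
    then show "\<eta> * K \<le> c1 / 2" using K by (simp add: field_simps)
    have "\<eta> \<le> \<delta> * c1^3 / (2 * Z)" unfolding \<eta>_def by (rule min.cobounded2)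
    then have "\<eta> * Z \<le> \<delta> * c1^3 / (2 * Z) * Z"
      using den by (intro mult_right_mono) auto
    then show "\<eta> * Z \<le> \<delta> * c1^3 / 2" using den by (simp add: field_simps)
  qed
  obtain p p' where p: "smooth p" "\<And>s. (p has_real_derivative p' s) (at s)" "continuous_on UNIV p'" "p 0 = p0 0"
    "\<And>s. \<bar>s\<bar> \<le> K \<Longrightarrow> \<bar>p' s - p1 s\<bar> < \<eta>"
    using polynomial_antiderivative_approx[OF p1c \<eta>(1), of "p0 0"] by metis
  have close: "\<bar>p s - p0 s\<bar> \<le> \<eta> * K" if s: "\<bar>s\<bar> \<le> K" for s
  proof -
    have "norm ((p s - p0 s) - (p 0 - p0 0)) \<le> \<eta> * norm (s - 0)"
    proof (rule differentiable_bound[of "{-K..K}" "\<lambda>s. p s - p0 s" "\<lambda>s h. (p' s - p1 s) * h"])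
      fix t assume "t \<in> {-K..K}"
      then have t: "\<bar>t\<bar> \<le> K" by auto
      have "((\<lambda>s. p s - p0 s) has_real_derivative p' t - p1 t) (at t)"
        by (rule DERIV_diff[OF p(2) p0D[OF t]])
      then show "((\<lambda>s. p s - p0 s) has_derivative (\<lambda>h. (p' t - p1 t) * h)) (at t within {-K..K})"
        unfolding has_field_derivative_def by (rule has_derivative_at_withinI)
      show "onorm (\<lambda>h. (p' t - p1 t) * h) \<le> \<eta>"
        using p(5)[OF t] \<eta>(1) by (intro onorm_bound) (auto simp: abs_mult intro!: mult_right_mono)
    qed (use s K in auto)
    also have "\<dots> \<le> \<eta> * K" using s \<eta>(1) by (intro mult_left_mono) auto
    finally show ?thesis using p(4) by simp
  qed
  have pb: "p0 s / 2 \<le> p s" "p s \<le> 2 * c2" "p s > 0" if s: "\<bar>s\<bar> \<le> K" for s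
    using close[OF s] \<eta>(2) c[OF s] c1 c12 by auto
  obtain \<Psi> where \<Psi>: "smooth \<Psi>" "\<And>s. (\<Psi> has_real_derivative p s) (at s)" "\<Psi> 0 = 0"
  proof -
    define F where "F = (\<lambda>x::real. (LBINT t=ereal 0..ereal x. p t))"
    have "(F has_real_derivative p s) (at s)" for s
      unfolding F_def by (rule interval_integral_DERIV[OF smoothD(3)[OF p(1)]])
    moreover have "F 0 = 0" by (simp add: F_def)
    ultimately show ?thesis using that smooth_realI[OF _ p(1)] by blast
  qed
  define m where "m = \<delta> * c1^3 / 2"
  have m: "m > 0" using \<delta> c1 by (simp add: m_def)
  have strict: "p' s - g s * (p s)^3 \<ge> m" if s: "\<bar>s\<bar> \<le> K" for s
  proof -
    have "\<bar>(p s)^3 - (p0 s)^3\<bar> = \<bar>p s - p0 s\<bar> * \<bar>(p s)\<^sup>2 + p s * p0 s + (p0 s)\<^sup>2\<bar>"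
      by (simp add: abs_mult[symmetric] algebra_simps power2_eq_square power3_eq_cube)
    also have "\<dots> \<le> (\<eta> * K) * (12 * c2\<^sup>2)"
    proof (rule mult_mono[OF close[OF s]])
      have z: "0 \<le> p0 s" "0 \<le> p s" "p0 s \<le> 2 * c2" using c[OF s] c1 c12 pb[OF s] by auto
      have "(p s)\<^sup>2 \<le> (2 * c2)\<^sup>2" "(p0 s)\<^sup>2 \<le> (2 * c2)\<^sup>2" "p s * p0 s \<le> (2 * c2) * (2 * c2)"
        by (rule power_mono[OF pb(2)[OF s] z(2)], rule power_mono[OF z(3,1)], rule mult_mono[OF pb(2)[OF s] z(3) _ z(1)], use c2 in simp)
      then show "\<bar>(p s)\<^sup>2 + p s * p0 s + (p0 s)\<^sup>2\<bar> \<le> 12 * c2\<^sup>2"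
        using z by (simp add: power2_eq_square)
    qed (use \<eta>(1) K in auto)
    finally have diff: "\<bar>(p s)^3 - (p0 s)^3\<bar> \<le> \<eta> * (12 * c2\<^sup>2 * K)" by (simp add: algebra_simps)
    have "\<bar>g s * ((p s)^3 - (p0 s)^3)\<bar> \<le> \<Gamma> * (\<eta> * (12 * c2\<^sup>2 * K))"
      unfolding abs_mult using \<Gamma>[OF s] diff \<Gamma>0 by (intro mult_mono) auto
    then have 1: "g s * ((p s)^3 - (p0 s)^3) \<le> \<eta> * (12 * \<Gamma> * c2\<^sup>2 * K)" by (simp add: algebra_simps)
    have 2: "\<delta> * (p0 s)^3 \<ge> \<delta> * c1^3" using c(1)[OF s] c1 \<delta> by (intro mult_left_mono power_mono) auto
    \<comment> \<open>Since p1 = (g + \<delta>) p0^3, the unapproximated profile satisfies the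
      inequality with margin \<delta> p0^3.\<close>
    have "p' s - g s * (p s)^3 = (p' s - p1 s) + \<delta> * (p0 s)^3 - g s * ((p s)^3 - (p0 s)^3)"
      by (simp add: p1_def algebra_simps)
    then show ?thesis using 1 2 p(5)[OF s] \<eta>(3)[unfolded Z_def] unfolding m_def by (simp add: algebra_simps)
  qed
  \<comment> \<open>The margin m is divided by p^2, which is at most (2 c2)^2.\<close>
  define d where "d = m / (4 * c2\<^sup>2)"
  have fin1: "g s * p s - p' s / (p s)\<^sup>2 \<le> - d" if s: "\<bar>s\<bar> \<le> K" for s
  proof -
    have ps: "p s > 0" by (rule pb(3)[OF s])
    have "(p s)\<^sup>2 \<le> (2 * c2)\<^sup>2" using pb(2,3)[OF s] by (intro power_mono) auto
    then have "(p s)\<^sup>2 \<le> 4 * c2\<^sup>2" by (simp add: power_mult_distrib)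
    then have "d \<le> m / (p s)\<^sup>2" unfolding d_def using m ps c2 by (intro divide_left_mono) auto
    also have "\<dots> \<le> (p' s - g s * (p s)^3) / (p s)\<^sup>2" using strict[OF s] by (intro divide_right_mono) auto
    also have "\<dots> = p' s / (p s)\<^sup>2 - g s * p s" using ps by (simp add: field_simps power2_eq_square power3_eq_cube)
    finally show ?thesis by simp
  qed
  have Ge: "\<bar>G s\<bar> \<le> L * s\<^sup>2" if s: "0 \<le> s" "s \<le> s0" for s
  proof (cases "s = 0")
    case False
    then have "s > 0" using s by simp
    from MVT2[OF this, of G g] G(1) obtain \<xi> where \<xi>: "0 < \<xi>" "\<xi> < s" "G s - G 0 = (s - 0) * g \<xi>" by blast
    have "\<bar>g \<xi>\<bar> \<le> L * \<bar>\<xi>\<bar>" using L(3)[of \<xi>] \<xi> s by simp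
    also have "\<dots> \<le> L * s" using \<xi> L by simp
    finally have "s * \<bar>g \<xi>\<bar> \<le> s * (L * s)" using s by (intro mult_left_mono) auto
    then show ?thesis using \<xi>(3) G(2) s by (simp add: abs_mult power2_eq_square algebra_simps)
  qed (use G(2) in simp)
  have plow: "p s \<ge> 1 / (2 * (a + b * s))" if s: "0 \<le> s" "s \<le> e" for s
  proof -
    have sK: "\<bar>s\<bar> \<le> K" using s e by simp
    have "\<bar>G s\<bar> \<le> L * s\<^sup>2" "0 \<le> \<delta> * s" "b\<^sup>2 * s\<^sup>2 = 2 * (L * s\<^sup>2)" "q s = a\<^sup>2 - 2 * G s - 2 * (\<delta> * s)"
      using Ge[of s] s e \<delta> b(2) by (auto simp: q_def E_def algebra_simps)
    then have "q s \<le> a\<^sup>2 + b\<^sup>2 * s\<^sup>2" by linarith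
    also have "\<dots> \<le> (a + b * s)\<^sup>2" using a b s by (simp add: power2_sum power_mult_distrib)
    finally have "sqrt (q s) \<le> a + b * s" using a b s by (intro real_le_lsqrt) auto
    then have "inverse (a + b * s) \<le> p0 s" unfolding p0_def using qpos[OF sK] by (intro le_imp_inverse_le) auto
    moreover have "1 / (2 * (a + b * s)) = inverse (a + b * s) / 2" by (simp add: inverse_eq_divide)
    ultimately show ?thesis using pb(1)[OF sK] by linarith
  qed
  have "\<Psi> e > D"
  proof -
    \<comment> \<open>The lower bound 1 / (2 (a + b s)) for p is the derivative of ln(1 + b s / a) /
      (2 b).\<close>
    define f where "f s = \<Psi> s - ln (1 + b * s / a) / (2 * b)" for s
    have "f 0 \<le> f e"
    proof (rule DERIV_nonneg_imp_nondecreasing[of 0 e f])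
      fix s assume s: "0 \<le> s" "s \<le> e"
      have pos: "1 + b * s / a > 0" using s a b by (intro add_pos_nonneg) auto
      have "((\<lambda>s. 1 + b * s / a) has_real_derivative b / a) (at s)"
        using a by (auto intro!: derivative_eq_intros)
      from DERIV_chain2[OF DERIV_ln_divide[OF pos] this]
      have "((\<lambda>s. ln (1 + b * s / a)) has_real_derivative 1 / (1 + b * s / a) * (b / a)) (at s)" .
      from DERIV_diff[OF \<Psi>(2) DERIV_cdivide[OF this, of "2 * b"]]
      have "(f has_real_derivative p s - 1 / (1 + b * s / a) * (b / a) / (2 * b)) (at s)" unfolding f_def .
      moreover have "1 / (1 + b * s / a) * (b / a) / (2 * b) = 1 / (2 * (a + b * s))"
      proof -
        define y where "y = a + b * s"
        have y: "y > 0" unfolding y_def using s a b by (intro add_pos_nonneg) auto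
        have eq: "1 + b * s / a = y / a" using a by (simp add: y_def add_divide_distrib)
        show ?thesis unfolding eq y_def[symmetric] using a b y by simp
      qed
      ultimately show "\<exists>y. (f has_real_derivative y) (at s) \<and> 0 \<le> y" using plow[OF s] by auto
    qed (use e in simp)
    then have "\<Psi> e \<ge> ln (1 + b * e / a) / (2 * b)" by (simp add: f_def \<Psi>(3))
    moreover have "1 + b * e / a = exp (2 * b * D + 1)" using a b e X by (simp add: a_def X_def)
    moreover have "(2 * b * D + 1) / (2 * b) > D" using b by (simp add: field_simps)
    ultimately show ?thesis by simp
  qed
  moreover have "\<Psi> e \<le> \<Psi> s" if "e \<le> s" "s \<le> K" for s
  proof (rule DERIV_nonneg_imp_nondecreasing[of e s \<Psi>, OF that(1)])
    fix t assume t: "e \<le> t" "t \<le> s"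
    then have "p t > 0" using pb(3)[of t] e that by simp
    then show "\<exists>y. (\<Psi> has_real_derivative y) (at t) \<and> 0 \<le> y" using \<Psi>(2)[of t] less_imp_le by blast
  qed
  ultimately have fin2: "\<Psi> s > D" if "\<epsilon> \<le> s" "s \<le> K" for s
    using that e by (meson less_le_trans order_trans)
  have "d > 0" using m c2 by (simp add: d_def)
  then show ?thesis
    using that[OF p(1-3) \<Psi> _ pb(3) fin1 fin2] by blast
qed

section \<open>Comparison of a bounded solution with a barrier\<close>

lemma continuous_bounded_Icc:
  fixes f :: "real \<Rightarrow> real"
  assumes "continuous_on {a..b} f"
  obtains C where "C > 0" "\<And>s. a \<le> s \<Longrightarrow> s \<le> b \<Longrightarrow> \<bar>f s\<bar> \<le> C"
proof -
  have "compact (f ` {a..b})" by (rule compact_continuous_image[OF assms compact_Icc])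
  then obtain C where "C > 0" "\<forall>y\<in>f ` {a..b}. norm y \<le> C" using compact_imp_bounded bounded_pos by metis
  then show ?thesis using that by auto
qed

text \<open>For z \<le> 0 the function attains its minimum 0, so its derivative vanishes there. For
  z > 0 the formula gives T' / T = A / z^2, the size of which is tuned through A.\<close>

lemma smooth_flat_exp_scaled:
  fixes A :: real
  assumes A: "A > 0"
  obtains T' where "smooth (\<lambda>z. flat_exp (z / A))" "\<And>z. ((\<lambda>z. flat_exp (z / A)) has_real_derivative T' z) (at z)"
    "continuous_on UNIV T'" "\<And>z. z \<le> 0 \<Longrightarrow> T' z = 0" "\<And>z. z > 0 \<Longrightarrow> T' z = flat_exp (z / A) * A / z\<^sup>2"
proof -
  have s: "smooth (\<lambda>z::real. flat_exp (z / A))"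
    using smooth_compose[OF smooth_flat_exp smooth_mult[OF smooth_ident smooth_const[of "inverse A"]]]
    by (simp add: divide_inverse)
  obtain T' where T': "\<And>z. ((\<lambda>z. flat_exp (z / A)) has_real_derivative T' z) (at z)" "smooth T'"
    using smooth_real_DERIV[OF s] by metis
  have "T' z = 0" if "z \<le> 0" for z
  proof (rule DERIV_local_min[OF T'(1)[of z], of 1])
    show "\<forall>y. \<bar>z - y\<bar> < 1 \<longrightarrow> flat_exp (z / A) \<le> flat_exp (y / A)"
      using that A flat_exp_bounds(1,4) by (simp add: divide_nonpos_pos)
  qed simp
  moreover have "T' z = flat_exp (z / A) * A / z\<^sup>2" if "z > 0" for z
  proof -
    have "z / A > 0" using that A by simp
    from DERIV_chain2[OF DERIV_flat_exp[OF this] DERIV_cdivide[OF DERIV_ident]]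
    have "((\<lambda>z. flat_exp (z / A)) has_real_derivative flat_exp (z / A) / (z / A)\<^sup>2 * (1 / A)) (at z)" .
    then have "T' z = flat_exp (z / A) / (z / A)\<^sup>2 * (1 / A)" using T'(1) DERIV_unique by blast
    then show ?thesis using A that by (simp add: power_divide power2_eq_square)
  qed
  ultimately show ?thesis using that[OF s T'(1) smoothD(3)[OF T'(2)]] by blast
qed

text \<open>
  For \<open>p = \<Psi>' u\<close> and \<open>w = \<nabla>u\<close> the left-hand side is \<open>T' \<bar>\<zeta>\<bar>\<^sup>2 + p' T \<bar>w\<bar>\<^sup>2 - g p T\<close>, where \<open>\<zeta> = p w - b\<close>.
  The strict inequality for \<open>p\<close> and the size of \<open>T' / T\<close> absorb the indefinite terms.
\<close>

lemma barrier_integrand_lower_bound: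
  fixes w b :: "'a::euclidean_space" and p p' g T T' H d :: real
  assumes p: "p > 0" and b: "norm b = 1" and H: "\<bar>p' / p\<^sup>2\<bar> \<le> H" and d: "d > 0" "g * p - p' / p\<^sup>2 \<le> - d"
    and T: "T \<ge> 0" "T' \<ge> T * (H + 2 * H\<^sup>2 / d)"
  shows "w \<bullet> ((p * T') *\<^sub>R (p *\<^sub>R w - b) + (p' * T) *\<^sub>R w) - g * (p * T) - b \<bullet> (T' *\<^sub>R (p *\<^sub>R w - b)) \<ge> d / 2 * T"
proof -
  define \<zeta> where "\<zeta> = p *\<^sub>R w - b"
  define q where "q = p' / p\<^sup>2"
  define y where "y = norm \<zeta>"
  \<comment> \<open>With q = p' / p^2 and p w = \<zeta> + b, the indefinite term p' |w|^2 becomes q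
    |\<zeta> + b|^2, a quadratic in \<zeta> whose coefficients are bounded by H.\<close>
  have p': "p' = q * p\<^sup>2" using p by (simp add: q_def)
  have pw: "p *\<^sub>R w = \<zeta> + b" by (simp add: \<zeta>_def)
  have "p\<^sup>2 * (w \<bullet> w) = (\<zeta> + b) \<bullet> (\<zeta> + b)" by (simp add: pw[symmetric] power2_eq_square)
  also have "\<dots> = y\<^sup>2 + 2 * (\<zeta> \<bullet> b) + 1"
    using b by (simp add: y_def power2_norm_eq_inner inner_add_left inner_add_right inner_commute norm_eq_sqrt_inner)
  finally have w: "p\<^sup>2 * (w \<bullet> w) = y\<^sup>2 + 2 * (\<zeta> \<bullet> b) + 1" .
  have "w \<bullet> ((p * T') *\<^sub>R \<zeta> + (p' * T) *\<^sub>R w) - g * (p * T) - b \<bullet> (T' *\<^sub>R \<zeta>) =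
      T' * ((p *\<^sub>R w - b) \<bullet> \<zeta>) + q * T * (p\<^sup>2 * (w \<bullet> w)) - g * p * T"
    by (simp add: p' inner_add_right inner_diff_left algebra_simps)
  also have "\<dots> = T' * y\<^sup>2 + T * (q * (y\<^sup>2 + 2 * (\<zeta> \<bullet> b)) + (q - g * p))"
    unfolding w by (simp add: \<zeta>_def[symmetric] y_def power2_norm_eq_inner algebra_simps)
  finally have X: "w \<bullet> ((p * T') *\<^sub>R \<zeta> + (p' * T) *\<^sub>R w) - g * (p * T) - b \<bullet> (T' *\<^sub>R \<zeta>) =
      T' * y\<^sup>2 + T * (q * (y\<^sup>2 + 2 * (\<zeta> \<bullet> b)) + (q - g * p))" .
  have y: "y \<ge> 0" by (simp add: y_def)
  have H0: "H \<ge> 0" "\<bar>q\<bar> \<le> H" using H abs_ge_zero[of "p' / p\<^sup>2"] unfolding q_def by linarith+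
  have "\<bar>\<zeta> \<bullet> b\<bar> \<le> y" using Cauchy_Schwarz_ineq2[of \<zeta> b] b by (simp add: y_def)
  then have "\<bar>q * (\<zeta> \<bullet> b)\<bar> \<le> H * y" unfolding abs_mult using H0 y by (intro mult_mono) auto
  moreover have "\<bar>q * y\<^sup>2\<bar> \<le> H * y\<^sup>2" unfolding abs_mult using H0 by (intro mult_mono) auto
  ultimately have "q * (y\<^sup>2 + 2 * (\<zeta> \<bullet> b)) + (q - g * p) \<ge> - (H * y\<^sup>2) - 2 * (H * y) + d"
    using d(2) unfolding q_def[symmetric] abs_le_iff distrib_left mult.left_commute[of q 2] by linarith
  then have 1: "T * (q * (y\<^sup>2 + 2 * (\<zeta> \<bullet> b)) + (q - g * p)) \<ge> T * (- (H * y\<^sup>2) - 2 * (H * y) + d)"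
    using T(1) by (intro mult_left_mono)
  have 2: "T' * y\<^sup>2 \<ge> T * (H + 2 * H\<^sup>2 / d) * y\<^sup>2" using T(2) by (intro mult_right_mono) auto
  \<comment> \<open>Completing the square in y: the coefficient 2 H^2 / d in the assumption on T' is
    the price of the linear term 2 H y when half of d is to be kept.\<close>
  have "0 \<le> (2 / d) * (H * y - d / 2)\<^sup>2" using d by simp
  also have "(2 / d) * (H * y - d / 2)\<^sup>2 = (H + 2 * H\<^sup>2 / d) * y\<^sup>2 + (- (H * y\<^sup>2) - 2 * (H * y) + d) - d / 2"
    using d(1) by (simp add: power2_eq_square field_simps)
  finally have 3: "T * (d / 2) \<le> T * ((H + 2 * H\<^sup>2 / d) * y\<^sup>2 + (- (H * y\<^sup>2) - 2 * (H * y) + d))"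
    using T(1) by (intro mult_left_mono) auto
  have eq: "T * (E * y\<^sup>2 + R) = T * E * y\<^sup>2 + T * R" for E R
    by (simp add: distrib_left mult.assoc)
  have "T * (d / 2) \<le> T' * y\<^sup>2 + T * (q * (y\<^sup>2 + 2 * (\<zeta> \<bullet> b)) + (q - g * p))"
    by (rule order_trans[OF 3[unfolded eq] add_mono[OF 2 1]])
  then show ?thesis using X by (simp add: \<zeta>_def mult.commute)
qed

context bounded_open
begin

text \<open>On \<Omega> the affine function is positive, so \<Psi> 0 = 0 makes z negative and T(z)
  zero wherever an approximant vanishes. Hence compact supports in \<Omega> are preserved, whatever
  sign the affine function has outside.\<close>

lemma barrier_test_function:
  assumes A: "H1_approx \<Omega> u w \<phi>" and B: "\<And>n x. \<bar>\<phi> n x\<bar> \<le> B" "AE x in M. \<bar>u x\<bar> \<le> B"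
    and P: "smooth P" "\<And>s. (P has_real_derivative P' s) (at s)" "continuous_on UNIV P'"
    and \<Psi>: "smooth \<Psi>" "\<And>s. (\<Psi> has_real_derivative p s) (at s)" "continuous_on UNIV p" "\<Psi> 0 = 0"
    and T: "smooth T" "\<And>s. (T has_real_derivative T' s) (at s)" "continuous_on UNIV T'" "\<And>z. z \<le> 0 \<Longrightarrow> T z = 0"
    and l: "\<And>x. x \<in> \<Omega> \<Longrightarrow> x \<bullet> b + c > 0"
  obtains \<phi>' where "H1_approx \<Omega> (\<lambda>x. P (u x) * T (\<Psi> (u x) - (x \<bullet> b + c)))
     (\<lambda>x. (P (u x) * T' (\<Psi> (u x) - (x \<bullet> b + c))) *\<^sub>R (p (u x) *\<^sub>R w x - b) 
        + (P' (u x) * T (\<Psi> (u x) - (x \<bullet> b + c))) *\<^sub>R w x) \<phi>'"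
proof -
  define H where "H x s = P s * T (\<Psi> s - (x \<bullet> b + c))" for x s
  define Hx where "Hx x s = - ((P s * T' (\<Psi> s - (x \<bullet> b + c))) *\<^sub>R b)" for x s
  define Hs where "Hs x s = P s * T' (\<Psi> s - (x \<bullet> b + c)) * p s + P' s * T (\<Psi> s - (x \<bullet> b + c))" for x s
  note cP = smoothD(3)[OF P(1)] and cT = smoothD(3)[OF T(1)] and c\<Psi> = smoothD(3)[OF \<Psi>(1)]
  have cz: "continuous_on UNIV (\<lambda>q::'a \<times> real. \<Psi> (snd q) - (fst q \<bullet> b + c))"
    by (intro continuous_intros continuous_on_compose2[OF c\<Psi>]) auto
  have cont: "continuous_on UNIV (\<lambda>q. H (fst q) (snd q))" "continuous_on UNIV (\<lambda>q. Hx (fst q) (snd q))"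
    "continuous_on UNIV (\<lambda>q. Hs (fst q) (snd q))"
    unfolding H_def Hx_def Hs_def
    by (intro continuous_intros continuous_on_compose2[OF cP] continuous_on_compose2[OF cT cz] continuous_on_compose2[OF T(3) cz]
        continuous_on_compose2[OF P(3)] continuous_on_compose2[OF \<Psi>(3)]; simp)+
  \<comment> \<open>P, \<Psi> and T are controlled only on bounded sets; compactness of closure
    \<Omega> times [-B, B] supplies the bounds for the chain rule.\<close>
  have bdd: "\<exists>C. \<forall>x s. x \<in> \<Omega> \<longrightarrow> s \<in> {-B..B} \<longrightarrow> norm (F x s) \<le> C" if "continuous_on UNIV (\<lambda>q. F (fst q) (snd q))" 
    for F :: "'a \<Rightarrow> real \<Rightarrow> 'c::euclidean_space"
  proof -
    have "compact ((\<lambda>q. F (fst q) (snd q)) ` (closure \<Omega> \<times> {-B..B}))"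
      using bounded_Omega by (intro compact_continuous_image continuous_on_subset[OF that] compact_Times) auto
    then obtain C where "\<forall>y\<in>(\<lambda>q. F (fst q) (snd q)) ` (closure \<Omega> \<times> {-B..B}). norm y \<le> C"
      using compact_imp_bounded bounded_iff by metis
    then have "\<forall>x s. x \<in> \<Omega> \<longrightarrow> s \<in> {-B..B} \<longrightarrow> norm (F x s) \<le> C" using closure_subset[of \<Omega>] by fastforce
    then show ?thesis by blast
  qed
  obtain C1 where C1: "\<And>x s. x \<in> \<Omega> \<Longrightarrow> s \<in> {-B..B} \<Longrightarrow> norm (Hx x s) \<le> C1" using bdd[OF cont(2)] by blast
  obtain C2 where C2: "\<And>x s. x \<in> \<Omega> \<Longrightarrow> s \<in> {-B..B} \<Longrightarrow> norm (Hs x s) \<le> C2" using bdd[OF cont(3)] by blast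
  obtain r where r: "H1_approx \<Omega> (\<lambda>x. H x (u x)) (\<lambda>x. Hx x (u x) + Hs x (u x) *\<^sub>R w x)
      (\<lambda>n x. if x \<in> \<Omega> then H x (\<phi> (r n) x) else 0)"
  proof (rule H1_approx_compose[OF A cont, where I = "{-B..B}" and C = "max C1 C2"])
    fix x :: 'a and s :: real assume "x \<in> \<Omega>"
    have dz: "((\<lambda>q. \<Psi> (snd q) - (fst q \<bullet> b + c)) has_derivative (\<lambda>h. p s * snd h - fst h \<bullet> b)) (at (x, s))"
    proof -
      have "((\<lambda>q. \<Psi> (snd q)) has_derivative (\<lambda>h. p s * snd h)) (at (x, s))"
        by (rule has_derivative_compose[where g = \<Psi>, OF has_derivative_snd[OF has_derivative_ident]])
           (use \<Psi>(2)[of s] in \<open>simp add: has_field_derivative_def\<close>)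
      moreover have "((\<lambda>q. fst q \<bullet> b + c) has_derivative (\<lambda>h. fst h \<bullet> b)) (at (x, s))"
        by (auto intro!: derivative_eq_intros)
      ultimately show ?thesis by (rule has_derivative_diff)
    qed
    have dT: "((\<lambda>q. T (\<Psi> (snd q) - (fst q \<bullet> b + c))) has_derivative 
        (\<lambda>h. T' (\<Psi> s - (x \<bullet> b + c)) * (p s * snd h - fst h \<bullet> b))) (at (x, s))"
      by (rule has_derivative_compose[where g = T, OF dz])
         (use T(2)[of "\<Psi> s - (x \<bullet> b + c)"] in \<open>simp add: has_field_derivative_def\<close>)
    have dP: "((\<lambda>q. P (snd q)) has_derivative (\<lambda>h. P' s * snd h)) (at (x, s))"
      by (rule has_derivative_compose[where g = P, OF has_derivative_snd[OF has_derivative_ident]])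
         (use P(2)[of s] in \<open>simp add: has_field_derivative_def\<close>)
    show "((\<lambda>q. H (fst q) (snd q)) has_derivative (\<lambda>h. Hx x s \<bullet> fst h + Hs x s * snd h)) (at (x, s))"
      unfolding H_def
      by (rule has_derivative_eq_rhs[OF has_derivative_mult[OF dP dT]])
         (simp add: fun_eq_iff Hx_def Hs_def inner_commute algebra_simps)
  next
    fix \<psi> assume \<psi>: "\<psi> \<in> test_functions \<Omega>"
    let ?f = "\<lambda>x. if x \<in> \<Omega> then H x (\<psi> x) else 0"
    let ?K = "closure {x. \<psi> x \<noteq> 0}"
    have zero: "?f x = 0" if "x \<notin> ?K" for x
    proof -
      have "\<psi> x = 0" using that closure_subset[of "{x. \<psi> x \<noteq> 0}"] by blast
      then show ?thesis using \<Psi>(4) l[of x] T(4) by (auto simp: H_def)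
    qed
    have sH: "smooth (\<lambda>x. H x (\<psi> x))"
      unfolding H_def
      by (intro smooth_mult smooth_compose[OF P(1)] smooth_compose[OF T(1)] smooth_diff smooth_compose[OF \<Psi>(1)]
          smooth_add smooth_inner_left smooth_const test_functionsD(1)[OF \<psi>])
    have "smooth ?f"
    proof (rule smooth_local)
      fix x
      show "\<exists>U h. open U \<and> x \<in> U \<and> smooth h \<and> (\<forall>y\<in>U. ?f y = h y)"
      proof (cases "x \<in> \<Omega>")
        case True
        then show ?thesis using sH open_Omega by (intro exI[of _ \<Omega>] exI[of _ "\<lambda>x. H x (\<psi> x)"]) auto
      next
        case False
        then have "x \<in> - ?K" using test_functionsD(3)[OF \<psi>] by blast
        then show ?thesis using zero by (intro exI[of _ "- ?K"] exI[of _ "\<lambda>x. 0"]) auto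
      qed
    qed
    then show "?f \<in> test_functions \<Omega>"
      by (rule test_functionsI[OF _ test_functionsD(2,3)[OF \<psi>]]) (rule zero)
  next
    show "\<phi> n x \<in> {-B..B}" for n x using B(1)[of n x] by (auto simp: abs_le_iff)
    show "AE x in M. u x \<in> {-B..B}" using B(2) by eventually_elim auto
    show "norm (Hx x s) \<le> max C1 C2" if "x \<in> \<Omega>" "s \<in> {-B..B}" for x s using C1[OF that] by simp
    show "\<bar>Hs x s\<bar> \<le> max C1 C2" if "x \<in> \<Omega>" "s \<in> {-B..B}" for x s using C2[OF that] by simp
  qed (auto simp: convex_real_interval)
  have eq: "Hx x (u x) + Hs x (u x) *\<^sub>R w x = (P (u x) * T' (\<Psi> (u x) - (x \<bullet> b + c))) *\<^sub>R (p (u x) *\<^sub>R w x - b) 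
        + (P' (u x) * T (\<Psi> (u x) - (x \<bullet> b + c))) *\<^sub>R w x" for x
    by (simp add: Hx_def Hs_def algebra_simps)
  show ?thesis using that r unfolding eq unfolding H_def by blast
qed

text \<open>The equation is tested with p(u) T(z), and the gradient of T(z) is paired with the
  constant field b, which integrates to zero. In the difference of the two identities the integrand
  is at least d / 2 times T(z), so T(z) = 0 almost everywhere, that is, z \<le> 0.\<close>

lemma solution_below_barrier:
  assumes u: "u \<in> H1_0 \<Omega>" and K: "AE x in M. \<bar>u x\<bar> \<le> K"
    and sol: "\<And>\<phi>. \<phi> \<in> H1_0 \<Omega> \<Longrightarrow> (LINT x|M. weak_gradient \<Omega> u x \<bullet> weak_gradient \<Omega> \<phi> x) = (LINT x|M. g (u x) * \<phi> x)"
    and g: "continuous_on UNIV g"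
    and p: "smooth p" "\<And>s. (p has_real_derivative p' s) (at s)" "continuous_on UNIV p'"
    and \<Psi>: "smooth \<Psi>" "\<And>s. (\<Psi> has_real_derivative p s) (at s)" "\<Psi> 0 = 0"
    and d: "d > 0" "\<And>s. \<bar>s\<bar> \<le> K \<Longrightarrow> p s > 0" "\<And>s. \<bar>s\<bar> \<le> K \<Longrightarrow> g s * p s - p' s / (p s)\<^sup>2 \<le> - d"
    and b: "b \<in> Basis" and l: "\<And>x. x \<in> \<Omega> \<Longrightarrow> x \<bullet> b + c > 0"
  shows "AE x in M. \<Psi> (u x) \<le> x \<bullet> b + c"
proof -
  define w where "w = weak_gradient \<Omega> u"
  obtain \<phi> B where A: "H1_approx \<Omega> u w \<phi>" "\<And>n x. \<bar>\<phi> n x\<bar> \<le> B" "K \<le> B"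
    using H1_0_bounded_approx[OF u K] unfolding w_def by metis
  have B: "AE x in M. \<bar>u x\<bar> \<le> B" using K by eventually_elim (use A(3) in auto)
  have cp: "continuous_on UNIV p" by (rule smoothD(3)[OF p(1)])
  have qc: "continuous_on {-K..K} (\<lambda>s. p' s / (p s)\<^sup>2)"
  proof (intro continuous_on_divide continuous_on_power)
    show "\<forall>s\<in>{-K..K}. (p s)\<^sup>2 \<noteq> 0"
    proof
      fix s assume "s \<in> {-K..K}"
      then have "p s > 0" using d(2)[of s] by auto
      then show "(p s)\<^sup>2 \<noteq> 0" by simp
    qed
  qed (use p(3) cp in \<open>auto intro: continuous_on_subset\<close>)
  obtain H where H0: "H > 0" "\<And>s. - K \<le> s \<Longrightarrow> s \<le> K \<Longrightarrow> \<bar>p' s / (p s)\<^sup>2\<bar> \<le> H"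
    using continuous_bounded_Icc[OF qc] by metis
  have H: "H > 0" "\<bar>p' s / (p s)\<^sup>2\<bar> \<le> H" if "\<bar>s\<bar> \<le> K" for s
    by (rule H0(1)) (rule H0(2), use that in auto)
  have "continuous_on {-K..K} \<Psi>" using smoothD(3)[OF \<Psi>(1)] by (rule continuous_on_subset) simp
  then obtain Z where Z0: "Z > 0" "\<And>s. - K \<le> s \<Longrightarrow> s \<le> K \<Longrightarrow> \<bar>\<Psi> s\<bar> \<le> Z"
    using continuous_bounded_Icc by metis
  have Z: "Z > 0" "\<bar>\<Psi> s\<bar> \<le> Z" if "\<bar>s\<bar> \<le> K" for s
    by (rule Z0(1)) (rule Z0(2), use that in auto)
  \<comment> \<open>E is the multiple of T that the pointwise bound asks of T'. Where T(z) is
    nonzero, 0 < z \<le> Z, so A0 = Z^2 E gives A0 / z^2 \<ge> E.\<close>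
  define E where "E = H + 2 * H\<^sup>2 / d"
  have E: "E > 0" using H0 d by (simp add: E_def add_pos_nonneg)
  define A0 where "A0 = Z\<^sup>2 * E"
  have A0: "A0 > 0" using Z0 E by (simp add: A0_def)
  define T where "T z = flat_exp (z / A0)" for z
  obtain T' where T: "smooth T" "\<And>z. (T has_real_derivative T' z) (at z)" "continuous_on UNIV T'" 
    "\<And>z. z \<le> 0 \<Longrightarrow> T' z = 0" "\<And>z. z > 0 \<Longrightarrow> T' z = T z * A0 / z\<^sup>2"
    unfolding T_def[abs_def] using smooth_flat_exp_scaled[OF A0] by metis
  have T0: "T z = 0" if "z \<le> 0" for z
    using that A0 flat_exp_bounds(4)[of "z / A0"] by (simp add: T_def divide_nonpos_pos)
  have Tpos: "T z > 0" if "z > 0" for z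
    using that A0 flat_exp_bounds(3)[of "z / A0"] by (simp add: T_def)
  define z where "z x = \<Psi> (u x) - (x \<bullet> b + c)" for x
  define v1 where "v1 x = p (u x) * T (z x)" for x
  define G1 where "G1 x = (p (u x) * T' (z x)) *\<^sub>R (p (u x) *\<^sub>R w x - b) + (p' (u x) * T (z x)) *\<^sub>R w x" for x
  define G2 where "G2 x = T' (z x) *\<^sub>R (p (u x) *\<^sub>R w x - b)" for x
  obtain \<phi>1 where V1: "H1_approx \<Omega> v1 G1 \<phi>1"
    unfolding v1_def[abs_def] G1_def[abs_def] z_def[abs_def]
    by (rule barrier_test_function[OF A(1,2) B p \<Psi>(1,2) cp \<Psi>(3) T(1,2,3) T0 l]) blast+
  obtain \<phi>2 where "H1_approx \<Omega> (\<lambda>x. 1 * T (z x)) (\<lambda>x. (1 * T' (z x)) *\<^sub>R (p (u x) *\<^sub>R w x - b) + (0 * T (z x)) *\<^sub>R w x) \<phi>2"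
    unfolding z_def[abs_def]
    by (rule barrier_test_function[OF A(1,2) B smooth_const DERIV_const continuous_on_const \<Psi>(1,2) cp \<Psi>(3) T(1,2,3) T0 l]) blast+
  then have V2: "H1_approx \<Omega> (\<lambda>x. T (z x)) G2 \<phi>2" by (simp add: G2_def[abs_def])
  have um: "u \<in> borel_measurable M" using H1_0_sq_integrable(1)[OF u] by (rule sq_integrable_measurable)
  have sw: "sq_integrable M w" using H1_0_sq_integrable(2)[OF u] by (simp add: w_def)
  have s1: "sq_integrable M v1" "sq_integrable M G1" and s2: "sq_integrable M G2"
    using V1 V2 by (auto simp: H1_approx_def)
  have sgu: "sq_integrable M (\<lambda>x. g (u x))"
  proof -
    obtain C where C: "\<And>s. - K \<le> s \<Longrightarrow> s \<le> K \<Longrightarrow> \<bar>g s\<bar> \<le> C"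
      using continuous_bounded_Icc[OF continuous_on_subset[OF g], of "-K" K] by auto
    show ?thesis
    proof (rule bounded_sq_integrable)
      show "(\<lambda>x. g (u x)) \<in> borel_measurable M" by (rule borel_measurable_continuous_on[OF g um])
      show "AE x in M. norm (g (u x)) \<le> C" using K by eventually_elim (use C in \<open>auto simp: abs_le_iff\<close>)
    qed
  qed
  define X where "X x = w x \<bullet> G1 x - g (u x) * v1 x - b \<bullet> G2 x" for x
  have i: "integrable M (\<lambda>x. w x \<bullet> G1 x)" "integrable M (\<lambda>x. g (u x) * v1 x)" "integrable M (\<lambda>x. b \<bullet> G2 x)"
  proof -
    show "integrable M (\<lambda>x. w x \<bullet> G1 x)" by (rule sq_integrable_inner[OF sw s1(2)])
    show "integrable M (\<lambda>x. g (u x) * v1 x)" using sq_integrable_inner[OF sgu s1(1)] by simp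
    show "integrable M (\<lambda>x. b \<bullet> G2 x)"
      using sq_integrable_integrable[OF sq_integrable_component[OF s2, of b]] by (simp add: inner_commute)
  qed
  have "(LINT x|M. w x \<bullet> G1 x) = (LINT x|M. w x \<bullet> weak_gradient \<Omega> v1 x)"
  proof (rule integral_cong_AE)
    show "AE x in M. w x \<bullet> G1 x = w x \<bullet> weak_gradient \<Omega> v1 x"
      using H1_approx_H1_0(2)[OF V1] by eventually_elim simp
    show "(\<lambda>x. w x \<bullet> weak_gradient \<Omega> v1 x) \<in> borel_measurable M"
      using sq_integrable_inner[OF sw H1_0_sq_integrable(2)[OF H1_approx_H1_0(1)[OF V1]]] by simp
  qed (use i in simp)
  also have "\<dots> = (LINT x|M. g (u x) * v1 x)" unfolding w_def by (rule sol[OF H1_approx_H1_0(1)[OF V1]])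
  finally have e1: "(LINT x|M. w x \<bullet> G1 x) = (LINT x|M. g (u x) * v1 x)" .
  \<comment> \<open>Integration by parts against the constant 1. This stands for the weak equation
    of the affine function, which is harmonic.\<close>
  have e2: "(LINT x|M. b \<bullet> G2 x) = 0"
    using H1_approx_by_parts[OF V2 smooth_const[of 1] b] by (simp add: inner_commute)
  have iX: "integrable M X" "(LINT x|M. X x) = 0"
    unfolding X_def using i e1 e2 by simp_all
  have inO: "AE x in M. x \<in> \<Omega>" by (rule AE_M_I)
  have low: "AE x in M. X x \<ge> d / 2 * T (z x)"
    using K inO
  proof eventually_elim
    case (elim x)
    note s = elim(1)
    show ?case
      unfolding X_def G1_def G2_def v1_def
    proof (rule barrier_integrand_lower_bound[OF d(2)[OF s] norm_Basis[OF b] H(2)[OF s] d(1) d(3)[OF s]])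
      show "0 \<le> T (z x)" using T0[of "z x"] Tpos[of "z x"] by (cases "z x \<le> 0") auto
      show "T (z x) * (H + 2 * H\<^sup>2 / d) \<le> T' (z x)"
      proof (cases "z x \<le> 0")
        case True
        then show ?thesis using T0 T(4) by simp
      next
        case False
        have "z x \<le> Z" using Z(2)[OF s] l[OF elim(2)] by (simp add: z_def abs_le_iff)
        then have "(z x)\<^sup>2 \<le> Z\<^sup>2" using False by (intro power_mono) auto
        then have "E * (z x)\<^sup>2 \<le> A0" using E by (simp add: A0_def mult.commute)
        then have "E \<le> A0 / (z x)\<^sup>2" using False by (simp add: field_simps)
        then have "T (z x) * E \<le> T (z x) * (A0 / (z x)\<^sup>2)" using Tpos[of "z x"] False by (intro mult_left_mono) auto
        then show ?thesis using T(5)[of "z x"] False by (simp add: E_def)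
      qed
    qed
  qed
  have T_nonneg: "T y \<ge> 0" for y using T0[of y] Tpos[of y] by (cases "y \<le> 0") auto
  have "AE x in M. X x = 0"
  proof -
    have "AE x in M. X x \<ge> 0"
      using low
    proof eventually_elim
      case (elim x)
      have "0 \<le> d / 2 * T (z x)" using d(1) T_nonneg by simp
      with elim show ?case by linarith
    qed
    then show ?thesis using integral_nonneg_eq_0_iff_AE[OF iX(1)] iX(2) by simp
  qed
  with low show ?thesis
  proof eventually_elim
    case (elim x)
    then have "d * T (z x) \<le> 0" by simp
    then have "\<not> z x > 0" using Tpos[of "z x"] d(1) mult_pos_pos[of d "T (z x)"] by linarith
    then show ?case by (simp add: z_def)
  qed
qed

end

section \<open>Uniqueness of the zero solution\<close>

lemma locally_Lipschitz_continuous: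
  assumes "locally_Lipschitz f"
  shows "continuous_on UNIV f"
proof -
  have "isCont f x" for x
  proof -
    obtain r L where r: "r > 0" "L-lipschitz_on (cball x r) f"
      using assms unfolding locally_Lipschitz_def by blast
    have "continuous_on (ball x r) f"
      by (rule continuous_on_subset[OF lipschitz_on_continuous_on[OF r(2)] ball_subset_cball])
    then show ?thesis using r(1) by (simp add: continuous_on_eq_continuous_at)
  qed
  then show ?thesis by (simp add: continuous_at_imp_continuous_on)
qed

context bounded_open
begin

text \<open>On \<Omega> the affine function x \<bullet> b + R + 1 is positive and below 2 |R| + 2. A
  barrier with \<Psi> > 2 |R| + 2 from height \<epsilon> on therefore forces u < \<epsilon>, and
  \<epsilon> is arbitrary.\<close>

lemma solution_nonpos:
  fixes g G :: "real \<Rightarrow> real"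
  assumes u: "u \<in> H1_0 \<Omega>" and K: "AE x in M. \<bar>u x\<bar> \<le> K"
    and sol: "\<And>\<phi>. \<phi> \<in> H1_0 \<Omega> \<Longrightarrow> (LINT x|M. weak_gradient \<Omega> u x \<bullet> weak_gradient \<Omega> \<phi> x) = (LINT x|M. g (u x) * \<phi> x)"
    and g: "continuous_on UNIV g"
    and G: "\<And>s. (G has_real_derivative g s) (at s)" "G 0 = 0" "\<And>s. G s \<le> 0"
    and L: "L > 0" "s0 > 0" "\<And>s. \<bar>s\<bar> \<le> s0 \<Longrightarrow> \<bar>g s\<bar> \<le> L * \<bar>s\<bar>"
  shows "AE x in M. u x \<le> 0"
proof -
  obtain b :: 'a where b: "b \<in> Basis" using nonempty_Basis by blast
  obtain R where R: "\<And>x. x \<in> \<Omega> \<Longrightarrow> norm x \<le> R" using bounded_Omega bounded_iff by blast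
  have l: "x \<bullet> b + (R + 1) > 0" "x \<bullet> b + (R + 1) < 2 * \<bar>R\<bar> + 2" if "x \<in> \<Omega>" for x
    using R[OF that] Basis_le_norm[OF b, of x] by auto
  define K' where "K' = max K 1"
  have K': "AE x in M. \<bar>u x\<bar> \<le> K'" "K' > 0" using K by (auto simp: K'_def elim: eventually_mono)
  have "AE x in M. u x < \<epsilon>" if \<epsilon>: "\<epsilon> > 0" for \<epsilon>
  proof -
    obtain p p' \<Psi> d where B: "smooth p" "\<And>s. (p has_real_derivative p' s) (at s)" "continuous_on UNIV p'"
      "smooth \<Psi>" "\<And>s. (\<Psi> has_real_derivative p s) (at s)" "\<Psi> 0 = 0" "d > 0"
      "\<And>s. \<bar>s\<bar> \<le> K' \<Longrightarrow> p s > 0" "\<And>s. \<bar>s\<bar> \<le> K' \<Longrightarrow> g s * p s - p' s / (p s)\<^sup>2 \<le> - d"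
      "\<And>s. \<epsilon> \<le> s \<Longrightarrow> s \<le> K' \<Longrightarrow> \<Psi> s > 2 * \<bar>R\<bar> + 2"
      by (rule barrier_function[OF G g L K'(2) \<epsilon>, of "2 * \<bar>R\<bar> + 2"]) (assumption, simp, blast)
    have "AE x in M. \<Psi> (u x) \<le> x \<bullet> b + (R + 1)"
      using solution_below_barrier[OF u K'(1) sol g B(1-9) b l(1)] by blast
    moreover have "AE x in M. x \<in> \<Omega>" by (rule AE_M_I)
    ultimately show ?thesis
      using K'(1)
    proof eventually_elim
      case (elim x)
      show ?case
      proof (rule ccontr)
        assume "\<not> u x < \<epsilon>"
        then have "\<Psi> (u x) > 2 * \<bar>R\<bar> + 2" using elim(3) by (intro B(10)) auto
        then show False using elim(1) l(2)[OF elim(2)] by linarith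
      qed
    qed
  qed
  then have "AE x in M. \<forall>n. u x < inverse (real (Suc n))" by (simp add: AE_all_countable)
  then show ?thesis
  proof eventually_elim
    case (elim x)
    show ?case
    proof (rule ccontr)
      assume "\<not> u x \<le> 0"
      then obtain n where "inverse (real (Suc n)) < u x" using reals_Archimedean[of "u x"] by auto
      then show False using elim[rule_format, of n] by simp
    qed
  qed
qed

text \<open>Boundedness of u makes f(u) square integrable, so the two integrals on the right can be
  merged and the linear term becomes part of a single nonlinearity.\<close>

lemma bounded_weak_solution_equation:
  assumes f: "continuous_on UNIV f" and sol: "bounded_weak_solution \<Omega> lam f u"
  obtains K where "u \<in> H1_0 \<Omega>" "AE x in M. \<bar>u x\<bar> \<le> K"
    "\<And>\<phi>. \<phi> \<in> H1_0 \<Omega> \<Longrightarrow> (LINT x|M. weak_gradient \<Omega> u x \<bullet> weak_gradient \<Omega> \<phi> x) = (LINT x|M. (lam * u x + f (u x)) * \<phi> x)"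
proof -
  have u: "u \<in> H1_0 \<Omega>" "u \<in> L_infinity \<Omega>" using sol by (auto simp: bounded_weak_solution_def)
  obtain K where K: "AE x in M. \<bar>u x\<bar> \<le> K" using u(2) by (auto simp: L_infinity_def)
  note us = H1_0_sq_integrable(1)[OF u(1)]
  note um = sq_integrable_measurable[OF us]
  obtain C where C: "\<And>s. - K \<le> s \<Longrightarrow> s \<le> K \<Longrightarrow> \<bar>f s\<bar> \<le> C"
    using continuous_bounded_Icc[OF continuous_on_subset[OF f], of "-K" K] by auto
  have fu: "sq_integrable M (\<lambda>x. f (u x))"
  proof (rule bounded_sq_integrable)
    show "(\<lambda>x. f (u x)) \<in> borel_measurable M" by (rule borel_measurable_continuous_on[OF f um])
    show "AE x in M. norm (f (u x)) \<le> C" using K by eventually_elim (use C in \<open>auto simp: abs_le_iff\<close>)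
  qed
  have "(LINT x|M. weak_gradient \<Omega> u x \<bullet> weak_gradient \<Omega> \<phi> x) = (LINT x|M. (lam * u x + f (u x)) * \<phi> x)"
    if \<phi>: "\<phi> \<in> H1_0 \<Omega>" for \<phi>
    using sol \<phi> sq_integrable_inner[OF us H1_0_sq_integrable(1)[OF \<phi>]]
      sq_integrable_inner[OF fu H1_0_sq_integrable(1)[OF \<phi>]]
    by (simp add: bounded_weak_solution_def distrib_right mult.assoc)
  then show ?thesis using that u(1) K by blast
qed

lemma zero_unique_solution:
  assumes lam: "lam \<le> 0" and f: "locally_Lipschitz f" "nonpositive_primitive f"
  shows "bounded_weak_solution \<Omega> lam f (\<lambda>x. 0)"
    and "bounded_weak_solution \<Omega> lam f u \<Longrightarrow> zero_ae_on \<Omega> u"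
proof -
  define F where "F = (\<lambda>x::real. LBINT t=ereal 0..ereal x. f t)"
  have fc: "continuous_on UNIV f" by (rule locally_Lipschitz_continuous[OF f(1)])
  have FD: "(F has_real_derivative f s) (at s)" for s
    unfolding F_def by (rule interval_integral_DERIV[OF fc])
  have F: "F 0 = 0" "F s \<le> 0" for s using f(2) by (auto simp: F_def nonpositive_primitive_def)
  \<comment> \<open>F \<le> 0 = F 0, so the primitive has a maximum at 0.\<close>
  have f0: "f 0 = 0"
    by (rule DERIV_local_max[OF FD[of 0], of 1]) (use F in auto)
  show "bounded_weak_solution \<Omega> lam f (\<lambda>x. 0)"
    unfolding bounded_weak_solution_def
  proof (intro conjI ballI IntI)
    show "(\<lambda>x. 0) \<in> L_infinity \<Omega>" by (auto simp: L_infinity_def)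
    show "(LINT x|M. weak_gradient \<Omega> (\<lambda>x. 0) x \<bullet> weak_gradient \<Omega> \<phi> x) =
        lam * (LINT x|M. 0 * \<phi> x) + (LINT x|M. f 0 * \<phi> x)" if "\<phi> \<in> H1_0 \<Omega>" for \<phi>
    proof -
      have "(LINT x|M. weak_gradient \<Omega> (\<lambda>x. 0) x \<bullet> weak_gradient \<Omega> \<phi> x) = (LINT x|M. 0)"
      proof (rule integral_cong_AE)
        show "AE x in M. weak_gradient \<Omega> (\<lambda>x. 0) x \<bullet> weak_gradient \<Omega> \<phi> x = 0"
          using H1_0_zero(2) by eventually_elim simp
        show "(\<lambda>x. weak_gradient \<Omega> (\<lambda>x. 0) x \<bullet> weak_gradient \<Omega> \<phi> x) \<in> borel_measurable M"
          using sq_integrable_inner[OF H1_0_sq_integrable(2)[OF H1_0_zero(1)] H1_0_sq_integrable(2)[OF that]] by simp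
      qed simp
      then show ?thesis by (simp add: f0)
    qed
  qed (rule H1_0_zero)
  assume "bounded_weak_solution \<Omega> lam f u"
  then obtain K where u: "u \<in> H1_0 \<Omega>" and K: "AE x in M. \<bar>u x\<bar> \<le> K"
    and sol: "\<And>\<phi>. \<phi> \<in> H1_0 \<Omega> \<Longrightarrow> (LINT x|M. weak_gradient \<Omega> u x \<bullet> weak_gradient \<Omega> \<phi> x) = (LINT x|M. (lam * u x + f (u x)) * \<phi> x)"
    using bounded_weak_solution_equation[OF fc] by blast
  define g where "g s = lam * s + f s" for s
  \<comment> \<open>This is where \<open>lam \<le> 0\<close> enters: the linear term adds a
    nonpositive quadratic to the primitive.\<close>
  define G where "G s = lam * s\<^sup>2 / 2 + F s" for s
  have gc: "continuous_on UNIV g" unfolding g_def by (intro continuous_intros fc)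
  have GD: "(G has_real_derivative g s) (at s)" for s
    unfolding G_def g_def by (auto intro!: derivative_eq_intros FD)
  have G: "G 0 = 0" "G s \<le> 0" for s
    using F(2)[of s] lam mult_nonpos_nonneg[of lam "s\<^sup>2"] by (auto simp: G_def F(1))
  obtain r L0 where r: "r > 0" "L0-lipschitz_on (cball 0 r) f"
    using f(1) unfolding locally_Lipschitz_def by blast
  define L where "L = \<bar>lam\<bar> + L0 + 1"
  have L0: "L0 \<ge> 0" using r(2) lipschitz_on_nonneg by blast
  have L: "L > 0" "\<bar>g s\<bar> \<le> L * \<bar>s\<bar>" if "\<bar>s\<bar> \<le> r" for s
  proof -
    show "L > 0" using L0 by (simp add: L_def)
    have "dist (f s) (f 0) \<le> L0 * dist s 0"
      by (rule lipschitz_onD[OF r(2)]) (use that r(1) in auto)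
    then have "\<bar>f s\<bar> \<le> L0 * \<bar>s\<bar>" by (simp add: f0 dist_real_def)
    moreover have "\<bar>g s\<bar> \<le> \<bar>lam\<bar> * \<bar>s\<bar> + \<bar>f s\<bar>" unfolding g_def abs_mult[symmetric] by (rule abs_triangle_ineq)
    ultimately show "\<bar>g s\<bar> \<le> L * \<bar>s\<bar>" using abs_ge_zero[of s] unfolding L_def distrib_right mult_1 by linarith
  qed
  have Lpos: "L > 0" using L0 by (simp add: L_def)
  have up: "AE x in M. u x \<le> 0"
    by (rule solution_nonpos[OF u K _ gc GD G Lpos r(1) L(2)]) (auto simp: sol g_def)
  \<comment> \<open>- u solves the problem for the reflected nonlinearity s \<mapsto> - g(- s),
    whose primitive G(- s) is again nonpositive.\<close>
  define v where "v x = 0 + (-1) * u x" for x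
  have v: "v \<in> H1_0 \<Omega>" and vw: "AE x in M. weak_gradient \<Omega> v x = weak_gradient \<Omega> (\<lambda>x. 0) x + (-1) *\<^sub>R weak_gradient \<Omega> u x"
    using H1_0_lincomb[OF H1_0_zero(1) u, of "-1"] unfolding v_def[abs_def] by auto
  have "AE x in M. v x \<le> 0"
  proof (rule solution_nonpos[of v K "\<lambda>s. - g (- s)" "\<lambda>s. G (- s)" L r])
    show "AE x in M. \<bar>v x\<bar> \<le> K" using K by (simp add: v_def)
    show "(LINT x|M. weak_gradient \<Omega> v x \<bullet> weak_gradient \<Omega> \<phi> x) = (LINT x|M. - g (- v x) * \<phi> x)"
      if \<phi>: "\<phi> \<in> H1_0 \<Omega>" for \<phi>
    proof -
      note s = H1_0_sq_integrable(2)
      have "(LINT x|M. weak_gradient \<Omega> v x \<bullet> weak_gradient \<Omega> \<phi> x) = (LINT x|M. - (weak_gradient \<Omega> u x \<bullet> weak_gradient \<Omega> \<phi> x))"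
      proof (rule integral_cong_AE)
        show "AE x in M. weak_gradient \<Omega> v x \<bullet> weak_gradient \<Omega> \<phi> x = - (weak_gradient \<Omega> u x \<bullet> weak_gradient \<Omega> \<phi> x)"
          using vw H1_0_zero(2) by eventually_elim simp
      qed (use sq_integrable_inner[OF s[OF v] s[OF \<phi>]] sq_integrable_inner[OF s[OF u] s[OF \<phi>]] in auto)
      also have "\<dots> = - (LINT x|M. g (u x) * \<phi> x)" by (simp add: sol[OF \<phi>] g_def)
      finally show ?thesis by (simp add: v_def)
    qed
    show "continuous_on UNIV (\<lambda>s. - g (- s))"
      by (intro continuous_intros continuous_on_compose2[OF gc]) auto
    show "((\<lambda>s. G (- s)) has_real_derivative - g (- s)) (at s)" for s
      using DERIV_chain2[OF GD[of "- s"] DERIV_minus[OF DERIV_ident]] by simp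
    show "\<bar>- g (- s)\<bar> \<le> L * \<bar>s\<bar>" if "\<bar>s\<bar> \<le> r" for s using L(2)[of "- s"] that by simp
  qed (use v G Lpos r(1) in auto)
  with up show "zero_ae_on \<Omega> u"
    unfolding zero_ae_on_def by eventually_elim (simp add: v_def)
qed

end

section \<open>Rellich's theorem and the first eigenvalue\<close>

text \<open>The function is understood to vanish outside \<open>\<Omega>\<close>: the denominator is the volume of the full ball.\<close>

definition ball_average :: "'a::euclidean_space set \<Rightarrow> real \<Rightarrow> ('a \<Rightarrow> real) \<Rightarrow> 'a \<Rightarrow> real" where
  "ball_average \<Omega> r f x =
     (LINT y|lebesgue_on \<Omega>. indicator (ball x r) y * f y) / measure lborel (ball (0::'a) r)"

section \<open>Translation estimate for test functions\<close>

lemma integrable_lborel_test: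
  assumes "\<phi> \<in> test_functions \<Omega>"
  shows "integrable lborel \<phi>"
proof -
  obtain C where "\<And>x. \<bar>\<phi> x\<bar> \<le> C" using test_functions_bounded[OF assms] by metis
  moreover have "bounded {x. \<phi> x \<noteq> 0}"
    using test_functionsD(2)[OF assms] compact_imp_bounded bounded_subset closure_subset by metis
  ultimately show ?thesis
    using test_functionsD(5)[OF assms, of UNIV]
    by (intro integrable_bounded_support[of \<phi> "{x. \<phi> x \<noteq> 0}" C]) (auto intro: borel_measurable_continuous_onI)
qed

text \<open>The translation by h is cut into n + 1 equal steps. Cauchy-Schwarz for the telescoping
  sum and translation invariance bound the left side by the squared L^2 norm of the difference
  quotient with step h / (n + 1), which tends to that of the derivative along h.\<close>

lemma test_translation_bound:
  assumes \<phi>: "\<phi> \<in> test_functions \<Omega>"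
  shows "integrable lborel (\<lambda>x. (\<phi> (x + h) - \<phi> x)\<^sup>2)"
    and "(LINT x|lborel. (\<phi> (x + h) - \<phi> x)\<^sup>2) \<le> (norm h)\<^sup>2 * (LINT x|lborel. (norm (grad \<phi> x))\<^sup>2)"
proof -
  have c: "continuous_on UNIV \<phi>" by (rule test_functionsD(5)[OF \<phi>])
  have m[measurable]: "\<phi> \<in> borel_measurable borel" by (rule borel_measurable_continuous_onI[OF c])
  have gc: "continuous_on UNIV (grad \<phi>)" by (rule continuous_on_grad[OF test_functionsD(1)[OF \<phi>]])
  have gm[measurable]: "grad \<phi> \<in> borel_measurable borel" by (rule borel_measurable_continuous_onI[OF gc])
  obtain C where C: "C > 0" "\<And>x. norm (grad \<phi> x) \<le> C" using test_functions_grad_bounded[OF \<phi>] by blast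
  have "bounded {x. \<phi> x \<noteq> 0}"
    using test_functionsD(2)[OF \<phi>] compact_imp_bounded bounded_subset closure_subset by metis
  then obtain R where R: "\<And>x. \<phi> x \<noteq> 0 \<Longrightarrow> norm x \<le> R" by (auto simp: bounded_iff)
  have i: "integrable lborel (\<lambda>x. (\<phi> (x + k) - \<phi> x)\<^sup>2)" for k
  proof (rule integrable_bounded_support[of _ "cball 0 (R + norm k)" "(C * norm k)\<^sup>2"])
    show "(\<phi> (x + k) - \<phi> x)\<^sup>2 = 0" if "x \<notin> cball 0 (R + norm k)" for x
    proof -
      have x: "norm x > R + norm k" using that by simp
      have "norm x \<le> norm (x + k) + norm k" by (metis add_diff_cancel norm_triangle_ineq4)
      then have "norm (x + k) > R" "norm x > R" using x norm_ge_zero[of k] by linarith+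
      then have "\<phi> x = 0" "\<phi> (x + k) = 0" using R[of x] R[of "x + k"] by force+
      then show ?thesis by simp
    qed
    show "\<bar>(\<phi> (x + k) - \<phi> x)\<^sup>2\<bar> \<le> (C * norm k)\<^sup>2" for x
      using power_mono[OF smooth_lipschitz[OF test_functionsD(1)[OF \<phi>] C(2), of "x + k" x] abs_ge_zero, of 2] by simp
  qed (auto simp: m)
  then show "integrable lborel (\<lambda>x. (\<phi> (x + h) - \<phi> x)\<^sup>2)" .
  define t where "t n = inverse (real (Suc n))" for n
  have t: "t n > 0" "t n \<le> 1" "t \<longlonglongrightarrow> 0" for n
    unfolding t_def using LIMSEQ_inverse_real_of_nat by (simp_all add: inverse_le_1_iff)
  define d where "d n x = \<phi> (x + t n *\<^sub>R h) - \<phi> x" for n x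
  have step: "(LINT x|lborel. (\<phi> (x + h) - \<phi> x)\<^sup>2) \<le> (LINT x|lborel. (d n x / t n)\<^sup>2)" for n
  proof -
    let ?m = "Suc n"
    have tm: "real ?m * t n = 1" by (simp add: t_def)
    have tele: "\<phi> (x + h) - \<phi> x = (\<Sum>j<?m. d n (x + (real j * t n) *\<^sub>R h))" for x
    proof -
      have "(\<Sum>j<?m. d n (x + (real j * t n) *\<^sub>R h)) =
          (\<Sum>j<?m. \<phi> (x + (real (Suc j) * t n) *\<^sub>R h) - \<phi> (x + (real j * t n) *\<^sub>R h))"
        by (rule sum.cong) (auto simp: d_def algebra_simps)
      also have "\<dots> = \<phi> (x + (real ?m * t n) *\<^sub>R h) - \<phi> (x + (real 0 * t n) *\<^sub>R h)"
        by (rule sum_lessThan_telescope)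
      finally show ?thesis unfolding tm by simp
    qed
    have ij: "integrable lborel (\<lambda>x. (d n (x + (real j * t n) *\<^sub>R h))\<^sup>2)" for j
      using integrable_lborel_translate[OF i[of "t n *\<^sub>R h"]] by (simp add: d_def)
    have eqj: "(LINT x|lborel. (d n (x + (real j * t n) *\<^sub>R h))\<^sup>2) = (LINT x|lborel. (d n x)\<^sup>2)" for j
      by (rule integral_lborel_translate) (simp add: d_def)
    have "(LINT x|lborel. (\<phi> (x + h) - \<phi> x)\<^sup>2) \<le> (LINT x|lborel. (\<Sum>j<?m. (d n (x + (real j * t n) *\<^sub>R h))\<^sup>2) * real ?m)"
    proof (rule integral_mono)
      show "(\<phi> (x + h) - \<phi> x)\<^sup>2 \<le> (\<Sum>j<?m. (d n (x + (real j * t n) *\<^sub>R h))\<^sup>2) * real ?m" for x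
        unfolding tele using sum_squared_le_sum_of_squares[of "\<lambda>j. d n (x + (real j * t n) *\<^sub>R h)" "{..<?m}"] by simp
    qed (use i ij in \<open>auto intro!: Bochner_Integration.integrable_sum simp del: sum.lessThan_Suc\<close>)
    also have "\<dots> = (\<Sum>j<?m. (LINT x|lborel. (d n x)\<^sup>2)) * real ?m"
      using ij by (simp add: eqj Bochner_Integration.integral_sum del: sum.lessThan_Suc)
    \<comment> \<open>The n + 1 equal terms and the factor n + 1 from Cauchy-Schwarz together make 1
      / (t n)^2.\<close>
    also have "\<dots> = (LINT x|lborel. (d n x)\<^sup>2) / (t n)\<^sup>2"
      by (simp add: t_def power2_eq_square field_simps)
    finally show ?thesis by (simp add: power_divide)
  qed
  have lim: "(\<lambda>n. LINT x|lborel. (d n x / t n)\<^sup>2) \<longlonglongrightarrow> (LINT x|lborel. (grad \<phi> x \<bullet> h)\<^sup>2)"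
  proof (rule integral_dominated_convergence[where w = "\<lambda>x. (C * norm h)\<^sup>2 * indicator (cball 0 (R + norm h)) x :: real"])
    show "integrable lborel (\<lambda>x::'a. (C * norm h)\<^sup>2 * indicator (cball 0 (R + norm h)) x :: real)"
      using emeasure_bounded_finite[of "cball 0 (R + norm h) :: 'a set"]
      by (intro integrable_mult_right integrable_real_indicator) auto
    show "AE x in lborel. (\<lambda>n. (d n x / t n)\<^sup>2) \<longlonglongrightarrow> (grad \<phi> x \<bullet> h)\<^sup>2"
    proof (rule AE_I2)
      fix x
      have "(\<lambda>n. d n x / t n) \<longlonglongrightarrow> grad \<phi> x \<bullet> h"
        unfolding d_def using t(1)
        by (intro difference_quotient_tendsto[OF test_functionsD(1)[OF \<phi>] t(3)]) (simp add: less_imp_neq[symmetric])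
      then show "(\<lambda>n. (d n x / t n)\<^sup>2) \<longlonglongrightarrow> (grad \<phi> x \<bullet> h)\<^sup>2" by (rule tendsto_power)
    qed
    show "AE x in lborel. norm ((d n x / t n)\<^sup>2) \<le> (C * norm h)\<^sup>2 * indicator (cball 0 (R + norm h)) x" for n
    proof (rule AE_I2)
      fix x
      show "norm ((d n x / t n)\<^sup>2) \<le> (C * norm h)\<^sup>2 * indicator (cball 0 (R + norm h)) x"
      proof (cases "norm x \<le> R + norm h")
        case True
        have "\<bar>d n x\<bar> \<le> C * norm (t n *\<^sub>R h)"
          using smooth_lipschitz[OF test_functionsD(1)[OF \<phi>] C(2), of "x + t n *\<^sub>R h" x] by (simp add: d_def)
        then have "\<bar>d n x / t n\<bar> \<le> C * norm h" using t(1)[of n] by (simp add: field_simps)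
        then have "(d n x / t n)\<^sup>2 \<le> (C * norm h)\<^sup>2"
          using power_mono[OF _ abs_ge_zero, of "d n x / t n" "C * norm h" 2] by (simp only: power2_abs)
        with True show ?thesis by simp
      next
        case False
        have "norm x \<le> norm (x + t n *\<^sub>R h) + norm (t n *\<^sub>R h)" by (metis add_diff_cancel norm_triangle_ineq4)
        moreover have "norm (t n *\<^sub>R h) \<le> norm h" using t(1,2)[of n] by (simp add: mult_left_le_one_le)
        ultimately have "norm (x + t n *\<^sub>R h) > R" "norm x > R" using False norm_ge_zero[of h] by linarith+
        then have "\<phi> (x + t n *\<^sub>R h) = 0" "\<phi> x = 0" using R[of x] R[of "x + t n *\<^sub>R h"] by force+
        then show ?thesis by (simp add: d_def)
      qed
    qed
  qed (simp_all add: d_def)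
  have "(LINT x|lborel. (\<phi> (x + h) - \<phi> x)\<^sup>2) \<le> (LINT x|lborel. (grad \<phi> x \<bullet> h)\<^sup>2)"
    by (rule LIMSEQ_le_const[OF lim]) (use step in blast)
  also have "\<dots> \<le> (LINT x|lborel. (norm h)\<^sup>2 * (norm (grad \<phi> x))\<^sup>2)"
  proof (rule integral_mono')
    have "integrable lborel (\<lambda>x. (norm (grad \<phi> x))\<^sup>2)"
    proof (rule integrable_bounded_support[of _ "{x. \<phi> x \<noteq> 0} \<union> cball 0 R" "C\<^sup>2"])
      show "bounded ({x. \<phi> x \<noteq> 0} \<union> cball 0 R)" using \<open>bounded {x. \<phi> x \<noteq> 0}\<close> by simp
      show "(norm (grad \<phi> x))\<^sup>2 = 0" if "x \<notin> {x. \<phi> x \<noteq> 0} \<union> cball 0 R" for x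
      proof -
        have "x \<in> - cball 0 R" using that by simp
        moreover have "((\<lambda>x. 0) has_derivative (\<lambda>v. 0 \<bullet> v)) (at x)" by simp
        moreover have "0 = \<phi> y" if "y \<in> - cball 0 R" for y using R[of y] that by force
        ultimately have "(\<phi> has_derivative (\<lambda>v. 0 \<bullet> v)) (at x)"
          using has_derivative_transform_within_open[of "\<lambda>x. 0" "\<lambda>v. 0 \<bullet> v" x UNIV "- cball 0 R" \<phi>] by auto
        then show ?thesis using grad_unique by fastforce
      qed
      show "\<bar>(norm (grad \<phi> x))\<^sup>2\<bar> \<le> C\<^sup>2" for x using C(2) by (simp add: power_mono)
    qed simp
    then show "integrable lborel (\<lambda>x. (norm h)\<^sup>2 * (norm (grad \<phi> x))\<^sup>2)" by simp
    show "(grad \<phi> x \<bullet> h)\<^sup>2 \<le> (norm h)\<^sup>2 * (norm (grad \<phi> x))\<^sup>2" for x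
      using power_mono[OF Cauchy_Schwarz_ineq2[of "grad \<phi> x" h] abs_ge_zero, of 2] by (simp add: power_mult_distrib mult.commute)
  qed simp
  finally show "(LINT x|lborel. (\<phi> (x + h) - \<phi> x)\<^sup>2) \<le> (norm h)\<^sup>2 * (LINT x|lborel. (norm (grad \<phi> x))\<^sup>2)" by simp
qed

context bounded_open
begin

section \<open>Averages over balls\<close>

lemma ball_volume_pos: "r > 0 \<Longrightarrow> measure lborel (ball (0::'a) r) > 0"
  by (rule content_ball_pos)

lemma sq_int_test_eq_lborel:
  assumes \<phi>: "\<phi> \<in> test_functions \<Omega>"
  shows "sq_int M \<phi> = (LINT x|lborel. (\<phi> x)\<^sup>2)" "sq_int M (grad \<phi>) = (LINT x|lborel. (norm (grad \<phi> x))\<^sup>2)"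
proof -
  show "sq_int M \<phi> = (LINT x|lborel. (\<phi> x)\<^sup>2)"
    unfolding sq_int_def real_norm_def power2_abs
    by (rule integral_test_eq_lborel) (use test_functionsD[OF \<phi>] in \<open>auto intro!: continuous_intros\<close>)
  show "sq_int M (grad \<phi>) = (LINT x|lborel. (norm (grad \<phi> x))\<^sup>2)"
    unfolding sq_int_def
    by (rule integral_test_eq_lborel)
       (use continuous_on_grad[OF test_functionsD(1)[OF \<phi>]] test_functions_grad_zero[OF \<phi>] in \<open>auto intro!: continuous_intros\<close>)
qed

lemma ball_indicator_measurable: "(\<lambda>y. indicator (ball x r) y :: real) \<in> borel_measurable M"
  by (rule measurable_restrict_space1[of _ lebesgue]) (intro borel_measurable_indicator, auto)

lemma ball_indicator_sq_integrable: "sq_integrable M (\<lambda>y. indicator (ball x r) y :: real)"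
  by (rule bounded_sq_integrable[OF ball_indicator_measurable, of _ _ 1]) (auto simp: indicator_def)

lemma ball_indicator_sq_int: "sq_int M (\<lambda>y. indicator (ball x r) y :: real) \<le> measure lborel (ball (0::'a) r)"
proof -
  have "sq_int M (\<lambda>y. indicator (ball x r) y :: real) = (LINT y|lebesgue. indicator \<Omega> y * (indicator (ball x r) y)\<^sup>2)"
    by (simp add: sq_int_def integral_restrict_space)
  also have "\<dots> \<le> (LINT y|lebesgue. indicator (ball x r) y)"
  proof (rule integral_mono')
    show "integrable lebesgue (\<lambda>y. indicator (ball x r) y :: real)"
      using fmeasurableD2[OF lmeasurable_ball[of x r]] by (intro integrable_real_indicator) (auto simp: less_top)
  qed (auto simp: indicator_def)
  also have "\<dots> = measure lborel (ball x r)" by (simp add: measure_completion)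
  also have "\<dots> = measure lborel (ball (0::'a) r)"
    using measure_translation[of x "ball 0 r"] by (simp add: ball_translation[symmetric] measure_completion)
  finally show ?thesis .
qed

text \<open>Cauchy-Schwarz against the indicator of the ball, whose part in \<Omega> has at most the
  full volume. The bound is uniform in x.\<close>

lemma ball_average_bound:
  assumes "r > 0" "sq_integrable M f"
  shows "\<bar>ball_average \<Omega> r f x\<bar> \<le> sqrt (sq_int M f) / sqrt (measure lborel (ball (0::'a) r))"
proof -
  let ?V = "measure lborel (ball (0::'a) r)"
  have V: "?V > 0" by (rule ball_volume_pos[OF assms(1)])
  have "\<bar>LINT y|M. indicator (ball x r) y \<bullet> f y\<bar> \<le> sqrt (sq_int M (\<lambda>y. indicator (ball x r) y :: real)) * sqrt (sq_int M f)"
    by (rule sq_int_Cauchy_Schwarz[OF ball_indicator_sq_integrable assms(2)])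
  also have "\<dots> \<le> sqrt ?V * sqrt (sq_int M f)"
    by (intro mult_right_mono real_sqrt_le_mono ball_indicator_sq_int) auto
  finally have "\<bar>LINT y|M. indicator (ball x r) y * f y\<bar> \<le> sqrt ?V * sqrt (sq_int M f)" by simp
  then have "\<bar>ball_average \<Omega> r f x\<bar> \<le> sqrt ?V * sqrt (sq_int M f) / ?V"
    unfolding ball_average_def abs_divide using V by (simp add: divide_right_mono)
  also have "\<dots> = sqrt (sq_int M f) / sqrt ?V" using V by (simp add: field_simps)
  finally show ?thesis .
qed

lemma ball_average_diff:
  assumes "sq_integrable M f" "sq_integrable M g"
  shows "ball_average \<Omega> r (\<lambda>y. f y - g y) x = ball_average \<Omega> r f x - ball_average \<Omega> r g x"
proof -
  have "integrable M (\<lambda>y. indicator (ball x r) y * f y)" "integrable M (\<lambda>y. indicator (ball x r) y * g y)"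
    using sq_integrable_inner[OF ball_indicator_sq_integrable assms(1)]
      sq_integrable_inner[OF ball_indicator_sq_integrable assms(2)] by auto
  then show ?thesis by (simp add: ball_average_def right_diff_distrib diff_divide_distrib)
qed

text \<open>Test functions vanish outside \<Omega>, so the average is a convolution on the whole
  space, written so that x enters only through translation.\<close>

lemma ball_average_test:
  assumes \<phi>: "\<phi> \<in> test_functions \<Omega>"
  shows "ball_average \<Omega> r \<phi> x = (LINT z|lborel. indicator (ball 0 r) z * \<phi> (x + z)) / measure lborel (ball (0::'a) r)"
proof -
  have c: "\<phi> \<in> borel_measurable borel" by (rule borel_measurable_continuous_onI[OF test_functionsD(5)[OF \<phi>]])
  have "(LINT y|M. indicator (ball x r) y * \<phi> y) = (LINT y|lborel. indicator (ball x r) y * \<phi> y)"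
    by (rule integral_lebesgue_on_eq_lborel)
       (use test_functionsD(4)[OF \<phi>] in \<open>auto intro!: borel_measurable_times borel_measurable_indicator c\<close>)
  also have "\<dots> = (LINT z|lborel. indicator (ball x r) (z + x) * \<phi> (z + x))"
    by (rule integral_lborel_translate[symmetric]) (auto intro!: borel_measurable_times borel_measurable_indicator c)
  also have "\<dots> = (LINT z|lborel. indicator (ball 0 r) z * \<phi> (x + z))"
    by (rule Bochner_Integration.integral_cong) (auto simp: indicator_def dist_norm add.commute)
  finally show ?thesis by (simp add: ball_average_def)
qed

text \<open>The difference is an average over z of \<phi>(x + z) - \<phi>(y + z), which
  Cauchy-Schwarz and the translation estimate bound. The constant depends only on r and the gradient
  norm, which is the equicontinuity for Arzela-Ascoli.\<close>

lemma ball_average_lipschitz: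
  assumes r: "r > 0" and \<phi>: "\<phi> \<in> test_functions \<Omega>"
  shows "\<bar>ball_average \<Omega> r \<phi> x - ball_average \<Omega> r \<phi> y\<bar> \<le>
     norm (x - y) * sqrt (sq_int M (grad \<phi>)) / sqrt (measure lborel (ball (0::'a) r))"
proof -
  let ?V = "measure lborel (ball (0::'a) r)"
  let ?I = "\<lambda>z. indicator (ball (0::'a) r) z :: real"
  have V: "?V > 0" by (rule ball_volume_pos[OF r])
  have cm[measurable]: "\<phi> \<in> borel_measurable borel" by (rule borel_measurable_continuous_onI[OF test_functionsD(5)[OF \<phi>]])
  have iI: "integrable lborel ?I"
    using emeasure_bounded_finite[of "ball (0::'a) r"] by (intro integrable_real_indicator) auto
  have i: "integrable lborel (\<lambda>z. ?I z * \<phi> (w + z))" for w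
    using integrable_mult_indicator[OF _ integrable_lborel_translate[OF integrable_lborel_test[OF \<phi>], of w], of "ball 0 r"]
    by (simp add: add.commute)
  have I2: "(?I z)\<^sup>2 = ?I z" for z by (simp add: indicator_def)
  have sI: "sq_integrable lborel ?I" "sq_int lborel ?I = ?V"
    using iI by (auto simp: sq_integrable_def sq_int_def I2)
  define d where "d z = \<phi> (x + z) - \<phi> (y + z)" for z
  have eq: "(\<lambda>z. (d z)\<^sup>2) = (\<lambda>z. (\<lambda>s. (\<phi> (s + (x - y)) - \<phi> s)\<^sup>2) (z + y))"
    by (simp add: d_def fun_eq_iff algebra_simps)
  have d2: "integrable lborel (\<lambda>z. (d z)\<^sup>2)"
    unfolding eq by (rule integrable_lborel_translate[OF test_translation_bound(1)[OF \<phi>]])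
  have d3: "(LINT z|lborel. (d z)\<^sup>2) \<le> (norm (x - y))\<^sup>2 * sq_int M (grad \<phi>)"
  proof -
    have "(LINT z|lborel. (d z)\<^sup>2) = (LINT s|lborel. (\<phi> (s + (x - y)) - \<phi> s)\<^sup>2)"
      unfolding eq by (rule integral_lborel_translate) measurable
    then show ?thesis using test_translation_bound(2)[OF \<phi>, of "x - y"] by (simp add: sq_int_test_eq_lborel(2)[OF \<phi>])
  qed
  have sd: "sq_integrable lborel d" using d2 by (simp add: sq_integrable_def d_def[abs_def])
  have "\<bar>LINT z|lborel. ?I z \<bullet> d z\<bar> \<le> sqrt (sq_int lborel ?I) * sqrt (sq_int lborel d)"
    by (rule sq_int_Cauchy_Schwarz[OF sI(1) sd])
  also have "\<dots> \<le> sqrt ?V * (norm (x - y) * sqrt (sq_int M (grad \<phi>)))"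
  proof -
    have "sqrt (sq_int lborel d) \<le> sqrt ((norm (x - y))\<^sup>2 * sq_int M (grad \<phi>))"
      using d3 by (intro real_sqrt_le_mono) (simp add: sq_int_def)
    then show ?thesis using sI(2) by (simp add: real_sqrt_mult mult_left_mono)
  qed
  finally have le: "\<bar>LINT z|lborel. ?I z * d z\<bar> \<le> sqrt ?V * (norm (x - y) * sqrt (sq_int M (grad \<phi>)))" by simp
  have "ball_average \<Omega> r \<phi> x - ball_average \<Omega> r \<phi> y = (LINT z|lborel. ?I z * d z) / ?V"
    using i by (simp add: ball_average_test[OF \<phi>] d_def right_diff_distrib diff_divide_distrib)
  then have "\<bar>ball_average \<Omega> r \<phi> x - ball_average \<Omega> r \<phi> y\<bar> \<le> sqrt ?V * (norm (x - y) * sqrt (sq_int M (grad \<phi>))) / ?V"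
    using le V by (simp add: divide_right_mono)
  also have "\<dots> = norm (x - y) * sqrt (sq_int M (grad \<phi>)) / sqrt ?V" using V by (simp add: field_simps)
  finally show ?thesis .
qed

lemma ball_average_continuous:
  assumes "r > 0" "\<phi> \<in> test_functions \<Omega>"
  shows "continuous_on UNIV (ball_average \<Omega> r \<phi>)"
proof -
  have "(sqrt (sq_int M (grad \<phi>)) / sqrt (measure lborel (ball (0::'a) r)))-lipschitz_on UNIV (ball_average \<Omega> r \<phi>)"
    using ball_average_lipschitz[OF assms] ball_volume_pos[OF assms(1)]
    by (intro lipschitz_onI) (auto simp: dist_norm mult.commute)
  then show ?thesis by (rule lipschitz_on_continuous_on)
qed

text \<open>Cauchy-Schwarz bounds the squared error at x by the mean of (\<phi>(x + z) - \<phi> x)^2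
  over |z| < r. After Fubini, each z contributes at most |z|^2 times the squared gradient
  norm.\<close>

lemma ball_average_close:
  assumes r: "r > 0" and \<phi>: "\<phi> \<in> test_functions \<Omega>"
  shows "sq_int M (\<lambda>x. \<phi> x - ball_average \<Omega> r \<phi> x) \<le> r\<^sup>2 * sq_int M (grad \<phi>)"
proof -
  let ?V = "measure lborel (ball (0::'a) r)"
  let ?I = "\<lambda>z. indicator (ball (0::'a) r) z :: real"
  define D where "D = sq_int M (grad \<phi>)"
  have D: "D \<ge> 0" by (simp add: D_def)
  have V: "?V > 0" by (rule ball_volume_pos[OF r])
  have cm[measurable]: "\<phi> \<in> borel_measurable borel" by (rule borel_measurable_continuous_onI[OF test_functionsD(5)[OF \<phi>]])
  have am[measurable]: "ball_average \<Omega> r \<phi> \<in> borel_measurable borel"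
    by (rule borel_measurable_continuous_onI[OF ball_average_continuous[OF r \<phi>]])
  have iI: "integrable lborel ?I"
    using emeasure_bounded_finite[of "ball (0::'a) r"] by (intro integrable_real_indicator) auto
  have i: "integrable lborel (\<lambda>z. ?I z * \<phi> (x + z))" for x
    using integrable_mult_indicator[OF _ integrable_lborel_translate[OF integrable_lborel_test[OF \<phi>], of x], of "ball 0 r"]
    by (simp add: add.commute)
  have I2: "(?I z)\<^sup>2 = ?I z" for z by (simp add: indicator_def)
  have sI: "sq_integrable lborel ?I" "sq_int lborel ?I = ?V"
    using iI by (auto simp: sq_integrable_def sq_int_def I2)
  obtain C where C: "\<And>x. \<bar>\<phi> x\<bar> \<le> C" using test_functions_bounded[OF \<phi>] by metis
  have bm[measurable]: "ball (0::'a) r \<in> sets borel" by simp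
  define f where "f x z = ?I z * (\<phi> (x + z) - \<phi> x)" for x z
  have f2: "(f x z)\<^sup>2 = ?I z * (\<phi> (x + z) - \<phi> x)\<^sup>2" for x z by (simp add: f_def power_mult_distrib I2)
  have if2: "integrable lborel (\<lambda>z. (f x z)\<^sup>2)" for x
  proof (rule integrable_bounded_support[of _ "ball 0 r" "(2 * C)\<^sup>2"])
    show "\<bar>(f x z)\<^sup>2\<bar> \<le> (2 * C)\<^sup>2" for z
    proof -
      have "\<bar>f x z\<bar> \<le> 2 * C" using C[of x] C[of "x + z"] by (auto simp: f_def indicator_def)
      from power_mono[OF this abs_ge_zero, of 2] show ?thesis by simp
    qed
    show "(\<lambda>z. (f x z)\<^sup>2) \<in> borel_measurable borel"
    proof -
      have a: "continuous_on UNIV (\<lambda>z. (\<phi> (x + z) - \<phi> x)\<^sup>2)"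
        by (intro continuous_intros continuous_on_compose2[OF test_functionsD(5)[OF \<phi>, of UNIV]]) auto
      have b: "?I \<in> borel_measurable borel" by (rule borel_measurable_indicator) simp
      show ?thesis unfolding f2 by (rule borel_measurable_times[OF b borel_measurable_continuous_onI[OF a]])
    qed
  qed (auto simp: f_def)
  have pt: "(\<phi> x - ball_average \<Omega> r \<phi> x)\<^sup>2 \<le> (LINT z|lborel. (f x z)\<^sup>2) / ?V" for x
  proof -
    have "f x \<in> borel_measurable borel" unfolding f_def by measurable
    then have sf: "sq_integrable lborel (f x)" using if2[of x] by (simp add: sq_integrable_def)
    have fI: "?I z * f x z = ?I z * \<phi> (x + z) - ?I z * \<phi> x" for z by (simp add: f_def indicator_def)
    have "(LINT z|lborel. ?I z * f x z) = (LINT z|lborel. ?I z * \<phi> (x + z)) - ?V * \<phi> x"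
      unfolding fI using i[of x] iI by simp
    then have eq: "ball_average \<Omega> r \<phi> x - \<phi> x = (LINT z|lborel. ?I z * f x z) / ?V"
      using V by (simp add: ball_average_test[OF \<phi>] field_simps)
    have "\<bar>LINT z|lborel. ?I z \<bullet> f x z\<bar> \<le> sqrt ?V * sqrt (LINT z|lborel. (f x z)\<^sup>2)"
      using sq_int_Cauchy_Schwarz[OF sI(1) sf] unfolding sI(2) by (simp add: sq_int_def)
    from power_mono[OF this abs_ge_zero, of 2]
    have "(LINT z|lborel. ?I z * f x z)\<^sup>2 \<le> ?V * (LINT z|lborel. (f x z)\<^sup>2)"
      using V by (simp add: power_mult_distrib)
    then have le: "(LINT z|lborel. ?I z * f x z)\<^sup>2 / ?V\<^sup>2 \<le> ?V * (LINT z|lborel. (f x z)\<^sup>2) / ?V\<^sup>2"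
      by (rule divide_right_mono) simp
    have "(\<phi> x - ball_average \<Omega> r \<phi> x)\<^sup>2 = (ball_average \<Omega> r \<phi> x - \<phi> x)\<^sup>2" by (rule power2_commute)
    also have "\<dots> = (LINT z|lborel. ?I z * f x z)\<^sup>2 / ?V\<^sup>2" unfolding eq by (rule power_divide)
    also note le
    also have "?V * (LINT z|lborel. (f x z)\<^sup>2) / ?V\<^sup>2 = (LINT z|lborel. (f x z)\<^sup>2) / ?V"
      using V by (simp add: power2_eq_square)
    finally show ?thesis .
  qed
  have "(\<integral>\<^sup>+x. ennreal ((\<phi> x - ball_average \<Omega> r \<phi> x)\<^sup>2) \<partial>lborel) \<le>
      (\<integral>\<^sup>+x. ennreal (1 / ?V) * (\<integral>\<^sup>+z. ennreal ((f x z)\<^sup>2) \<partial>lborel) \<partial>lborel)"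
  proof (rule nn_integral_mono)
    fix x :: 'a
    have "ennreal ((\<phi> x - ball_average \<Omega> r \<phi> x)\<^sup>2) \<le> ennreal (1 / ?V * (LINT z|lborel. (f x z)\<^sup>2))"
      using pt[of x] by (intro ennreal_leI) simp
    also have "\<dots> = ennreal (1 / ?V) * (\<integral>\<^sup>+z. ennreal ((f x z)\<^sup>2) \<partial>lborel)"
      using V by (subst nn_integral_eq_integral[OF if2]) (auto simp: ennreal_mult[symmetric])
    finally show "ennreal ((\<phi> x - ball_average \<Omega> r \<phi> x)\<^sup>2) \<le> ennreal (1 / ?V) * (\<integral>\<^sup>+z. ennreal ((f x z)\<^sup>2) \<partial>lborel)" .
  qed
  also have "\<dots> = ennreal (1 / ?V) * (\<integral>\<^sup>+x. (\<integral>\<^sup>+z. ennreal ((f x z)\<^sup>2) \<partial>lborel) \<partial>lborel)"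
    unfolding f_def by (rule nn_integral_cmult) measurable
  also have "(\<integral>\<^sup>+x. (\<integral>\<^sup>+z. ennreal ((f x z)\<^sup>2) \<partial>lborel) \<partial>lborel) = (\<integral>\<^sup>+z. (\<integral>\<^sup>+x. ennreal ((f x z)\<^sup>2) \<partial>lborel) \<partial>lborel)"
    unfolding f_def by (rule lborel_pair.Fubini'[symmetric]) measurable
  also have "\<dots> \<le> (\<integral>\<^sup>+(z::'a). ennreal (r\<^sup>2 * D) * indicator (ball 0 r) z \<partial>lborel)"
  proof (rule nn_integral_mono)
    fix z :: 'a
    show "(\<integral>\<^sup>+x. ennreal ((f x z)\<^sup>2) \<partial>lborel) \<le> ennreal (r\<^sup>2 * D) * indicator (ball 0 r) z"
    proof (cases "z \<in> ball 0 r")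
      case True
      have "(\<integral>\<^sup>+x. ennreal ((f x z)\<^sup>2) \<partial>lborel) = ennreal (LINT x|lborel. (\<phi> (x + z) - \<phi> x)\<^sup>2)"
        unfolding f2 using True by (simp add: nn_integral_eq_integral[OF test_translation_bound(1)[OF \<phi>]])
      also have "\<dots> \<le> ennreal (r\<^sup>2 * D)"
      proof (rule ennreal_leI)
        have "(LINT x|lborel. (\<phi> (x + z) - \<phi> x)\<^sup>2) \<le> (norm z)\<^sup>2 * D"
          using test_translation_bound(2)[OF \<phi>, of z] by (simp add: D_def sq_int_test_eq_lborel(2)[OF \<phi>])
        also have "\<dots> \<le> r\<^sup>2 * D" using True D by (intro mult_right_mono power_mono) auto
        finally show "(LINT x|lborel. (\<phi> (x + z) - \<phi> x)\<^sup>2) \<le> r\<^sup>2 * D" .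
      qed
      finally show ?thesis using True by simp
    qed (simp add: f2)
  qed
  also have "\<dots> = ennreal (r\<^sup>2 * D) * ennreal ?V"
    using emeasure_bounded_finite[of "ball (0::'a) r"]
    by (simp add: nn_integral_cmult_indicator emeasure_eq_ennreal_measure less_top[symmetric])
  also have "ennreal (1 / ?V) * (ennreal (r\<^sup>2 * D) * ennreal ?V) = ennreal (r\<^sup>2 * D)"
    using V D by (simp add: ennreal_mult[symmetric])
  finally have nn: "(\<integral>\<^sup>+x. ennreal ((\<phi> x - ball_average \<Omega> r \<phi> x)\<^sup>2) \<partial>lborel) \<le> ennreal (r\<^sup>2 * D)"
    by (simp add: mult_left_mono)
  let ?e = "\<lambda>x. \<phi> x - ball_average \<Omega> r \<phi> x"
  have se: "sq_integrable M ?e"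
    using test_functionsD(5)[OF \<phi>] ball_average_continuous[OF r \<phi>]
    by (intro continuous_sq_integrable continuous_intros) auto
  have "ennreal (sq_int M ?e) = (\<integral>\<^sup>+x. ennreal ((?e x)\<^sup>2) \<partial>M)"
    using nn_integral_eq_integral[of M "\<lambda>x. (?e x)\<^sup>2"] se by (simp add: sq_int_def sq_integrable_def)
  also have "\<dots> \<le> (\<integral>\<^sup>+x. ennreal ((?e x)\<^sup>2) \<partial>lebesgue)"
    by (subst nn_integral_restrict_space) (auto intro!: nn_integral_mono simp: indicator_def)
  also have "\<dots> = (\<integral>\<^sup>+x. ennreal ((?e x)\<^sup>2) \<partial>lborel)" by (rule nn_integral_completion)
  also note nn
  finally show ?thesis using D by (simp add: D_def)
qed

end

section \<open>Rellich's compactness theorem\<close>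

lemma sq_int_parallelogram:
  assumes "sq_integrable M f" "sq_integrable M g"
  shows "sq_int M (\<lambda>x. f x + g x) + sq_int M (\<lambda>x. f x - g x) = 2 * sq_int M f + 2 * sq_int M g"
  using sq_int_sum_inner[OF assms, of 1] sq_int_sum_inner[OF assms, of "-1"] by simp

context bounded_open
begin

text \<open>Averages over balls of a fixed radius form a bounded equicontinuous family, so
  Arzela-Ascoli applies at every scale and a diagonal subsequence serves all scales. By
  \<open>ball_average_close\<close> the averages are L^2 close to the functions, uniformly in the
  sequence.\<close>

lemma Rellich:
  assumes t: "\<And>n. \<phi> n \<in> test_functions \<Omega>"
    and C: "\<And>n. sq_int M (\<phi> n) \<le> C" "\<And>n. sq_int M (grad (\<phi> n)) \<le> C"
  obtains k where "strict_mono (k::nat\<Rightarrow>nat)"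
    "\<And>e. e > 0 \<Longrightarrow> \<exists>N. \<forall>m\<ge>N. \<forall>n\<ge>N. sq_int M (\<lambda>x. \<phi> (k m) x - \<phi> (k n) x) < e"
proof -
  define r where "r j = inverse (real (Suc j))" for j
  have r: "r j > 0" for j by (simp add: r_def)
  define A where "A j n = ball_average \<Omega> (r j) (\<phi> n)" for j n
  \<comment> \<open>Only closeness up to r j is demanded at scale j. This property passes to
    subsequences and ignores finitely many terms, as the diagonal argument requires.\<close>
  define P where "P j s \<longleftrightarrow> (\<exists>N. \<forall>m\<ge>N. \<forall>n\<ge>N. \<forall>x\<in>\<Omega>. \<bar>A j (s m) x - A j (s n) x\<bar> \<le> r j)" for j and s :: "nat \<Rightarrow> nat"
  have sub: "\<exists>k. strict_mono (k::nat\<Rightarrow>nat) \<and> P j (s \<circ> k)" for j s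
  proof -
    define V where "V = measure lborel (ball (0::'a) (r j))"
    have V: "V > 0" unfolding V_def by (rule ball_volume_pos[OF r])
    have bd: "norm (A j (s n) x) \<le> sqrt C / sqrt V" for n x
    proof -
      have "\<bar>A j (s n) x\<bar> \<le> sqrt (sq_int M (\<phi> (s n))) / sqrt V"
        unfolding A_def V_def by (rule ball_average_bound[OF r test_function_sq_integrable(1)[OF t]])
      also have "\<dots> \<le> sqrt C / sqrt V" using C(1) V by (intro divide_right_mono real_sqrt_le_mono) auto
      finally show ?thesis by simp
    qed
    define L where "L = sqrt C / sqrt V + 1"
    have "C \<ge> 0" using C(1)[of 0] sq_int_nonneg[of M "\<phi> 0"] by linarith
    then have L: "L > 0" using V by (simp add: L_def add_nonneg_pos)
    have lip: "norm (A j (s n) x - A j (s n) y) \<le> L * norm (x - y)" for n x y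
    proof -
      have "\<bar>A j (s n) x - A j (s n) y\<bar> \<le> norm (x - y) * sqrt (sq_int M (grad (\<phi> (s n)))) / sqrt V"
        unfolding A_def V_def by (rule ball_average_lipschitz[OF r t])
      also have "\<dots> \<le> norm (x - y) * sqrt C / sqrt V"
        using C(2) V by (intro divide_right_mono mult_left_mono real_sqrt_le_mono) auto
      also have "\<dots> \<le> L * norm (x - y)" by (simp add: L_def algebra_simps)
      finally show ?thesis by simp
    qed
    have comp: "compact (closure \<Omega>)" using bounded_Omega by simp
    obtain g k where k: "strict_mono (k::nat\<Rightarrow>nat)"
      "\<And>e. 0 < e \<Longrightarrow> \<exists>N. \<forall>n x. n \<ge> N \<and> x \<in> closure \<Omega> \<longrightarrow> norm (A j (s (k n)) x - g x) < e"
    proof (rule Arzela_Ascoli[OF comp, of "\<lambda>n. A j (s n)" "sqrt C / sqrt V"])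
      show "norm (A j (s n) x) \<le> sqrt C / sqrt V" for n x by (rule bd)
      show "\<exists>d>0. \<forall>n y. y \<in> closure \<Omega> \<and> norm (x - y) < d \<longrightarrow> norm (A j (s n) x - A j (s n) y) < e"
        if "e > 0" for x e
      proof (intro exI[of _ "e / L"] conjI allI impI)
        show "e / L > 0" using that L by simp
        fix n y assume "y \<in> closure \<Omega> \<and> norm (x - y) < e / L"
        then have "L * norm (x - y) < e" using L by (simp add: field_simps)
        then show "norm (A j (s n) x - A j (s n) y) < e" using lip[of n x y] by linarith
      qed
    qed blast
    obtain N where N: "\<And>n x. n \<ge> N \<Longrightarrow> x \<in> closure \<Omega> \<Longrightarrow> norm (A j (s (k n)) x - g x) < r j / 2"
      using k(2)[of "r j / 2"] r[of j] by auto
    have "\<bar>A j (s (k m)) x - A j (s (k n)) x\<bar> \<le> r j" if "m \<ge> N" "n \<ge> N" "x \<in> \<Omega>" for m n x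
    proof -
      have xc: "x \<in> closure \<Omega>" using that(3) closure_subset by blast
      show ?thesis using N[OF that(1) xc] N[OF that(2) xc] unfolding real_norm_def by linarith
    qed
    then have "P j (s \<circ> k)" unfolding P_def by auto
    with k(1) show ?thesis by blast
  qed
  have PP: "P j (s \<circ> k2)" if p: "P j (s \<circ> k1)" and N: "\<And>i. N \<le> i \<Longrightarrow> \<exists>i'. i \<le> i' \<and> k2 i = k1 i'" for j s k1 k2 N
  proof -
    obtain N0 where N0: "\<And>m n x. m \<ge> N0 \<Longrightarrow> n \<ge> N0 \<Longrightarrow> x \<in> \<Omega> \<Longrightarrow> \<bar>A j (s (k1 m)) x - A j (s (k1 n)) x\<bar> \<le> r j"
      using p unfolding P_def by auto
    have "\<bar>A j (s (k2 m)) x - A j (s (k2 n)) x\<bar> \<le> r j" if mn: "m \<ge> max N N0" "n \<ge> max N N0" "x \<in> \<Omega>" for m n x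
    proof -
      obtain m' n' where "m \<le> m'" "k2 m = k1 m'" "n \<le> n'" "k2 n = k1 n'"
        using N[of m] N[of n] mn by auto
      then show ?thesis using N0[of m' n' x] mn by simp
    qed
    then show ?thesis unfolding P_def o_def by blast
  qed
  obtain k where k: "strict_mono (k::nat\<Rightarrow>nat)" "\<And>j. P j (id \<circ> k)"
    by (rule subsequence_diagonalization_lemma[of P id]) (rule sub, erule PP, blast, blast)
  have "\<exists>N. \<forall>m\<ge>N. \<forall>n\<ge>N. sq_int M (\<lambda>x. \<phi> (k m) x - \<phi> (k n) x) < e" if e: "e > 0" for e
  proof -
    \<comment> \<open>Q collects the constants of the final estimate: the squared norm of the
      difference is at most (r j)^2 Q, with 4 C as the bound for the squared norm of its
      gradient.\<close>
    define Q where "Q = 8 * C + 2 * measure M (space M)"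
    have "C \<ge> 0" using C(1)[of 0] sq_int_nonneg[of M "\<phi> 0"] by linarith
    then have Q: "Q \<ge> 0" by (simp add: Q_def)
    obtain j where "inverse (real (Suc j)) < min 1 (e / (Q + 1))"
      using reals_Archimedean[of "min 1 (e / (Q + 1))"] e Q by auto
    then have j: "r j < 1" "r j < e / (Q + 1)" by (auto simp: r_def)
    obtain N where N: "\<And>m n x. m \<ge> N \<Longrightarrow> n \<ge> N \<Longrightarrow> x \<in> \<Omega> \<Longrightarrow> \<bar>A j (k m) x - A j (k n) x\<bar> \<le> r j"
      using k(2)[of j] unfolding P_def by auto
    have "sq_int M (\<lambda>x. \<phi> (k m) x - \<phi> (k n) x) < e" if mn: "m \<ge> N" "n \<ge> N" for m n
    proof -
      define w where "w x = \<phi> (k m) x + (-1) * \<phi> (k n) x" for x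
      have w: "w \<in> test_functions \<Omega>"
        unfolding w_def by (intro test_functions_add test_functions_scale t)
      have gw: "grad w x = grad (\<phi> (k m)) x - grad (\<phi> (k n)) x" for x
        unfolding w_def using test_functionsD(1)[OF t]
        by (subst grad_add) (auto intro: smooth_mult simp: grad_scale smooth_minus grad_scale[of _ "-1", simplified])
      note ts = test_function_sq_integrable[OF t]
      have "sq_int M (grad w) = sq_int M (\<lambda>x. grad (\<phi> (k m)) x + - grad (\<phi> (k n)) x)" by (simp add: sq_int_def gw)
      also have "\<dots> \<le> 2 * sq_int M (grad (\<phi> (k m))) + 2 * sq_int M (\<lambda>x. - grad (\<phi> (k n)) x)"
        by (rule sq_int_add_le[OF ts(2) sq_integrable_uminus[OF ts(2)]])
      also have "\<dots> \<le> 4 * C" using C(2)[of "k m"] C(2)[of "k n"] by (simp add: sq_int_def)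
      finally have gC: "sq_int M (grad w) \<le> 4 * C" .
      have aw: "ball_average \<Omega> (r j) w x = A j (k m) x - A j (k n) x" for x
        using ball_average_diff[OF ts(1) ts(1)] by (simp add: w_def[abs_def] A_def)
      have c1: "sq_integrable M (\<lambda>x. w x - ball_average \<Omega> (r j) w x)" "sq_integrable M (ball_average \<Omega> (r j) w)"
        using continuous_sq_integrable[OF ball_average_continuous[OF r w]] test_function_sq_integrable(1)[OF w]
        by (auto intro: sq_integrable_diff)
      have "sq_int M (ball_average \<Omega> (r j) w) \<le> (LINT x|M. (r j)\<^sup>2)"
        unfolding sq_int_def
      proof (rule integral_mono_AE)
        show "AE x in M. (norm (ball_average \<Omega> (r j) w x))\<^sup>2 \<le> (r j)\<^sup>2"
          using N[OF mn] r[of j] by (intro AE_M_I) (simp add: aw abs_le_square_iff[symmetric])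
      qed (use c1(2) in \<open>auto simp: sq_integrable_def\<close>)
      then have a1: "sq_int M (ball_average \<Omega> (r j) w) \<le> (r j)\<^sup>2 * measure M (space M)" by (simp add: mult.commute)
      have a2: "sq_int M (\<lambda>x. w x - ball_average \<Omega> (r j) w x) \<le> (r j)\<^sup>2 * (4 * C)"
        using ball_average_close[OF r w, of j] mult_left_mono[OF gC, of "(r j)\<^sup>2"] by simp
      have "sq_int M w \<le> 2 * sq_int M (\<lambda>x. w x - ball_average \<Omega> (r j) w x) + 2 * sq_int M (ball_average \<Omega> (r j) w)"
        using sq_int_add_le[OF c1] by simp
      also have "\<dots> \<le> (r j)\<^sup>2 * Q" using a1 a2 by (simp add: Q_def algebra_simps)
      also have "\<dots> \<le> r j * Q"
        using j(1) r[of j] Q by (intro mult_right_mono) (auto simp: power2_eq_square mult_left_le_one_le)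
      also have "\<dots> < e"
      proof -
        have "r j * (Q + 1) < e" using j(2) Q by (simp add: field_simps)
        then show ?thesis using r[of j] by (simp add: algebra_simps)
      qed
      finally show ?thesis by (simp add: w_def[abs_def])
    qed
    then show ?thesis by blast
  qed
  with k(1) show ?thesis using that by blast
qed

section \<open>Minimisation of the Rayleigh quotient\<close>

lemma sq_int_eq_zero_iff:
  assumes "sq_integrable M f"
  shows "sq_int M f = 0 \<longleftrightarrow> (AE x in M. f x = 0)"
  using assms unfolding sq_int_def sq_integrable_def by (subst integral_nonneg_eq_0_iff_AE) auto

text \<open>Otherwise the constant 1 would be orthogonal to all test functions and vanish almost
  everywhere, although a nonempty open set is not negligible.\<close>

lemma exists_nonzero_test:
  assumes "\<Omega> \<noteq> {}"
  obtains \<phi> where "\<phi> \<in> test_functions \<Omega>" "sq_int M \<phi> = 1"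
proof -
  have "\<exists>\<phi>\<in>test_functions \<Omega>. sq_int M \<phi> \<noteq> 0"
  proof (rule ccontr)
    assume "\<not> ?thesis"
    then have z: "AE x in M. \<phi> x = 0" if "\<phi> \<in> test_functions \<Omega>" for \<phi>
      using sq_int_eq_zero_iff[OF test_function_sq_integrable(1)[OF that]] that by blast
    have "AE x in M. (1::real) = 0"
    proof (rule du_Bois_Reymond)
      fix \<phi> assume \<phi>: "\<phi> \<in> test_functions \<Omega>"
      have "(LINT x|M. 1 * \<phi> x) = (LINT x|M. 0)"
        by (rule integral_cong_AE)
           (use z[OF \<phi>] sq_integrable_measurable[OF test_function_sq_integrable(1)[OF \<phi>]] in auto)
      then show "(LINT x|M. 1 * \<phi> x) = 0" by simp
    qed simp
    then have "AE x in lebesgue. x \<notin> \<Omega>" by (simp add: AE_restrict_space_iff)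
    then have "negligible \<Omega>" by (simp add: negligible_iff_null_sets AE_iff_null_sets)
    then show False using open_not_negligible[OF open_Omega assms] by blast
  qed
  then obtain \<phi> where \<phi>: "\<phi> \<in> test_functions \<Omega>" "sq_int M \<phi> \<noteq> 0" by blast
  then have pos: "sq_int M \<phi> > 0" using sq_int_nonneg[of M \<phi>] by linarith
  show ?thesis
  proof (rule that[of "\<lambda>x. (1 / sqrt (sq_int M \<phi>)) * \<phi> x"])
    show "sq_int M (\<lambda>x. (1 / sqrt (sq_int M \<phi>)) * \<phi> x) = 1"
      using sq_int_scaleR[of M "1 / sqrt (sq_int M \<phi>)" \<phi>] pos by (simp add: power_divide)
  qed (rule test_functions_scale[OF \<phi>(1)])
qed

end

text \<open>For small t the linear term dominates, so it must vanish if the quadratic is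
  nonnegative; the denominator A + 1 in t covers A = 0. This is how a minimum yields its
  Euler-Lagrange equation.\<close>

lemma linear_term_zero:
  fixes A B :: real
  assumes "\<And>t. 0 \<le> 2 * t * B + t\<^sup>2 * A" "A \<ge> 0"
  shows "B = 0"
proof (rule ccontr)
  assume "B \<noteq> 0"
  define t where "t = - B / (A + 1)"
  have A: "A + 1 > 0" using assms(2) by simp
  have "0 \<le> (2 * t * B + t\<^sup>2 * A) * (A + 1)\<^sup>2" using assms(1)[of t] by simp
  also have "\<dots> = 2 * (t * (A + 1)) * B * (A + 1) + (t * (A + 1))\<^sup>2 * A"
    by (simp add: power2_eq_square algebra_simps)
  also have "t * (A + 1) = - B" using A by (simp add: t_def)
  also have "2 * (- B) * B * (A + 1) + (- B)\<^sup>2 * A = - (B\<^sup>2) * (A + 2)"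
    by (simp add: power2_eq_square algebra_simps)
  finally have "0 \<le> - (B\<^sup>2) * (A + 2)" .
  moreover have "B\<^sup>2 * (A + 2) > 0" using \<open>B \<noteq> 0\<close> assms(2) by simp
  ultimately show False by linarith
qed

context bounded_open
begin

text \<open>Direct method on normalised test functions. Rellich makes a minimising sequence L^2
  Cauchy along a subsequence, and the parallelogram law upgrades this to the gradients, so the limit
  is attained strongly. The infimum m is an eigenvalue and a lower bound for all others, so the
  \<open>LEAST\<close> in \<open>first_dirichlet_eigenvalue\<close> is attained.\<close>

lemma first_eigenfunction_exists:
  assumes ne: "\<Omega> \<noteq> {}"
  defines "\<mu> \<equiv> first_dirichlet_eigenvalue \<Omega>"
  obtains u where "u \<in> H1_0 \<Omega>" "\<not> zero_ae_on \<Omega> u" "\<mu> \<ge> 0"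
    "\<And>\<phi>. \<phi> \<in> H1_0 \<Omega> \<Longrightarrow> (LINT x|M. weak_gradient \<Omega> u x \<bullet> weak_gradient \<Omega> \<phi> x) = \<mu> * (LINT x|M. u x * \<phi> x)"
proof -
  define R where "R = {sq_int M (grad \<phi>) |\<phi>. \<phi> \<in> test_functions \<Omega> \<and> sq_int M \<phi> = 1}"
  define m where "m = Inf R"
  obtain \<phi>0 where "\<phi>0 \<in> test_functions \<Omega>" "sq_int M \<phi>0 = 1" by (rule exists_nonzero_test[OF ne])
  then have Rne: "R \<noteq> {}" by (auto simp: R_def)
  have Rbd: "bdd_below R" by (rule bdd_belowI[of _ 0]) (auto simp: R_def)
  have m0: "m \<ge> 0" unfolding m_def by (rule cInf_greatest[OF Rne]) (auto simp: R_def)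
  have low: "m * sq_int M \<phi> \<le> sq_int M (grad \<phi>)" if \<phi>: "\<phi> \<in> test_functions \<Omega>" for \<phi>
  proof (cases "sq_int M \<phi> = 0")
    case False
    then have pos: "sq_int M \<phi> > 0" using sq_int_nonneg[of M \<phi>] by linarith
    define c where "c = 1 / sqrt (sq_int M \<phi>)"
    have c2: "c\<^sup>2 = 1 / sq_int M \<phi>" using pos by (simp add: c_def power_divide)
    have "sq_int M (\<lambda>x. c * \<phi> x) = 1" using sq_int_scaleR[of M c \<phi>] c2 pos by simp
    moreover have "grad (\<lambda>x. c * \<phi> x) = (\<lambda>x. c *\<^sub>R grad \<phi> x)"
      using grad_scale[OF test_functionsD(1)[OF \<phi>]] by (simp add: fun_eq_iff)
    then have "sq_int M (grad (\<lambda>x. c * \<phi> x)) = sq_int M (grad \<phi>) / sq_int M \<phi>"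
      using sq_int_scaleR[of M c "grad \<phi>"] c2 by simp
    ultimately have "sq_int M (grad \<phi>) / sq_int M \<phi> \<in> R"
      unfolding R_def using test_functions_scale[OF \<phi>, of c]
      by (intro CollectI exI[of _ "\<lambda>x. c * \<phi> x"]) simp
    then have "m \<le> sq_int M (grad \<phi>) / sq_int M \<phi>" unfolding m_def by (rule cInf_lower[OF _ Rbd])
    then show ?thesis using pos by (simp add: field_simps)
  qed simp
  have "\<exists>\<phi>. \<phi> \<in> test_functions \<Omega> \<and> sq_int M \<phi> = 1 \<and> sq_int M (grad \<phi>) < m + inverse (real (Suc n))" for n
  proof -
    have "Inf R < m + inverse (real (Suc n))" by (simp add: m_def)
    then obtain y where "y \<in> R" "y < m + inverse (real (Suc n))" using cInf_lessD[OF Rne] by blast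
    then show ?thesis by (auto simp: R_def)
  qed
  then obtain \<phi> where \<phi>: "\<And>n. \<phi> n \<in> test_functions \<Omega>" "\<And>n. sq_int M (\<phi> n) = 1"
    "\<And>n. sq_int M (grad (\<phi> n)) < m + inverse (real (Suc n))" by metis
  have b2: "sq_int M (grad (\<phi> n)) \<le> m + 1" for n
  proof -
    have "inverse (real (Suc n)) \<le> 1" by (simp add: inverse_le_1_iff)
    then show ?thesis using \<phi>(3)[of n] by linarith
  qed
  have b1: "sq_int M (\<phi> n) \<le> m + 1" for n using \<phi>(2) m0 by simp
  have "\<exists>k. strict_mono (k::nat\<Rightarrow>nat) \<and>
      (\<forall>e>0. \<exists>N. \<forall>i\<ge>N. \<forall>j\<ge>N. sq_int M (\<lambda>x. \<phi> (k i) x - \<phi> (k j) x) < e)"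
    by (rule Rellich[of \<phi>, OF \<phi>(1) b1 b2]) auto
  then obtain k where k: "strict_mono (k::nat\<Rightarrow>nat)"
    "\<And>e. e > 0 \<Longrightarrow> \<exists>N. \<forall>i\<ge>N. \<forall>j\<ge>N. sq_int M (\<lambda>x. \<phi> (k i) x - \<phi> (k j) x) < e"
    by auto
  note ts = test_function_sq_integrable[OF \<phi>(1)]
  define \<psi> where "\<psi> n = \<phi> (k n)" for n
  \<comment> \<open>In the parallelogram law for gradients, the sum contributes at least 4 m minus m
    times the squared norm of the difference, by the Rayleigh inequality; the right-hand side is at
    most 4 m plus the two errors of minimisation.\<close>
  have gcauchy: "sq_int M (\<lambda>x. grad (\<psi> i) x - grad (\<psi> j) x) \<le>
      2 * inverse (real (Suc i)) + 2 * inverse (real (Suc j)) + m * sq_int M (\<lambda>x. \<psi> i x - \<psi> j x)" for i j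
  proof -
    define s where "s x = \<psi> i x + \<psi> j x" for x
    have s: "s \<in> test_functions \<Omega>" unfolding s_def \<psi>_def by (intro test_functions_add \<phi>(1))
    have gs: "grad s x = grad (\<psi> i) x + grad (\<psi> j) x" for x
      unfolding s_def \<psi>_def by (rule grad_add[OF test_functionsD(1)[OF \<phi>(1)] test_functionsD(1)[OF \<phi>(1)]])
    have p1: "sq_int M s + sq_int M (\<lambda>x. \<psi> i x - \<psi> j x) = 4"
      using sq_int_parallelogram[OF ts(1) ts(1), of "k i" "k j"] \<phi>(2)[of "k i"] \<phi>(2)[of "k j"] by (simp add: s_def[abs_def] \<psi>_def)
    have p2: "sq_int M (grad s) + sq_int M (\<lambda>x. grad (\<psi> i) x - grad (\<psi> j) x) = 2 * sq_int M (grad (\<psi> i)) + 2 * sq_int M (grad (\<psi> j))"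
      using sq_int_parallelogram[OF ts(2) ts(2), of "k i" "k j"] by (simp add: gs[abs_def] \<psi>_def)
    have inv: "sq_int M (grad (\<psi> n)) \<le> m + inverse (real (Suc n))" for n
    proof -
      have "inverse (real (Suc (k n))) \<le> inverse (real (Suc n))"
        using seq_suble[OF k(1), of n] by (intro le_imp_inverse_le) auto
      then show ?thesis using \<phi>(3)[of "k n"] unfolding \<psi>_def by linarith
    qed
    have "sq_int M s = 4 - sq_int M (\<lambda>x. \<psi> i x - \<psi> j x)" using p1 by linarith
    then have "m * sq_int M s = m * (4 - sq_int M (\<lambda>x. \<psi> i x - \<psi> j x))" by (rule arg_cong)
    then have "sq_int M (grad s) \<ge> 4 * m - m * sq_int M (\<lambda>x. \<psi> i x - \<psi> j x)" using low[OF s] by (simp add: algebra_simps)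
    then show ?thesis using p2 inv[of i] inv[of j] by linarith
  qed
  obtain u where u: "sq_integrable M u" "(\<lambda>n. sq_int M (\<lambda>x. \<psi> n x - u x)) \<longlonglongrightarrow> 0"
    by (rule sq_int_complete[of \<psi>]) (use ts(1) k(2) in \<open>auto simp: \<psi>_def\<close>)
  have gc2: "\<exists>N. \<forall>i\<ge>N. \<forall>j\<ge>N. sq_int M (\<lambda>x. grad (\<psi> i) x - grad (\<psi> j) x) < e" if e: "e > 0" for e
  proof -
    obtain N1 where N1: "\<And>i j. i \<ge> N1 \<Longrightarrow> j \<ge> N1 \<Longrightarrow> sq_int M (\<lambda>x. \<psi> i x - \<psi> j x) < e / (2 * (m + 1))"
      using k(2)[of "e / (2 * (m + 1))"] e m0 unfolding \<psi>_def by auto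
    obtain N2 where N2: "inverse (real (Suc N2)) < e / 8" using reals_Archimedean[of "e / 8"] e by auto
    have "sq_int M (\<lambda>x. grad (\<psi> i) x - grad (\<psi> j) x) < e" if ij: "i \<ge> max N1 N2" "j \<ge> max N1 N2" for i j
    proof -
      have i8: "inverse (real (Suc i)) < e / 8" "inverse (real (Suc j)) < e / 8"
      proof -
        have "inverse (real (Suc l)) < e / 8" if "l \<ge> N2" for l
          by (rule le_less_trans[OF le_imp_inverse_le N2]) (use that in auto)
        then show "inverse (real (Suc i)) < e / 8" "inverse (real (Suc j)) < e / 8" using ij by auto
      qed
      have "m * sq_int M (\<lambda>x. \<psi> i x - \<psi> j x) \<le> (m + 1) * (e / (2 * (m + 1)))"
        using N1[of i j] ij m0 by (intro mult_mono) (auto intro: less_imp_le)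
      also have "\<dots> = e / 2" using m0 by (simp add: field_simps)
      finally show ?thesis using gcauchy[of i j] i8 by linarith
    qed
    then show ?thesis by blast
  qed
  obtain g where g: "sq_integrable M g" "(\<lambda>n. sq_int M (\<lambda>x. grad (\<psi> n) x - g x)) \<longlonglongrightarrow> 0"
    by (rule sq_int_complete[of "\<lambda>n. grad (\<psi> n)"]) (use ts(2) gc2 in \<open>auto simp: \<psi>_def\<close>)
  have A: "H1_approx \<Omega> u g \<psi>"
    unfolding H1_approx_def using u g \<phi>(1) by (auto simp: \<psi>_def)
  have u1: "sq_int M u = 1"
    using sq_int_tendsto[OF _ u(1) u(2)] ts(1) \<phi>(2) by (simp add: \<psi>_def LIMSEQ_const_iff)
  have gm: "sq_int M g \<le> m"
  proof (rule LIMSEQ_le[OF sq_int_tendsto[OF _ g]])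
    show "sq_integrable M (grad (\<psi> n))" for n using ts(2) by (simp add: \<psi>_def)
    show "(\<lambda>n. m + inverse (real (Suc n))) \<longlonglongrightarrow> m"
      using tendsto_add[OF tendsto_const LIMSEQ_inverse_real_of_nat, of m] by simp
    show "\<exists>N. \<forall>n\<ge>N. sq_int M (grad (\<psi> n)) \<le> m + inverse (real (Suc n))"
    proof (intro exI allI impI)
      fix n :: nat
      have "inverse (real (Suc (k n))) \<le> inverse (real (Suc n))"
        using seq_suble[OF k(1), of n] by (intro le_imp_inverse_le) auto
      then show "sq_int M (grad (\<psi> n)) \<le> m + inverse (real (Suc n))" using \<phi>(3)[of "k n"] unfolding \<psi>_def by linarith
    qed
  qed
  have lowH: "m * sq_int M v \<le> sq_int M (weak_gradient \<Omega> v)" if v: "v \<in> H1_0 \<Omega>" for v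
  proof -
    obtain \<xi> where X: "H1_approx \<Omega> v (weak_gradient \<Omega> v) \<xi>" using H1_0_approx[OF v] .
    then have X': "\<And>n. \<xi> n \<in> test_functions \<Omega>" by (simp add: H1_approx_def)
    have "(\<lambda>n. m * sq_int M (\<xi> n)) \<longlonglongrightarrow> m * sq_int M v"
      using X X' test_function_sq_integrable by (intro tendsto_intros sq_int_tendsto) (auto simp: H1_approx_def)
    moreover have "(\<lambda>n. sq_int M (grad (\<xi> n))) \<longlonglongrightarrow> sq_int M (weak_gradient \<Omega> v)"
      using X X' test_function_sq_integrable by (intro sq_int_tendsto) (auto simp: H1_approx_def)
    ultimately show ?thesis by (rule LIMSEQ_le) (use low[OF X'] in blast)
  qed
  note uH = H1_approx_H1_0(1)[OF A] and ug = H1_approx_H1_0(2)[OF A]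
  define w where "w = weak_gradient \<Omega> u"
  have ws: "sq_integrable M w" using H1_0_sq_integrable(2)[OF uH] by (simp add: w_def)
  have wg: "sq_int M w = sq_int M g"
    using ug ws g(1) by (intro sq_int_cong_AE) (auto simp: w_def sq_integrable_measurable)
  have EL: "(LINT x|M. w x \<bullet> weak_gradient \<Omega> v x) = m * (LINT x|M. u x * v x)" if v: "v \<in> H1_0 \<Omega>" for v
  proof -
    note vs = H1_0_sq_integrable[OF v]
    define B where "B = (LINT x|M. w x \<bullet> weak_gradient \<Omega> v x) - m * (LINT x|M. u x * v x)"
    \<comment> \<open>The Rayleigh inequality for u + t v is expanded in t. The constant terms drop
      out because the squared norms are 1 for u and at most m for g.\<close>
    have "0 \<le> 2 * t * B + t\<^sup>2 * (sq_int M (weak_gradient \<Omega> v) - m * sq_int M v)" for t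
    proof -
      note l = H1_0_lincomb[OF uH v, of t]
      have "sq_int M (weak_gradient \<Omega> (\<lambda>x. u x + t * v x)) = sq_int M (\<lambda>x. w x + t *\<^sub>R weak_gradient \<Omega> v x)"
        using l(2) H1_0_sq_integrable(2)[OF l(1)] sq_integrable_add[OF ws sq_integrable_scaleR[OF vs(2)]]
        by (intro sq_int_cong_AE) (auto simp: w_def sq_integrable_measurable)
      then have "m * sq_int M (\<lambda>x. u x + t *\<^sub>R v x) \<le> sq_int M (\<lambda>x. w x + t *\<^sub>R weak_gradient \<Omega> v x)"
        using lowH[OF l(1)] by simp
      then show ?thesis
        unfolding sq_int_sum_inner[OF u(1) vs(1)] sq_int_sum_inner[OF ws vs(2)] wg u1
        using gm by (simp add: B_def algebra_simps)
    qed
    then have "B = 0" by (rule linear_term_zero) (use lowH[OF v] in simp)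
    then show ?thesis by (simp add: B_def)
  qed
  have nz: "\<not> zero_ae_on \<Omega> u" using u1 sq_int_eq_zero_iff[OF u(1)] by (auto simp: zero_ae_on_def)
  have eig: "dirichlet_eigenvalue \<Omega> m"
    unfolding dirichlet_eigenvalue_def using uH nz EL w_def by blast
  \<comment> \<open>Testing the eigenvalue equation with v itself makes \<nu> the Rayleigh quotient
    of v, which is at least m.\<close>
  have "m \<le> \<nu>" if "dirichlet_eigenvalue \<Omega> \<nu>" for \<nu>
  proof -
    obtain v where v: "v \<in> H1_0 \<Omega>" "\<not> zero_ae_on \<Omega> v"
      "(LINT x|M. weak_gradient \<Omega> v x \<bullet> weak_gradient \<Omega> v x) = \<nu> * (LINT x|M. v x * v x)"
      using \<open>dirichlet_eigenvalue \<Omega> \<nu>\<close> unfolding dirichlet_eigenvalue_def by blast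
    have "sq_int M (weak_gradient \<Omega> v) = \<nu> * sq_int M v"
    proof -
      have "sq_int M v = (LINT x|M. v x * v x)" by (simp add: sq_int_def power2_eq_square)
      moreover have "sq_int M (weak_gradient \<Omega> v) = (LINT x|M. weak_gradient \<Omega> v x \<bullet> weak_gradient \<Omega> v x)"
        by (simp add: sq_int_def power2_norm_eq_inner)
      ultimately show ?thesis using v(3) by simp
    qed
    then have "m * sq_int M v \<le> \<nu> * sq_int M v" using lowH[OF v(1)] by simp
    moreover have "sq_int M v > 0"
      using v(2) sq_int_eq_zero_iff[OF H1_0_sq_integrable(1)[OF v(1)]] sq_int_nonneg[of M v]
      by (auto simp: zero_ae_on_def less_le)
    ultimately show ?thesis by simp
  qed
  then have "\<mu> = m" unfolding \<mu>_def first_dirichlet_eigenvalue_def by (intro Least_equality eig)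
  then show ?thesis using that[OF uH nz] EL m0 unfolding w_def by blast
qed

end

section \<open>Boundedness of eigenfunctions\<close>

text \<open>With \<rho> for the function itself, \<rho>' = - s \<rho>^3 is a polynomial in s and
  \<rho>, so regularity bootstraps by induction on k.\<close>

lemma smooth_inverse_sqrt:
  fixes \<epsilon> :: real
  assumes "\<epsilon> > 0"
  shows "smooth (\<lambda>s. inverse (sqrt (s\<^sup>2 + \<epsilon>\<^sup>2)))"
    and "((\<lambda>s. inverse (sqrt (s\<^sup>2 + \<epsilon>\<^sup>2))) has_real_derivative - s * (inverse (sqrt (s\<^sup>2 + \<epsilon>\<^sup>2)))^3) (at s)"
proof -
  define \<rho> where "\<rho> s = inverse (sqrt (s\<^sup>2 + \<epsilon>\<^sup>2))" for s
  have D: "(\<rho> has_real_derivative - s * (\<rho> s)^3) (at s)" for s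
  proof -
    define q where "q s = s\<^sup>2 + \<epsilon>\<^sup>2" for s
    have pos: "q s > 0" using assms by (simp add: q_def add_nonneg_pos)
    have d1: "(q has_real_derivative 2 * s) (at s)" unfolding q_def by (auto intro!: derivative_eq_intros)
    have d2: "((\<lambda>s. sqrt (q s)) has_real_derivative (inverse (sqrt (q s)) / 2) * (2 * s)) (at s)"
      by (rule DERIV_chain2[OF DERIV_real_sqrt d1]) (rule pos)
    have nz: "sqrt (q s) \<noteq> 0" using pos by simp
    have i: "inverse \<bar>q s\<bar> = inverse (sqrt (q s)) * inverse (sqrt (q s))"
      using pos by (simp flip: inverse_mult_distrib)
    have "((\<lambda>s. inverse (sqrt (q s))) has_real_derivative - s * (inverse (sqrt (q s)))^3) (at s)"
      by (rule DERIV_cong[OF DERIV_inverse_fun[OF d2 nz]])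
         (simp add: power3_eq_cube numeral_2_eq_2 i algebra_simps)
    then show ?thesis unfolding q_def \<rho>_def .
  qed
  have "C_k k \<rho>" for k
  proof (induction k)
    case 0
    then show ?case using DERIV_isCont[OF D] by (simp add: continuous_at_imp_continuous_on)
  next
    case (Suc k)
    have s1: "C_k k (\<lambda>s::real. s)" by (rule smooth_ident[unfolded smooth_def, rule_format])
    have "C_k k (\<lambda>s. (-1 * s) * (\<rho> s * (\<rho> s * \<rho> s)))"
      by (intro C_k_mult C_k_const s1 Suc)
    then have "C_k k (\<lambda>s. - s * (\<rho> s)^3)" by (simp add: power3_eq_cube mult.assoc)
    then show ?case by (rule C_k_real_SucI[OF D])
  qed
  then show "smooth (\<lambda>s. inverse (sqrt (s\<^sup>2 + \<epsilon>\<^sup>2)))" by (simp add: smooth_def \<rho>_def[abs_def])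
  show "((\<lambda>s. inverse (sqrt (s\<^sup>2 + \<epsilon>\<^sup>2))) has_real_derivative - s * (inverse (sqrt (s\<^sup>2 + \<epsilon>\<^sup>2)))^3) (at s)"
    using D unfolding \<rho>_def .
qed

text \<open>S is a smooth sign function and J its primitive with J 0 = 0, a smooth absolute value.
  S' \<ge> 0 carries the sign in Kato's inequality; |S| \<le> 1 and 0 \<le> J s \<le> |s| give
  domination as \<epsilon> tends to 0.\<close>

lemma smooth_sign:
  fixes \<epsilon> :: real
  assumes \<epsilon>: "\<epsilon> > 0"
  defines "S \<equiv> \<lambda>s. s * inverse (sqrt (s\<^sup>2 + \<epsilon>\<^sup>2))" and "J \<equiv> \<lambda>s. sqrt (s\<^sup>2 + \<epsilon>\<^sup>2) - \<epsilon>"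
    and "S' \<equiv> \<lambda>s. \<epsilon>\<^sup>2 * (inverse (sqrt (s\<^sup>2 + \<epsilon>\<^sup>2)))^3"
  shows "smooth S" "(S has_real_derivative S' s) (at s)" "smooth J" "(J has_real_derivative S s) (at s)"
    "\<bar>S s\<bar> \<le> 1" "0 \<le> S' s" "\<bar>S' s\<bar> \<le> 1 / \<epsilon>" "continuous_on UNIV S'" "0 \<le> J s" "J s \<le> \<bar>s\<bar>"
proof -
  define \<rho> where "\<rho> s = inverse (sqrt (s\<^sup>2 + \<epsilon>\<^sup>2))" for s
  have pos: "s\<^sup>2 + \<epsilon>\<^sup>2 > 0" for s using \<epsilon> by (simp add: add_nonneg_pos)
  have sr: "smooth \<rho>" unfolding \<rho>_def by (rule smooth_inverse_sqrt(1)[OF \<epsilon>])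
  have \<rho>2: "(s\<^sup>2 + \<epsilon>\<^sup>2) * (\<rho> s)\<^sup>2 = 1" "\<rho> s > 0" for s
  proof -
    have "(\<rho> s)\<^sup>2 = inverse (s\<^sup>2 + \<epsilon>\<^sup>2)" by (simp add: \<rho>_def power_inverse)
    then show "(s\<^sup>2 + \<epsilon>\<^sup>2) * (\<rho> s)\<^sup>2 = 1"
      by (simp only:) (rule right_inverse, rule less_imp_neq[OF pos, symmetric])
    show "\<rho> s > 0" unfolding \<rho>_def using real_sqrt_gt_zero[OF pos[of s]] by (rule positive_imp_inverse_positive)
  qed
  have S: "S = (\<lambda>s. s * \<rho> s)" and S': "S' = (\<lambda>s. \<epsilon>\<^sup>2 * (\<rho> s)^3)" by (auto simp: S_def S'_def \<rho>_def)
  show sS: "smooth S" unfolding S by (intro smooth_mult smooth_ident sr)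
  show "(S has_real_derivative S' s) (at s)"
  proof -
    have "(S has_real_derivative 1 * \<rho> s + (- s * (\<rho> s)^3) * s) (at s)"
      unfolding S \<rho>_def by (rule DERIV_mult[OF DERIV_ident smooth_inverse_sqrt(2)[OF \<epsilon>]])
    moreover have "1 * \<rho> s + (- s * (\<rho> s)^3) * s = S' s"
    proof -
      \<comment> \<open>Inserting (s^2 + \<epsilon>^2) \<rho>^2 = 1 turns \<rho> - s^2 \<rho>^3 into
        \<epsilon>^2 \<rho>^3.\<close>
      have "\<rho> s = \<rho> s * ((s\<^sup>2 + \<epsilon>\<^sup>2) * (\<rho> s)\<^sup>2)" using \<rho>2(1)[of s] by simp
      then show ?thesis by (simp add: S' power2_eq_square power3_eq_cube algebra_simps)
    qed
    ultimately show ?thesis by simp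
  qed
  show JD: "(J has_real_derivative S s) (at s)" for s
  proof -
    have d1: "((\<lambda>s. s\<^sup>2 + \<epsilon>\<^sup>2) has_real_derivative 2 * s) (at s)" by (auto intro!: derivative_eq_intros)
    have "((\<lambda>s. sqrt (s\<^sup>2 + \<epsilon>\<^sup>2)) has_real_derivative (inverse (sqrt (s\<^sup>2 + \<epsilon>\<^sup>2)) / 2) * (2 * s)) (at s)"
      by (rule DERIV_chain2[OF DERIV_real_sqrt d1]) (rule pos)
    from DERIV_diff[OF this DERIV_const[of \<epsilon>]] show ?thesis by (simp add: J_def S_def mult.commute)
  qed
  show "smooth J" by (rule smooth_realI[OF JD sS])
  have sle: "\<bar>s\<bar> \<le> sqrt (s\<^sup>2 + \<epsilon>\<^sup>2)" by (rule real_le_rsqrt) simp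
  have "\<bar>S s\<bar> = \<bar>s\<bar> * \<rho> s" using \<rho>2(2)[of s] by (simp add: S abs_mult)
  also have "\<dots> \<le> sqrt (s\<^sup>2 + \<epsilon>\<^sup>2) * \<rho> s" using sle \<rho>2(2)[of s] by (intro mult_right_mono) auto
  also have "\<dots> = 1"
  proof -
    have "sqrt (s\<^sup>2 + \<epsilon>\<^sup>2) \<noteq> 0" using real_sqrt_gt_zero[OF pos[of s]] by (rule less_imp_neq[symmetric])
    then show ?thesis unfolding \<rho>_def by (rule right_inverse)
  qed
  finally show "\<bar>S s\<bar> \<le> 1" .
  show S'0: "0 \<le> S' s" using \<rho>2(2)[of s] by (simp add: S')
  have "\<rho> s \<le> 1 / \<epsilon>"
  proof -
    have "\<epsilon> \<le> sqrt (s\<^sup>2 + \<epsilon>\<^sup>2)" by (rule real_le_rsqrt) simp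
    then show ?thesis unfolding \<rho>_def inverse_eq_divide
      using \<epsilon> real_sqrt_gt_zero[OF pos[of s]] by (intro divide_left_mono mult_pos_pos) auto
  qed
  moreover have "S' s \<le> \<rho> s"
  proof -
    have "\<epsilon>\<^sup>2 * (\<rho> s)\<^sup>2 \<le> (s\<^sup>2 + \<epsilon>\<^sup>2) * (\<rho> s)\<^sup>2" by (intro mult_right_mono) auto
    then have "\<epsilon>\<^sup>2 * (\<rho> s)\<^sup>2 * \<rho> s \<le> 1 * \<rho> s" using \<rho>2[of s] by (intro mult_right_mono) auto
    then show ?thesis by (simp add: S' power2_eq_square power3_eq_cube mult.assoc)
  qed
  ultimately show "\<bar>S' s\<bar> \<le> 1 / \<epsilon>" using S'0 by simp
  show "continuous_on UNIV S'" unfolding S' by (intro continuous_intros smoothD(3)[OF sr])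
  have "\<epsilon> \<le> sqrt (s\<^sup>2 + \<epsilon>\<^sup>2)" by (rule real_le_rsqrt) simp
  then show "0 \<le> J s" by (simp add: J_def)
  have "sqrt (s\<^sup>2 + \<epsilon>\<^sup>2) \<le> \<bar>s\<bar> + \<epsilon>" using \<epsilon> by (intro real_le_lsqrt) (auto simp: power2_sum)
  then show "J s \<le> \<bar>s\<bar>" by (simp add: J_def)
qed

section \<open>Kato's inequality\<close>

definition laplacian :: "('a::euclidean_space \<Rightarrow> real) \<Rightarrow> 'a \<Rightarrow> real" where
  "laplacian \<psi> x = (\<Sum>b\<in>Basis. grad (\<lambda>y. grad \<psi> y \<bullet> b) x \<bullet> b)"

lemma smooth_laplacian: "smooth \<psi> \<Longrightarrow> smooth (laplacian \<psi>)"
  unfolding laplacian_def[abs_def] by (intro smooth_sum smooth_grad_component)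

context bounded_open
begin

text \<open>Kato's inequality, by testing with \<open>\<psi> * u / sqrt (u\<^sup>2 + \<epsilon>\<^sup>2)\<close> and letting \<open>\<epsilon>\<close> tend to \<open>0\<close>.
  Since \<open>\<psi>\<close> need not vanish on the boundary, this is the subsolution property on the whole space.\<close>

lemma abs_eigenfunction_subsolution:
  assumes u: "u \<in> H1_0 \<Omega>"
    and eig: "\<And>\<phi>. \<phi> \<in> H1_0 \<Omega> \<Longrightarrow> (LINT x|M. weak_gradient \<Omega> u x \<bullet> weak_gradient \<Omega> \<phi> x) = \<mu> * (LINT x|M. u x * \<phi> x)"
    and \<psi>: "smooth \<psi>" "\<And>x. \<psi> x \<ge> 0"
  shows "0 \<le> (LINT x|M. \<bar>u x\<bar> * (laplacian \<psi> x + \<mu> * \<psi> x))"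
proof -
  define w where "w = weak_gradient \<Omega> u"
  obtain \<phi> where A: "H1_approx \<Omega> u w \<phi>" using H1_0_approx[OF u] unfolding w_def by blast
  note us = H1_0_sq_integrable(1)[OF u]
  have ws: "sq_integrable M w" using H1_0_sq_integrable(2)[OF u] by (simp add: w_def)
  note um[measurable] = sq_integrable_measurable[OF us] and wm[measurable] = sq_integrable_measurable[OF ws]
  have ia: "integrable M (\<lambda>x. \<bar>u x\<bar>)" using sq_integrable_integrable[OF us] by simp
  have \<psi>c: "continuous_on UNIV \<psi>" "continuous_on UNIV (laplacian \<psi>)" "continuous_on UNIV (grad \<psi>)"
    using smoothD(3)[OF \<psi>(1)] smoothD(3)[OF smooth_laplacian[OF \<psi>(1)]] continuous_on_grad[OF \<psi>(1)] by auto
  note \<psi>m[measurable] = continuous_measurable[OF \<psi>c(1)] continuous_measurable[OF \<psi>c(2)] continuous_measurable[OF \<psi>c(3)]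
  obtain C1 where C1: "\<And>x. x \<in> \<Omega> \<Longrightarrow> norm (\<psi> x) \<le> C1" using continuous_bounded_on[OF \<psi>c(1)] by blast
  obtain C2 where C2: "\<And>x. x \<in> \<Omega> \<Longrightarrow> norm (laplacian \<psi> x) \<le> C2" using continuous_bounded_on[OF \<psi>c(2)] by blast
  obtain C3 where C3: "\<And>x. x \<in> \<Omega> \<Longrightarrow> norm (grad \<psi> x) \<le> C3" using continuous_bounded_on[OF \<psi>c(3)] by blast
  define S where "S \<epsilon> s = s * inverse (sqrt (s\<^sup>2 + \<epsilon>\<^sup>2))" for \<epsilon> s :: real
  define J where "J \<epsilon> s = sqrt (s\<^sup>2 + \<epsilon>\<^sup>2) - \<epsilon>" for \<epsilon> s :: real
  have key: "0 \<le> (LINT x|M. J \<epsilon> (u x) * laplacian \<psi> x + \<mu> * (u x * S \<epsilon> (u x) * \<psi> x))" if \<epsilon>: "\<epsilon> > 0" for \<epsilon>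
  proof -
    define S' where "S' s = \<epsilon>\<^sup>2 * (inverse (sqrt (s\<^sup>2 + \<epsilon>\<^sup>2)))^3" for s
    have F': "smooth (S \<epsilon>)" "\<And>s. (S \<epsilon> has_real_derivative S' s) (at s)" "smooth (J \<epsilon>)" 
      "\<And>s. (J \<epsilon> has_real_derivative S \<epsilon> s) (at s)" "\<And>s. \<bar>S \<epsilon> s\<bar> \<le> 1" "\<And>s. 0 \<le> S' s" "\<And>s. \<bar>S' s\<bar> \<le> 1 / \<epsilon>" "continuous_on UNIV S'"
      "\<And>s. 0 \<le> J \<epsilon> s" "\<And>s. J \<epsilon> s \<le> \<bar>s\<bar>"
      using smooth_sign[OF \<epsilon>] unfolding S'_def[abs_def] S_def[abs_def] J_def[abs_def] by auto
    have S0: "S \<epsilon> 0 = 0" "J \<epsilon> 0 = 0" using \<epsilon> by (auto simp: S_def J_def)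
    note cS = smoothD(3)[OF F'(1)]
    obtain r1 where "H1_approx \<Omega> (\<lambda>x. \<psi> x * S \<epsilon> (u x)) (\<lambda>x. S \<epsilon> (u x) *\<^sub>R grad \<psi> x + (\<psi> x * S' (u x)) *\<^sub>R w x) (\<lambda>n x. \<psi> x * S \<epsilon> (\<phi> (r1 n) x))"
      by (rule H1_approx_compose_real[OF A F'(1) S0(1) F'(2,8) \<psi>(1), of UNIV "max 1 (1 / \<epsilon>)"])
         (use F'(5,7) in \<open>auto intro: le_max_iff_disj[THEN iffD2]\<close>)
    then obtain \<phi>1 where V1: "H1_approx \<Omega> (\<lambda>x. \<psi> x * S \<epsilon> (u x)) (\<lambda>x. S \<epsilon> (u x) *\<^sub>R grad \<psi> x + (\<psi> x * S' (u x)) *\<^sub>R w x) \<phi>1" by blast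
    obtain r2 where "H1_approx \<Omega> (\<lambda>x. 1 * J \<epsilon> (u x)) (\<lambda>x. J \<epsilon> (u x) *\<^sub>R grad (\<lambda>x. 1) x + (1 * S \<epsilon> (u x)) *\<^sub>R w x) (\<lambda>n x. 1 * J \<epsilon> (\<phi> (r2 n) x))"
      by (rule H1_approx_compose_real[OF A F'(3) S0(2) F'(4) cS smooth_const[of 1], of UNIV 1])
         (use F'(5) in auto)
    then have "H1_approx \<Omega> (\<lambda>x. J \<epsilon> (u x)) (\<lambda>x. S \<epsilon> (u x) *\<^sub>R w x) (\<lambda>n x. 1 * J \<epsilon> (\<phi> (r2 n) x))" by simp
    then obtain \<phi>2 where V2: "H1_approx \<Omega> (\<lambda>x. J \<epsilon> (u x)) (\<lambda>x. S \<epsilon> (u x) *\<^sub>R w x) \<phi>2" by blast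
    have s1: "sq_integrable M (\<lambda>x. \<psi> x * S \<epsilon> (u x))" 
      "sq_integrable M (\<lambda>x. S \<epsilon> (u x) *\<^sub>R grad \<psi> x + (\<psi> x * S' (u x)) *\<^sub>R w x)"
      and s2: "sq_integrable M (\<lambda>x. J \<epsilon> (u x))" "sq_integrable M (\<lambda>x. S \<epsilon> (u x) *\<^sub>R w x)"
      using V1 V2 by (auto simp: H1_approx_def)
    have s3: "sq_integrable M (grad \<psi>)" "sq_integrable M (laplacian \<psi>)"
      using continuous_sq_integrable \<psi>c by blast+
    have i1: "integrable M (\<lambda>x. w x \<bullet> (S \<epsilon> (u x) *\<^sub>R grad \<psi> x + (\<psi> x * S' (u x)) *\<^sub>R w x))" by (rule sq_integrable_inner[OF ws s1(2)])
    have i2: "integrable M (\<lambda>x. (S \<epsilon> (u x) *\<^sub>R w x) \<bullet> grad \<psi> x)" by (rule sq_integrable_inner[OF s2(2) s3(1)])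
    have i3: "integrable M (\<lambda>x. J \<epsilon> (u x) * laplacian \<psi> x)" using sq_integrable_inner[OF s2(1) s3(2)] by simp
    have i4: "integrable M (\<lambda>x. u x * (\<psi> x * S \<epsilon> (u x)))" using sq_integrable_inner[OF us s1(1)] by simp
    have "(LINT x|M. w x \<bullet> (S \<epsilon> (u x) *\<^sub>R grad \<psi> x + (\<psi> x * S' (u x)) *\<^sub>R w x)) =
       (LINT x|M. w x \<bullet> weak_gradient \<Omega> (\<lambda>x. \<psi> x * S \<epsilon> (u x)) x)"
    proof (rule integral_cong_AE)
      show "AE x in M. w x \<bullet> (S \<epsilon> (u x) *\<^sub>R grad \<psi> x + (\<psi> x * S' (u x)) *\<^sub>R w x) = w x \<bullet> weak_gradient \<Omega> (\<lambda>x. \<psi> x * S \<epsilon> (u x)) x"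
        using H1_approx_H1_0(2)[OF V1] by eventually_elim simp
      show "(\<lambda>x. w x \<bullet> weak_gradient \<Omega> (\<lambda>x. \<psi> x * S \<epsilon> (u x)) x) \<in> borel_measurable M"
        using sq_integrable_inner[OF ws H1_0_sq_integrable(2)[OF H1_approx_H1_0(1)[OF V1]]] by simp
    qed (use i1 in simp)
    also have "\<dots> = \<mu> * (LINT x|M. u x * (\<psi> x * S \<epsilon> (u x)))"
      unfolding w_def by (rule eig[OF H1_approx_H1_0(1)[OF V1]])
    finally have e1: "(LINT x|M. w x \<bullet> (S \<epsilon> (u x) *\<^sub>R grad \<psi> x + (\<psi> x * S' (u x)) *\<^sub>R w x)) = \<mu> * (LINT x|M. u x * (\<psi> x * S \<epsilon> (u x)))" .
    \<comment> \<open>The two sides differ by the integral of \<psi> S'(u) |w|^2, the nonnegative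
      term that Kato's inequality discards.\<close>
    have "(LINT x|M. (S \<epsilon> (u x) *\<^sub>R w x) \<bullet> grad \<psi> x) \<le> (LINT x|M. w x \<bullet> (S \<epsilon> (u x) *\<^sub>R grad \<psi> x + (\<psi> x * S' (u x)) *\<^sub>R w x))"
    proof (rule integral_mono[OF i2 i1])
      fix x
      have "0 \<le> \<psi> x * S' (u x) * (w x \<bullet> w x)" using \<psi>(2)[of x] F'(6)[of "u x"] by simp
      then show "(S \<epsilon> (u x) *\<^sub>R w x) \<bullet> grad \<psi> x \<le> w x \<bullet> (S \<epsilon> (u x) *\<^sub>R grad \<psi> x + (\<psi> x * S' (u x)) *\<^sub>R w x)"
        by (simp add: inner_add_right)
    qed
    \<comment> \<open>S(u) w is the gradient of J(u), which lies in \<open>H1_0\<close>; so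
      integration by parts against the components of grad \<psi> has no boundary term.\<close>
    moreover have "(LINT x|M. (S \<epsilon> (u x) *\<^sub>R w x) \<bullet> grad \<psi> x) = - (LINT x|M. J \<epsilon> (u x) * laplacian \<psi> x)"
    proof -
      have ib: "integrable M (\<lambda>x. ((S \<epsilon> (u x) *\<^sub>R w x) \<bullet> b) * (grad \<psi> x \<bullet> b))" 
        "integrable M (\<lambda>x. J \<epsilon> (u x) * (grad (\<lambda>y. grad \<psi> y \<bullet> b) x \<bullet> b))" if "b \<in> Basis" for b
        using sq_integrable_inner[OF sq_integrable_component[OF s2(2)] sq_integrable_component[OF s3(1)], of b b]
          sq_integrable_inner[OF s2(1) smooth_sq_integrable[OF smooth_grad_component[OF smooth_grad_component[OF \<psi>(1) that] that]]]
        by auto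
      have "(LINT x|M. J \<epsilon> (u x) * laplacian \<psi> x) = (LINT x|M. (\<Sum>b\<in>Basis. J \<epsilon> (u x) * (grad (\<lambda>y. grad \<psi> y \<bullet> b) x \<bullet> b)))"
        by (simp add: laplacian_def sum_distrib_left)
      also have "\<dots> = (\<Sum>b\<in>Basis. (LINT x|M. J \<epsilon> (u x) * (grad (\<lambda>y. grad \<psi> y \<bullet> b) x \<bullet> b)))"
        by (rule Bochner_Integration.integral_sum) (rule ib(2))
      also have "\<dots> = (\<Sum>b\<in>Basis. - (LINT x|M. ((S \<epsilon> (u x) *\<^sub>R w x) \<bullet> b) * (grad \<psi> x \<bullet> b)))"
        by (intro sum.cong refl H1_approx_by_parts[OF V2] smooth_grad_component[OF \<psi>(1)])
      also have "\<dots> = - (LINT x|M. (\<Sum>b\<in>Basis. ((S \<epsilon> (u x) *\<^sub>R w x) \<bullet> b) * (grad \<psi> x \<bullet> b)))"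
        by (subst Bochner_Integration.integral_sum) (auto simp: sum_negf intro: ib(1)[simplified])
      also have "\<dots> = - (LINT x|M. (S \<epsilon> (u x) *\<^sub>R w x) \<bullet> grad \<psi> x)"
        by (simp only: euclidean_inner[symmetric])
      finally show ?thesis by simp
    qed
    ultimately have "0 \<le> (LINT x|M. J \<epsilon> (u x) * laplacian \<psi> x) + \<mu> * (LINT x|M. u x * (\<psi> x * S \<epsilon> (u x)))"
      using e1 by linarith
    also have "\<dots> = (LINT x|M. J \<epsilon> (u x) * laplacian \<psi> x + \<mu> * (u x * S \<epsilon> (u x) * \<psi> x))"
      using i3 i4 by (simp add: mult.assoc mult.commute[of "S \<epsilon> _"])
    finally show ?thesis .
  qed
  define e where "e n = inverse (real (Suc n))" for n
  have e: "e n > 0" "e \<longlonglongrightarrow> 0" for n unfolding e_def using LIMSEQ_inverse_real_of_nat by simp_all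
  have "(\<lambda>n. LINT x|M. J (e n) (u x) * laplacian \<psi> x + \<mu> * (u x * S (e n) (u x) * \<psi> x))
      \<longlonglongrightarrow> (LINT x|M. \<bar>u x\<bar> * (laplacian \<psi> x + \<mu> * \<psi> x))"
  proof (rule integral_dominated_convergence[where w = "\<lambda>x. \<bar>u x\<bar> * (C2 + \<bar>\<mu>\<bar> * C1)"])
    show "(\<lambda>x. \<bar>u x\<bar> * (laplacian \<psi> x + \<mu> * \<psi> x)) \<in> borel_measurable M" by measurable
    show "(\<lambda>x. J (e n) (u x) * laplacian \<psi> x + \<mu> * (u x * S (e n) (u x) * \<psi> x)) \<in> borel_measurable M" for n
      unfolding J_def S_def by measurable
    show "integrable M (\<lambda>x. \<bar>u x\<bar> * (C2 + \<bar>\<mu>\<bar> * C1))" using ia by simp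
    show "AE x in M. (\<lambda>n. J (e n) (u x) * laplacian \<psi> x + \<mu> * (u x * S (e n) (u x) * \<psi> x)) \<longlonglongrightarrow> \<bar>u x\<bar> * (laplacian \<psi> x + \<mu> * \<psi> x)"
    proof (rule AE_I2)
      fix x
      have sq: "(\<lambda>n. sqrt ((u x)\<^sup>2 + (e n)\<^sup>2)) \<longlonglongrightarrow> sqrt ((u x)\<^sup>2 + 0\<^sup>2)" by (intro tendsto_intros e)
      have j: "(\<lambda>n. J (e n) (u x)) \<longlonglongrightarrow> \<bar>u x\<bar>" unfolding J_def using tendsto_diff[OF sq e(2)] by simp
      have "(\<lambda>n. u x * S (e n) (u x)) \<longlonglongrightarrow> \<bar>u x\<bar>"
      proof (cases "u x = 0")
        case False
        have "(\<lambda>n. u x * (u x * inverse (sqrt ((u x)\<^sup>2 + (e n)\<^sup>2)))) \<longlonglongrightarrow> u x * (u x * inverse (sqrt ((u x)\<^sup>2 + 0\<^sup>2)))"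
          by (intro tendsto_mult tendsto_const tendsto_inverse sq) (use False in simp)
        moreover have "u x * (u x * inverse (sqrt ((u x)\<^sup>2 + 0\<^sup>2))) = \<bar>u x\<bar>"
          using False by (simp add: field_simps abs_mult_self_eq)
        ultimately show ?thesis by (simp add: S_def)
      qed (simp add: S_def)
      then have "(\<lambda>n. J (e n) (u x) * laplacian \<psi> x + \<mu> * (u x * S (e n) (u x) * \<psi> x)) \<longlonglongrightarrow> \<bar>u x\<bar> * laplacian \<psi> x + \<mu> * (\<bar>u x\<bar> * \<psi> x)"
        by (intro tendsto_intros j)
      then show "(\<lambda>n. J (e n) (u x) * laplacian \<psi> x + \<mu> * (u x * S (e n) (u x) * \<psi> x)) \<longlonglongrightarrow> \<bar>u x\<bar> * (laplacian \<psi> x + \<mu> * \<psi> x)"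
        by (simp add: algebra_simps)
    qed
    show "AE x in M. norm (J (e n) (u x) * laplacian \<psi> x + \<mu> * (u x * S (e n) (u x) * \<psi> x)) \<le> \<bar>u x\<bar> * (C2 + \<bar>\<mu>\<bar> * C1)" for n
    proof (rule AE_M_I)
      fix x assume x: "x \<in> \<Omega>"
      have F: "\<bar>S (e n) (u x)\<bar> \<le> 1" "0 \<le> J (e n) (u x)" "J (e n) (u x) \<le> \<bar>u x\<bar>"
        unfolding S_def J_def by (rule smooth_sign[OF e(1)])+
      have "\<bar>J (e n) (u x) * laplacian \<psi> x\<bar> \<le> \<bar>u x\<bar> * C2"
        unfolding abs_mult using F(2,3) C2[OF x] by (intro mult_mono) auto
      moreover have "\<bar>\<mu> * (u x * S (e n) (u x) * \<psi> x)\<bar> \<le> \<bar>\<mu>\<bar> * (\<bar>u x\<bar> * 1 * C1)"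
        unfolding abs_mult using F(1) C1[OF x] by (intro mult_left_mono mult_mono) auto
      ultimately have "\<bar>J (e n) (u x) * laplacian \<psi> x + \<mu> * (u x * S (e n) (u x) * \<psi> x)\<bar> \<le> \<bar>u x\<bar> * C2 + \<bar>\<mu>\<bar> * (\<bar>u x\<bar> * 1 * C1)"
        by (intro order_trans[OF abs_triangle_ineq add_mono])
      then show "norm (J (e n) (u x) * laplacian \<psi> x + \<mu> * (u x * S (e n) (u x) * \<psi> x)) \<le> \<bar>u x\<bar> * (C2 + \<bar>\<mu>\<bar> * C1)"
        by (simp add: algebra_simps)
    qed
  qed
  then show ?thesis by (rule LIMSEQ_le_const) (use key[OF e(1)] in auto)
qed

end

section \<open>Comparison with the heat kernel\<close>

lemma gaussian:
  fixes x :: "'a::euclidean_space" and \<alpha> \<beta> :: real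
  defines "\<psi> \<equiv> \<lambda>y. exp (\<alpha> - \<beta> * ((y - x) \<bullet> (y - x)))"
  shows "smooth \<psi>"
    and "laplacian \<psi> y = \<psi> y * (4 * \<beta>\<^sup>2 * ((y - x) \<bullet> (y - x)) - 2 * \<beta> * DIM('a))"
proof -
  have "smooth (\<lambda>y. (y - x) \<bullet> (y - x))"
  proof -
    have eq: "(y - x) \<bullet> (y - x) = (\<Sum>b\<in>Basis. (y \<bullet> b - x \<bullet> b) * (y \<bullet> b - x \<bullet> b))" for y
      by (subst euclidean_inner) (simp add: inner_diff_left)
    show ?thesis
      unfolding eq by (intro smooth_sum smooth_mult smooth_diff smooth_inner_left smooth_const)
  qed
  then show s: "smooth \<psi>"
    unfolding \<psi>_def by (intro smooth_compose[OF smooth_exp] smooth_diff smooth_mult smooth_const)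
  have g: "grad \<psi> y = (- 2 * \<beta> * \<psi> y) *\<^sub>R (y - x)" for y
    by (rule grad_unique) (auto intro!: derivative_eq_intros simp: \<psi>_def fun_eq_iff inner_commute algebra_simps)
  have gg: "grad (\<lambda>y. grad \<psi> y \<bullet> b) y \<bullet> b = \<psi> y * (4 * \<beta>\<^sup>2 * ((y - x) \<bullet> b)\<^sup>2 - 2 * \<beta>)" if b: "b \<in> Basis" for b y
  proof -
    have eq: "(\<lambda>y. grad \<psi> y \<bullet> b) = (\<lambda>y. \<psi> y * (- 2 * \<beta> * ((y - x) \<bullet> b)))" by (simp add: g fun_eq_iff)
    have l: "smooth (\<lambda>y. - 2 * \<beta> * ((y - x) \<bullet> b))"
      unfolding inner_diff_left by (intro smooth_mult smooth_diff smooth_inner_left smooth_const)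
    have gl: "grad (\<lambda>y. - 2 * \<beta> * ((y - x) \<bullet> b)) y = (- 2 * \<beta>) *\<^sub>R b"
      by (rule grad_unique) (auto intro!: derivative_eq_intros simp: inner_commute)
    have "grad (\<lambda>y. grad \<psi> y \<bullet> b) y \<bullet> b = (\<psi> y *\<^sub>R ((- 2 * \<beta>) *\<^sub>R b) + (- 2 * \<beta> * ((y - x) \<bullet> b)) *\<^sub>R grad \<psi> y) \<bullet> b"
      unfolding eq by (subst grad_mult[OF s l]) (simp only: gl)
    also have "\<dots> = \<psi> y * (4 * \<beta>\<^sup>2 * ((y - x) \<bullet> b)\<^sup>2 - 2 * \<beta>)"
      using b by (simp add: g inner_add_left inner_diff_left algebra_simps power2_eq_square)
    finally show ?thesis .
  qed
  have "laplacian \<psi> y = (\<Sum>b\<in>Basis. \<psi> y * (4 * \<beta>\<^sup>2 * ((y - x) \<bullet> b)\<^sup>2 - 2 * \<beta>))"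
    unfolding laplacian_def by (rule sum.cong) (auto simp: gg)
  also have "\<dots> = \<psi> y * (4 * \<beta>\<^sup>2 * (\<Sum>b\<in>Basis. ((y - x) \<bullet> b)\<^sup>2) - 2 * \<beta> * DIM('a))"
    by (simp add: sum_distrib_left[symmetric] sum_subtractf algebra_simps)
  also have "(\<Sum>b\<in>Basis. ((y - x) \<bullet> b)\<^sup>2) = (y - x) \<bullet> (y - x)"
    by (simp add: euclidean_inner[of "y - x" "y - x"] power2_eq_square)
  finally show "laplacian \<psi> y = \<psi> y * (4 * \<beta>\<^sup>2 * ((y - x) \<bullet> (y - x)) - 2 * \<beta> * DIM('a))" .
qed

context bounded_open
begin

text \<open>The mean value theorem bounds the difference quotients by C on \<Omega>, and dominated
  convergence passes to the limit along every sequence that tends to \<open>r0\<close>.\<close>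

lemma DERIV_integral:
  fixes k k' :: "real \<Rightarrow> 'a \<Rightarrow> real"
  assumes v: "integrable M v" and r0: "a < r0" "r0 < b"
    and D: "\<And>r y. a < r \<Longrightarrow> r < b \<Longrightarrow> ((\<lambda>r. k r y) has_real_derivative k' r y) (at r)"
    and bound: "\<And>r y. a < r \<Longrightarrow> r < b \<Longrightarrow> y \<in> \<Omega> \<Longrightarrow> \<bar>k' r y\<bar> \<le> C"
    and meas: "\<And>r. k r \<in> borel_measurable M" "k' r0 \<in> borel_measurable M"
    and int: "\<And>r. a < r \<Longrightarrow> r < b \<Longrightarrow> integrable M (\<lambda>y. v y * k r y)"
  shows "((\<lambda>r. LINT y|M. v y * k r y) has_real_derivative (LINT y|M. v y * k' r0 y)) (at r0)"
  unfolding has_field_derivative_iff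
proof (subst tendsto_at_iff_sequentially, intro allI impI)
  fix X :: "nat \<Rightarrow> real" assume X: "\<forall>i. X i \<in> UNIV - {r0}" "X \<longlonglongrightarrow> r0"
  have "\<forall>\<^sub>F i in sequentially. a < X i \<and> X i < b"
    by (rule eventually_conj[OF order_tendstoD(1)[OF X(2) r0(1)] order_tendstoD(2)[OF X(2) r0(2)]])
  then obtain N where N: "\<And>i. i \<ge> N \<Longrightarrow> a < X i \<and> X i < b" by (auto simp: eventually_sequentially)
  \<comment> \<open>Finitely many terms are dropped so that all parameters lie in the interval where
    the bounds hold.\<close>
  define Y where "Y i = X (i + N)" for i
  have Y: "a < Y i" "Y i < b" "Y i \<noteq> r0" for i using N[of "i + N"] X(1) by (auto simp: Y_def)
  have Ylim: "Y \<longlonglongrightarrow> r0" unfolding Y_def by (rule LIMSEQ_ignore_initial_segment[OF X(2)])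
  define q where "q i y = v y * ((k (Y i) y - k r0 y) / (Y i - r0))" for i y
  have "(\<lambda>i. LINT y|M. q i y) \<longlonglongrightarrow> (LINT y|M. v y * k' r0 y)"
  proof (rule integral_dominated_convergence[where w = "\<lambda>y. \<bar>v y\<bar> * C"])
    show "(\<lambda>y. v y * k' r0 y) \<in> borel_measurable M"
      by (rule borel_measurable_times[OF borel_measurable_integrable[OF v] meas(2)])
    show "q i \<in> borel_measurable M" for i
      unfolding q_def
      by (rule borel_measurable_times[OF borel_measurable_integrable[OF v]
            borel_measurable_divide[OF borel_measurable_diff[OF meas(1) meas(1)] borel_measurable_const]])
    show "integrable M (\<lambda>y. \<bar>v y\<bar> * C)" using v by simp
    show "AE y in M. (\<lambda>i. q i y) \<longlonglongrightarrow> v y * k' r0 y"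
    proof (rule AE_I2)
      fix y
      have "((\<lambda>r. (k r y - k r0 y) / (r - r0)) \<longlongrightarrow> k' r0 y) (at r0)"
        using D[OF r0, of y] by (simp add: has_field_derivative_iff)
      moreover have "filterlim Y (at r0) sequentially" using Ylim Y(3) by (auto simp: filterlim_at)
      ultimately have l: "(\<lambda>i. (k (Y i) y - k r0 y) / (Y i - r0)) \<longlonglongrightarrow> k' r0 y"
        by (rule filterlim_compose[where g = "\<lambda>r. (k r y - k r0 y) / (r - r0)"])
      show "(\<lambda>i. q i y) \<longlonglongrightarrow> v y * k' r0 y"
        using tendsto_mult[OF tendsto_const[of "v y"] l] by (simp only: q_def)
    qed
    show "AE y in M. norm (q i y) \<le> \<bar>v y\<bar> * C" for i
    proof (rule AE_M_I)
      fix y assume y: "y \<in> \<Omega>"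
      have "norm (k (Y i) y - k r0 y) \<le> C * norm (Y i - r0)"
      proof (rule differentiable_bound[of "{a<..<b}" "\<lambda>r. k r y" "\<lambda>r h. k' r y * h"])
        fix r assume r: "r \<in> {a<..<b}"
        show "((\<lambda>r. k r y) has_derivative (\<lambda>h. k' r y * h)) (at r within {a<..<b})"
          by (rule has_derivative_at_withinI[OF D[unfolded has_field_derivative_def]]) (use r in auto)
        show "onorm (\<lambda>h. k' r y * h) \<le> C"
        proof (rule onorm_bound)
          have b: "\<bar>k' r y\<bar> \<le> C" using bound[of r y] r y by simp
          then show "0 \<le> C" by linarith
          show "norm (k' r y * h) \<le> C * norm h" for h using b by (simp add: abs_mult mult_right_mono)
        qed
      next
        show "convex {a<..<b}" by (rule convex_real_interval)
        show "Y i \<in> {a<..<b}" using Y(1,2)[of i] by simp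
        show "r0 \<in> {a<..<b}" using r0 by simp
      qed
      moreover have "\<bar>Y i - r0\<bar> > 0" using Y(3)[of i] by simp
      ultimately have "\<bar>(k (Y i) y - k r0 y) / (Y i - r0)\<bar> \<le> C"
        by (simp only: abs_divide pos_divide_le_eq real_norm_def)
      then show "norm (q i y) \<le> \<bar>v y\<bar> * C" unfolding q_def real_norm_def abs_mult by (rule mult_left_mono[OF _ abs_ge_zero])
    qed
  qed
  moreover have "(LINT y|M. q i y) = ((LINT y|M. v y * k (Y i) y) - (LINT y|M. v y * k r0 y)) / (Y i - r0)" for i
  proof -
    have "(LINT y|M. q i y) = (LINT y|M. (v y * k (Y i) y - v y * k r0 y) / (Y i - r0))"
      by (rule Bochner_Integration.integral_cong) (auto simp: q_def right_diff_distrib)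
    then show ?thesis using int[OF Y(1,2), of i] int[OF r0] by simp
  qed
  ultimately have "(\<lambda>i. (((\<lambda>r. ((LINT y|M. v y * k r y) - (LINT y|M. v y * k r0 y)) / (r - r0)) \<circ> X) (i + N)))
      \<longlonglongrightarrow> (LINT y|M. v y * k' r0 y)"
    by (simp add: Y_def)
  then show "((\<lambda>r. ((LINT y|M. v y * k r y) - (LINT y|M. v y * k r0 y)) / (r - r0)) \<circ> X)
      \<longlonglongrightarrow> (LINT y|M. v y * k' r0 y)"
    by (rule LIMSEQ_offset[of _ N])
qed

text \<open>With time \<open>t = r\<^sup>2\<close>, the kernel \<open>exp (\<mu> t)\<close> times the heat kernel solves
  \<open>\<partial>\<^sub>t K = \<Delta> K + \<mu> K\<close>, so its integral against a subsolution is nondecreasing in time.\<close>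

lemma subsolution_ball_integral:
  assumes v: "integrable M v" "\<And>x. v x \<ge> 0" and \<mu>: "\<mu> \<ge> 0"
    and sub: "\<And>\<psi>. smooth \<psi> \<Longrightarrow> (\<And>x. \<psi> x \<ge> 0) \<Longrightarrow> 0 \<le> (LINT x|M. v x * (laplacian \<psi> x + \<mu> * \<psi> x))"
    and s: "0 < s" "s \<le> 1"
  shows "(LINT y|M. indicator (ball x s) y * v y) \<le> exp (1 / 4 + \<mu>) * (LINT y|M. v y) * s ^ DIM('a)"
proof -
  define n where "n = real DIM('a)"
  define Q where "Q y = (y - x) \<bullet> (y - x)" for y
  have Q0: "Q y \<ge> 0" for y by (simp add: Q_def)
  \<comment> \<open>Up to a constant factor this is exp(\<mu> t) times the heat kernel at time t =
    r^2. The power t^(- n / 2) = r^(- n) is written exp(- n ln r), so that k is a Gaussian in y to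
    which \<open>gaussian\<close> applies.\<close>
  define k where "k r y = exp (\<mu> * r\<^sup>2 - n * ln r - 1 / (4 * r\<^sup>2) * Q y)" for r y
  define k' where "k' r y = k r y * (2 * \<mu> * r - n / r + Q y / (2 * r^3))" for r y
  have kpos: "k r y > 0" for r y by (simp add: k_def)
  have D: "((\<lambda>r. k r y) has_real_derivative k' r y) (at r)" if "r > 0" for r y
    unfolding k_def k'_def using that
    by (auto intro!: derivative_eq_intros simp: field_simps power2_eq_square power3_eq_cube)
  have sm: "smooth (k r)" for r
    unfolding k_def Q_def by (rule gaussian(1))
  \<comment> \<open>The factor 2 r is dt / dr for t = r^2.\<close>
  have lap: "2 * r * (laplacian (k r) y + \<mu> * k r y) = k' r y" if "r > 0" for r y
  proof -
    have "laplacian (k r) y = k r y * (4 * (1 / (4 * r\<^sup>2))\<^sup>2 * Q y - 2 * (1 / (4 * r\<^sup>2)) * n)"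
      unfolding k_def Q_def n_def by (rule gaussian(2))
    then show ?thesis using that unfolding k'_def by (simp add: field_simps power2_eq_square power3_eq_cube)
  qed
  have Qc: "continuous_on UNIV Q" unfolding Q_def by (intro continuous_intros)
  have kc: "continuous_on UNIV (k r)" for r by (rule smoothD(3)[OF sm])
  have k'c: "continuous_on UNIV (k' r)" if "r > 0" for r
    unfolding k'_def using that by (intro continuous_intros kc Qc) auto
  have vk: "integrable M (\<lambda>y. v y * k r y)" for r
  proof -
    obtain C where C: "\<And>y. y \<in> \<Omega> \<Longrightarrow> norm (k r y) \<le> C" using continuous_bounded_on[OF kc] by blast
    show ?thesis
    proof (rule Bochner_Integration.integrable_bound[of M "\<lambda>y. v y * C"])
      show "AE y in M. norm (v y * k r y) \<le> norm (v y * C)"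
      proof (rule AE_M_I)
        fix y assume "y \<in> \<Omega>"
        from C[OF this] kpos[of r y] have "\<bar>k r y\<bar> \<le> \<bar>C\<bar>" by simp
        then show "norm (v y * k r y) \<le> norm (v y * C)" by (simp add: abs_mult mult_left_mono)
      qed
    qed (use v continuous_measurable[OF kc] in auto)
  qed
  define F where "F r = (LINT y|M. v y * k r y)" for r
  have FD: "\<exists>d. (F has_real_derivative d) (at r) \<and> 0 \<le> d" if r: "s \<le> r" "r \<le> 1" for r
  proof -
    have cont: "continuous_on ({s/2..2} \<times> closure \<Omega>) (\<lambda>p. k' (fst p) (snd p))"
      unfolding k'_def k_def using s
      by (intro continuous_intros continuous_on_compose2[OF Qc]) (auto simp: zero_less_mult_iff)
    have "compact ((\<lambda>p. k' (fst p) (snd p)) ` ({s/2..2} \<times> closure \<Omega>))"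
      using bounded_Omega by (intro compact_continuous_image[OF cont] compact_Times) auto
    then obtain C where C: "\<forall>z\<in>(\<lambda>p. k' (fst p) (snd p)) ` ({s/2..2} \<times> closure \<Omega>). norm z \<le> C"
      using compact_imp_bounded bounded_iff by metis
    have "((\<lambda>r. LINT y|M. v y * k r y) has_real_derivative (LINT y|M. v y * k' r y)) (at r)"
    proof (rule DERIV_integral[OF v(1), of "s / 2" _ 2])
      show "\<bar>k' t y\<bar> \<le> C" if "s / 2 < t" "t < 2" "y \<in> \<Omega>" for t y
      proof -
        have "(t, y) \<in> {s/2..2} \<times> closure \<Omega>" using that closure_subset[of \<Omega>] by auto
        then show ?thesis using C by force
      qed
    qed (use r s D vk continuous_measurable[OF kc] continuous_measurable[OF k'c] in auto)
    moreover have "0 \<le> (LINT y|M. v y * k' r y)"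
    proof -
      have r0: "r > 0" using r s by simp
      have "0 \<le> 2 * r * (LINT y|M. v y * (laplacian (k r) y + \<mu> * k r y))"
        using sub[OF sm[of r]] kpos r0 by (simp add: less_imp_le)
      also have "\<dots> = (LINT y|M. v y * k' r y)"
      proof -
        have "(LINT y|M. v y * k' r y) = (LINT y|M. (2 * r) * (v y * (laplacian (k r) y + \<mu> * k r y)))"
          unfolding lap[OF r0, symmetric] by (simp only: mult.left_commute[of "v _"] mult.assoc)
        then show ?thesis by simp
      qed
      finally show ?thesis .
    qed
    ultimately show ?thesis unfolding F_def by blast
  qed
  have "F s \<le> F 1" by (rule DERIV_nonneg_imp_nondecreasing[OF s(2) FD])
  \<comment> \<open>At time 1 the kernel is at most exp \<mu>.\<close>
  also have "F 1 \<le> (LINT y|M. v y * exp \<mu>)"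
    unfolding F_def
  proof (rule integral_mono[OF vk])
    show "v y * k 1 y \<le> v y * exp \<mu>" for y
      using v(2)[of y] Q0[of y] by (intro mult_left_mono) (auto simp: k_def)
  qed (use v(1) in simp)
  finally have F1: "F s \<le> exp \<mu> * (LINT y|M. v y)" by (simp add: mult.commute)
  have sn: "s ^ DIM('a) > 0" using s by simp
  have ib: "integrable M (\<lambda>y. indicator (ball x s) y * v y)"
    by (rule Bochner_Integration.integrable_bound[OF v(1)])
       (use v(1) ball_indicator_measurable[of x s] in \<open>auto simp: indicator_def\<close>)
  \<comment> \<open>At time s^2 the kernel is at least s^(- n) exp(- 1 / 4) on the ball of radius s,
    where Q \<le> s^2. This is the origin of the factor exp(1 / 4).\<close>
  have "(LINT y|M. exp (- (1 / 4)) * (indicator (ball x s) y * v y)) \<le> (LINT y|M. s ^ DIM('a) * (v y * k s y))"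
  proof (rule integral_mono)
    fix y
    show "exp (- (1 / 4)) * (indicator (ball x s) y * v y) \<le> s ^ DIM('a) * (v y * k s y)"
    proof (cases "y \<in> ball x s")
      case True
      have "Q y \<le> s\<^sup>2"
      proof -
        have "norm (y - x) \<le> s" using True by (simp add: dist_norm norm_minus_commute)
        from power_mono[OF this norm_ge_zero, of 2] show ?thesis by (simp add: Q_def power2_norm_eq_inner)
      qed
      then have "1 / (4 * s\<^sup>2) * Q y \<le> 1 / 4" using s by (simp add: field_simps)
      moreover have "\<mu> * s\<^sup>2 \<ge> 0" using \<mu> by simp
      ultimately have "exp (- (n * ln s)) * exp (- (1 / 4)) \<le> k s y"
        unfolding k_def exp_add[symmetric] by simp
      moreover have "exp (- (n * ln s)) = inverse (s ^ DIM('a))"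
        using s by (simp add: exp_minus n_def exp_of_nat_mult)
      ultimately have "exp (- (1 / 4)) \<le> s ^ DIM('a) * k s y"
        using sn by (simp add: field_simps)
      from mult_right_mono[OF this v(2)[of y]] True show ?thesis by (simp add: mult.assoc mult.commute[of "v y"])
    next
      case False
      then show ?thesis using v(2)[of y] kpos[of s y] sn by simp
    qed
  qed (use ib vk in auto)
  then have "exp (- (1 / 4)) * (LINT y|M. indicator (ball x s) y * v y) \<le> s ^ DIM('a) * F s"
    by (simp add: F_def)
  also have "\<dots> \<le> s ^ DIM('a) * (exp \<mu> * (LINT y|M. v y))" using F1 sn by (intro mult_left_mono) auto
  finally have "exp (1 / 4) * (exp (- (1 / 4)) * (LINT y|M. indicator (ball x s) y * v y)) \<le>
      exp (1 / 4) * (s ^ DIM('a) * (exp \<mu> * (LINT y|M. v y)))" by (intro mult_left_mono) auto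
  moreover have "exp (1 / 4) * (exp (- (1 / 4)) * I) = I" for I :: real
    using exp_minus_inverse[of "1 / 4 :: real"] by (simp add: mult.assoc[symmetric])
  ultimately show ?thesis by (simp only: exp_add mult_ac)
qed

text \<open>The averages of \<open>u\<close> over small balls are uniformly bounded and converge to \<open>u\<close> in \<open>L\<^sup>2\<close>.\<close>

lemma eigenfunction_bounded:
  assumes u: "u \<in> H1_0 \<Omega>" and \<mu>: "\<mu> \<ge> 0"
    and eig: "\<And>\<phi>. \<phi> \<in> H1_0 \<Omega> \<Longrightarrow> (LINT x|M. weak_gradient \<Omega> u x \<bullet> weak_gradient \<Omega> \<phi> x) = \<mu> * (LINT x|M. u x * \<phi> x)"
  shows "u \<in> L_infinity \<Omega>"
proof -
  define w where "w = weak_gradient \<Omega> u"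
  obtain \<phi> where A: "H1_approx \<Omega> u w \<phi>" using H1_0_approx[OF u] unfolding w_def by blast
  have t: "\<phi> n \<in> test_functions \<Omega>" for n using A by (simp add: H1_approx_def)
  note ts = test_function_sq_integrable[OF t]
  note us = H1_0_sq_integrable(1)[OF u]
  note um[measurable] = sq_integrable_measurable[OF us]
  have ws: "sq_integrable M w" using H1_0_sq_integrable(2)[OF u] by (simp add: w_def)
  have ia: "integrable M (\<lambda>x. \<bar>u x\<bar>)" using sq_integrable_integrable[OF us] by simp
  define V1 where "V1 = measure lborel (ball (0::'a) 1)"
  have V1: "V1 > 0" unfolding V1_def by (rule ball_volume_pos) simp
  have V: "measure lborel (ball (0::'a) r) = r ^ DIM('a) * V1" if "r > 0" for r
    unfolding V1_def using content_ball_conv_unit_ball[of r "0::'a"] that by simp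
  \<comment> \<open>The volume of a ball is r^n V1 with n the dimension, so the powers of r in
    \<open>subsolution_ball_integral\<close> cancel and K is independent of r.\<close>
  define K where "K = exp (1 / 4 + \<mu>) * (LINT y|M. \<bar>u y\<bar>) / V1"
  have avg: "\<bar>ball_average \<Omega> r u x\<bar> \<le> K" if r: "0 < r" "r \<le> 1" for r x
  proof -
    have "\<bar>LINT y|M. indicator (ball x r) y * u y\<bar> \<le> (LINT y|M. \<bar>indicator (ball x r) y * u y\<bar>)"
      by (rule integral_abs_bound)
    also have "\<dots> = (LINT y|M. indicator (ball x r) y * \<bar>u y\<bar>)" by (simp add: abs_mult)
    also have "\<dots> \<le> exp (1 / 4 + \<mu>) * (LINT y|M. \<bar>u y\<bar>) * r ^ DIM('a)"
      by (rule subsolution_ball_integral[OF ia _ \<mu> _ r]) (use abs_eigenfunction_subsolution[OF u eig] in auto)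
    finally have le: "\<bar>LINT y|M. indicator (ball x r) y * u y\<bar> \<le> exp (1 / 4 + \<mu>) * (LINT y|M. \<bar>u y\<bar>) * r ^ DIM('a)" .
    have p: "r ^ DIM('a) > 0" using r by simp
    have "\<bar>ball_average \<Omega> r u x\<bar> = \<bar>LINT y|M. indicator (ball x r) y * u y\<bar> / (r ^ DIM('a) * V1)"
      unfolding ball_average_def V[OF r(1)] abs_divide using p V1 by (simp add: abs_mult)
    also have "\<dots> \<le> exp (1 / 4 + \<mu>) * (LINT y|M. \<bar>u y\<bar>) * r ^ DIM('a) / (r ^ DIM('a) * V1)"
      using le p V1 by (intro divide_right_mono) auto
    also have "\<dots> = K" using r by (simp add: K_def)
    finally show ?thesis .
  qed
  \<comment> \<open>The excess of |u| over K; the rest of the proof shows that its L^2 norm is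
    zero.\<close>
  define h where "h x = max 0 (\<bar>u x\<bar> - K)" for x
  have hm[measurable]: "h \<in> borel_measurable M" unfolding h_def by measurable
  have hs: "sq_integrable M h"
  proof (rule sq_integrable_bound[OF hm, of "\<lambda>x. 2 * (u x)\<^sup>2 + 2 * K\<^sup>2"])
    show "integrable M (\<lambda>x. 2 * (u x)\<^sup>2 + 2 * K\<^sup>2)" using us by (simp add: sq_integrable_def)
    have "(h x)\<^sup>2 \<le> 2 * (u x)\<^sup>2 + 2 * K\<^sup>2" for x
    proof -
      have "\<bar>h x\<bar> \<le> \<bar>u x\<bar> + \<bar>K\<bar>" by (simp add: h_def)
      from power_mono[OF this abs_ge_zero, of 2] have "(h x)\<^sup>2 \<le> (\<bar>u x\<bar> + \<bar>K\<bar>)\<^sup>2" by simp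
      also have "\<dots> \<le> 2 * (u x)\<^sup>2 + 2 * K\<^sup>2" using norm_add_square_le[of "\<bar>u x\<bar>" "\<bar>K\<bar>"] by simp
      finally show ?thesis .
    qed
    then show "AE x in M. (norm (h x))\<^sup>2 \<le> 2 * (u x)\<^sup>2 + 2 * K\<^sup>2" by simp
  qed
  have hr: "sq_int M h \<le> 4 * r\<^sup>2 * sq_int M w" if r: "0 < r" "r \<le> 1" for r
  proof -
    define Vr where "Vr = measure lborel (ball (0::'a) r)"
    have Vr: "Vr > 0" unfolding Vr_def by (rule ball_volume_pos[OF r(1)])
    define a where "a n = sq_int M (\<lambda>x. \<phi> n x - u x)" for n
    define d where "d n = sqrt (a n) / sqrt Vr" for n
    \<comment> \<open>The excess is at most the sum of |\<phi> n - u|, the distance of \<phi> n to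
      its average, and the average of \<phi> n - u in absolute value. The detour over \<phi> n is
      due to \<open>ball_average_close\<close>, which concerns test functions; n tends to infinity
      before r tends to 0.\<close>
    have step: "sq_int M h \<le> 4 * a n + 4 * (r\<^sup>2 * sq_int M (grad (\<phi> n))) + 2 * ((d n)\<^sup>2 * measure M (space M))" for n
    proof -
      let ?e = "\<lambda>x. \<phi> n x - ball_average \<Omega> r (\<phi> n) x"
      have c1: "sq_integrable M (\<lambda>x. \<phi> n x - u x)" by (intro sq_integrable_diff ts us)
      have c2: "sq_integrable M ?e"
        by (intro sq_integrable_diff ts continuous_sq_integrable ball_average_continuous[OF r(1) t])
      have pt: "(h x)\<^sup>2 \<le> 4 * (\<phi> n x - u x)\<^sup>2 + 4 * (?e x)\<^sup>2 + 2 * (d n)\<^sup>2" for x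
      proof -
        have "\<bar>ball_average \<Omega> r (\<lambda>y. \<phi> n y - u y) x\<bar> \<le> d n"
          unfolding d_def a_def Vr_def by (rule ball_average_bound[OF r(1) c1])
        then have "\<bar>ball_average \<Omega> r (\<phi> n) x - ball_average \<Omega> r u x\<bar> \<le> d n"
          by (simp add: ball_average_diff[OF ts(1) us])
        then have "\<bar>u x\<bar> - K \<le> (\<bar>\<phi> n x - u x\<bar> + \<bar>?e x\<bar>) + d n" using avg[OF r, of x] by linarith
        moreover have "d n \<ge> 0" using Vr by (simp add: d_def a_def)
        ultimately have "\<bar>h x\<bar> \<le> (\<bar>\<phi> n x - u x\<bar> + \<bar>?e x\<bar>) + d n" by (simp add: h_def)
        from power_mono[OF this abs_ge_zero, of 2] have "(h x)\<^sup>2 \<le> ((\<bar>\<phi> n x - u x\<bar> + \<bar>?e x\<bar>) + d n)\<^sup>2" by simp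
        also have "\<dots> \<le> 2 * (\<bar>\<phi> n x - u x\<bar> + \<bar>?e x\<bar>)\<^sup>2 + 2 * (d n)\<^sup>2"
          using norm_add_square_le[of "\<bar>\<phi> n x - u x\<bar> + \<bar>?e x\<bar>" "d n"] by simp
        also have "\<dots> \<le> 4 * (\<phi> n x - u x)\<^sup>2 + 4 * (?e x)\<^sup>2 + 2 * (d n)\<^sup>2"
          using norm_add_square_le[of "\<bar>\<phi> n x - u x\<bar>" "\<bar>?e x\<bar>"] by simp
        finally show ?thesis .
      qed
      have "sq_int M h \<le> (LINT x|M. 4 * (\<phi> n x - u x)\<^sup>2 + 4 * (?e x)\<^sup>2 + 2 * (d n)\<^sup>2)"
        unfolding sq_int_def using pt hs c1 c2 by (intro integral_mono) (auto simp: sq_integrable_def)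
      also have "\<dots> = 4 * a n + 4 * sq_int M ?e + 2 * ((d n)\<^sup>2 * measure M (space M))"
        using c1 c2 by (simp add: sq_integrable_def sq_int_def a_def mult.commute)
      finally show ?thesis using ball_average_close[OF r(1) t, of n] by simp
    qed
    have a0: "a \<longlonglongrightarrow> 0" using A by (simp add: H1_approx_def a_def[abs_def])
    have g0: "(\<lambda>n. sq_int M (grad (\<phi> n))) \<longlonglongrightarrow> sq_int M w"
      using A ts(2) ws by (intro sq_int_tendsto) (auto simp: H1_approx_def)
    have "d \<longlonglongrightarrow> sqrt 0 / sqrt Vr" unfolding d_def by (intro tendsto_intros a0) (use Vr in simp)
    then have d0: "d \<longlonglongrightarrow> 0" by simp
    have "(\<lambda>n. 4 * a n + 4 * (r\<^sup>2 * sq_int M (grad (\<phi> n))) + 2 * ((d n)\<^sup>2 * measure M (space M))) \<longlonglongrightarrow>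
        4 * 0 + 4 * (r\<^sup>2 * sq_int M w) + 2 * (0\<^sup>2 * measure M (space M))"
      by (intro tendsto_intros a0 g0 d0)
    then have "sq_int M h \<le> 4 * 0 + 4 * (r\<^sup>2 * sq_int M w) + 2 * (0\<^sup>2 * measure M (space M))"
      by (rule LIMSEQ_le_const) (use step in blast)
    then show ?thesis by simp
  qed
  have "(\<lambda>n. 4 * (inverse (real (Suc n)))\<^sup>2 * sq_int M w) \<longlonglongrightarrow> 4 * 0\<^sup>2 * sq_int M w"
    by (intro tendsto_intros LIMSEQ_inverse_real_of_nat)
  then have "sq_int M h \<le> 4 * 0\<^sup>2 * sq_int M w"
  proof (rule LIMSEQ_le_const)
    show "\<exists>N. \<forall>n\<ge>N. sq_int M h \<le> 4 * (inverse (real (Suc n)))\<^sup>2 * sq_int M w"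
      by (intro exI allI impI hr) (auto simp: inverse_le_1_iff)
  qed
  then have "sq_int M h = 0" using sq_int_nonneg[of M h] by simp
  then have "AE x in M. h x = 0" using sq_int_eq_zero_iff[OF hs] by simp
  then have "AE x in M. \<bar>u x\<bar> \<le> K" by eventually_elim (simp add: h_def max_def split: if_splits)
  then show ?thesis unfolding L_infinity_def using um by blast
qed

section \<open>A nontrivial solution above the first eigenvalue, and the theorem\<close>

lemma nontrivial_solution_exists:
  assumes ne: "\<Omega> \<noteq> {}" and lam: "lam \<ge> first_dirichlet_eigenvalue \<Omega>"
  shows "\<exists>f. locally_Lipschitz f \<and> nonpositive_primitive f \<and>
    (\<exists>u. bounded_weak_solution \<Omega> lam f u \<and> \<not> zero_ae_on \<Omega> u)"
proof -
  define \<mu> where "\<mu> = first_dirichlet_eigenvalue \<Omega>"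
  obtain u where u: "u \<in> H1_0 \<Omega>" "\<not> zero_ae_on \<Omega> u" "\<mu> \<ge> 0"
    "\<And>\<phi>. \<phi> \<in> H1_0 \<Omega> \<Longrightarrow> (LINT x|M. weak_gradient \<Omega> u x \<bullet> weak_gradient \<Omega> \<phi> x) = \<mu> * (LINT x|M. u x * \<phi> x)"
    using first_eigenfunction_exists[OF ne] unfolding \<mu>_def by blast
  define f where "f s = - (lam - \<mu>) * s" for s :: real
  have "\<bar>lam - \<mu>\<bar>-lipschitz_on X f" for X
    by (rule lipschitz_onI) (auto simp: f_def dist_real_def abs_mult[symmetric] right_diff_distrib abs_minus_commute)
  then have f1: "locally_Lipschitz f" unfolding locally_Lipschitz_def using zero_less_one by blast
  have f2: "nonpositive_primitive f"
    unfolding nonpositive_primitive_def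
  proof
    fix s :: real
    define F where "F = (\<lambda>x::real. LBINT t=ereal 0..ereal x. f t)"
    have fc: "continuous_on UNIV f" unfolding f_def by (intro continuous_intros)
    \<comment> \<open>The primitive of f is - (lam - \<mu>) x^2 / 2, so this sum is
      constant.\<close>
    have "((\<lambda>x. F x + (lam - \<mu>) / 2 * x\<^sup>2) has_real_derivative 0) (at x)" for x
      unfolding F_def
      by (rule DERIV_cong[OF DERIV_add[OF interval_integral_DERIV[OF fc]]]) (auto intro!: derivative_eq_intros simp: f_def field_simps)
    then have "F s + (lam - \<mu>) / 2 * s\<^sup>2 = F 0 + (lam - \<mu>) / 2 * 0\<^sup>2"
      by (intro DERIV_isconst_all) auto
    moreover have "F 0 = 0" by (simp add: F_def)
    moreover have "(lam - \<mu>) / 2 * s\<^sup>2 \<ge> 0" using lam by (simp add: \<mu>_def)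
    ultimately show "(LBINT t=ereal 0..ereal s. f t) \<le> 0" unfolding F_def by simp
  qed
  have "bounded_weak_solution \<Omega> lam f u"
    unfolding bounded_weak_solution_def
  proof (intro conjI ballI IntI)
    show "u \<in> L_infinity \<Omega>" by (rule eigenfunction_bounded[OF u(1,3,4)])
    fix \<phi> assume \<phi>: "\<phi> \<in> H1_0 \<Omega>"
    have "(LINT x|M. f (u x) * \<phi> x) = - (lam - \<mu>) * (LINT x|M. u x * \<phi> x)"
      by (simp add: f_def mult.assoc)
    then show "(LINT x|M. weak_gradient \<Omega> u x \<bullet> weak_gradient \<Omega> \<phi> x) =
        lam * (LINT x|M. u x * \<phi> x) + (LINT x|M. f (u x) * \<phi> x)"
      using u(4)[OF \<phi>] by (simp add: algebra_simps)
  qed (rule u(1))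
  with f1 f2 u(2) show ?thesis by blast
qed

end

theorem lemma2p1:
  fixes \<Omega> :: "'a::euclidean_space set" and lam :: real
  assumes "smooth_bounded_domain \<Omega>"
  shows "(lam \<le> 0 \<longrightarrow>
           (\<forall>f. locally_Lipschitz f \<and> nonpositive_primitive f \<longrightarrow>
              bounded_weak_solution \<Omega> lam f (\<lambda>x. 0) \<and>
              (\<forall>u. bounded_weak_solution \<Omega> lam f u \<longrightarrow> zero_ae_on \<Omega> u))) \<and>
         (lam \<ge> first_dirichlet_eigenvalue \<Omega> \<longrightarrow>
           (\<exists>f. locally_Lipschitz f \<and> nonpositive_primitive f \<and>
              (\<exists>u. bounded_weak_solution \<Omega> lam f u \<and> \<not> zero_ae_on \<Omega> u)))"
proof -
  interpret bounded_open \<Omega>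
    using assms by unfold_locales (auto simp: smooth_bounded_domain_def)
  have "\<Omega> \<noteq> {}" using assms by (simp add: smooth_bounded_domain_def)
  then show ?thesis using zero_unique_solution nontrivial_solution_exists by blast
qed

end
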